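(* Let $\mathbb{X}$ be a finite-dimensional Euclidean space, $\mathbb{A},\mathbb{B}$ nonempty compact subsets of finite-dimensional Euclidean spaces, and $f:\mathbb{X}\times\mathbb{A}\times\mathbb{B}\to\mathbb{X}$, $g:\mathbb{X}\times\mathbb{A}\times\mathbb{B}\to[0,1]$ continuous with $\|f(x,a,b)-f(y,a,b)\|+|g(x,a,b)-g(y,a,b)|\le L\|x-y\|$ for some $L>0$ and all $x,y,a,b$. For $x_*\in\mathbb{X}$ and Borel measurable bounded controls $a:\mathbb{R}_+\to\mathbb{A}$, $b:\mathbb{R}_+\to\mathbb{B}$ let $y(\cdot;x_*,a,b)$ be the solution of $\dot x=f(x,a(t),b(t))$, $x(0)=x_*$. Let $\Omega\subset\mathbb{X}$ be nonempty and strongly invariant: $y(t;x_*,a,b)\in\Omega$ for all $x_*\in\Omega$, $t\ge0$ and all such controls $a,b$. For $\varrho\in\mathfrak{D}$, $x_*\in\Omega$ define $$\mathcal{V}[\varrho](x_* )=\inf_{\alpha\in\mathcal{A}}\sup_{b}\int_0^\infty\varrho(t)g\big(y(t;x_*,\alpha(b),b),\alpha(b)(t),b(t)\big)dt,$$ the supremum being over all Borel measurable bounded $b:\mathbb{R}_+\to\mathbb{B}$. Then for every $U_*:\Omega\to[0,1]$ the following are equivalent: (c) for every density $\mu\in\mathfrak{D}$ piecewise continuous on $(0,\infty)$, $\lim_{\lambda\to+0}\sup_{\omega\in\Omega}|\mathcal{V}[\mu^\lambda_{\mathrm{scale}}](\omega)-U_*(\omega)|=0$; (u) $\lim_{T\to+\infty}\sup_\omega|\mathcal{V}[\varpi_T](\omega)-U_*(\omega)|=0$;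 (e) $\lim_{\lambda\to+0}\sup_\omega|\mathcal{V}[\pi_\lambda](\omega)-U_*(\omega)|=0$; (p) for some power density $\varrho\in\mathfrak{D}$, $\lim_{T\to+\infty}\sup_\omega|\mathcal{V}[\varrho^T_{\mathrm{shift}}](\omega)-U_*(\omega)|=0$; (q) this holds for every power density $\varrho\in\mathfrak{D}$. Moreover, if for some $\mu\in\mathfrak{D}$ piecewise continuous on $(0,\infty)$ and some power density $\varrho$ one of the limits $\lim_{T\to\infty}\mathcal{V}[\varpi_T]$, $\lim_{\lambda\to+0}\mathcal{V}[\pi_\lambda]$, $\lim_{T\to\infty}\mathcal{V}[\varrho^T_{\mathrm{shift}}]$ exists uniformly on $\Omega$, then these and $\lim_{\lambda\to+0}\mathcal{V}[\mu^\lambda_{\mathrm{scale}}]$ all exist uniformly on $\Omega$, coincide and do not depend on the choice of $\mu$ and $\varrho$.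
   Context: $\mathbb{R}_+=[0,\infty)$. A quasistrategy (Elliott–Kalton strategy) of the first player is a map $\alpha$ from the set of Borel measurable bounded $b:\mathbb{R}_+\to\mathbb{B}$ to the set of Borel measurable bounded $a:\mathbb{R}_+\to\mathbb{A}$ such that for every $t>0$, $b|_{[0,t]}=b'|_{[0,t]}$ implies $\alpha[b]|_{[0,t]}=\alpha[b']|_{[0,t]}$; $\mathcal{A}$ is the set of all quasistrategies. $\mathfrak{D}$: probability densities $\varrho:\mathbb{R}_+\to\mathbb{R}_+$. For $T>0$ with $\int_T^\infty\varrho>0$: $\varrho^T_{\mathrm{shift}}(t)=\varrho(t+T)/\int_T^\infty\varrho$; for $\lambda>0$: $\varrho^\lambda_{\mathrm{scale}}(t)=\lambda\varrho(\lambda t)$. $\varpi_T(t)=\frac1T1_{[0,T]}(t)$, $\pi_\lambda(t)=\lambda e^{-\lambda t}$. A power density is $\varrho\in\mathfrak{D}$ with $\varrho(t)=(\alpha+\beta t)^{-\gamma}$ for some $\alpha,\beta,\gamma>0$. *)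

theory Defs
  imports "HOL-Analysis.Analysis"
begin

text \<open>Time is real; only the half-line {0..} matters. Controls are taken
  extensional on {0..} (value undefined at negative times), so that a control
  is exactly a function on R_+.\<close>

definition control :: "'a::euclidean_space set \<Rightarrow> (real \<Rightarrow> 'a) \<Rightarrow> bool" where
  "control A a \<longleftrightarrow> a \<in> borel_measurable (restrict_space borel {0..})
     \<and> bounded (a ` {0..}) \<and> a ` {0..} \<subseteq> A \<and> a \<in> extensional {0..}"

text \<open>Caratheodory solution of  x' = f(x,a(t),b(t)), x(0) = x0  on R_+;
  normalised to be constant x0 at negative times so that it is unique.\<close>

definition is_traj ::
  "('x::euclidean_space \<Rightarrow> 'a \<Rightarrow> 'b \<Rightarrow> 'x) \<Rightarrow> 'x \<Rightarrow> (real \<Rightarrow> 'a) \<Rightarrow> (real \<Rightarrow> 'b)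
     \<Rightarrow> (real \<Rightarrow> 'x) \<Rightarrow> bool" where
  "is_traj f x0 a b y \<longleftrightarrow> continuous_on {0..} y \<and> (\<forall>t<0. y t = x0) \<and>
     (\<forall>t\<ge>0. (\<lambda>s. f (y s) (a s) (b s)) integrable_on {0..t} \<and>
             y t = x0 + integral {0..t} (\<lambda>s. f (y s) (a s) (b s)))"

definition traj ::
  "('x::euclidean_space \<Rightarrow> 'a \<Rightarrow> 'b \<Rightarrow> 'x) \<Rightarrow> 'x \<Rightarrow> (real \<Rightarrow> 'a) \<Rightarrow> (real \<Rightarrow> 'b)
     \<Rightarrow> real \<Rightarrow> 'x" where
  "traj f x0 a b = (THE y. is_traj f x0 a b y)"

definition quasistrategy ::
  "'a::euclidean_space set \<Rightarrow> 'b::euclidean_space set \<Rightarrow> ((real \<Rightarrow> 'b) \<Rightarrow> (real \<Rightarrow> 'a)) \<Rightarrow> bool" where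
  "quasistrategy A B \<alpha> \<longleftrightarrow>
     (\<forall>b. control B b \<longrightarrow> control A (\<alpha> b)) \<and>
     (\<forall>b b' t. control B b \<longrightarrow> control B b' \<longrightarrow> t > 0 \<longrightarrow>
        (\<forall>s\<in>{0..t}. b s = b' s) \<longrightarrow> (\<forall>s\<in>{0..t}. \<alpha> b s = \<alpha> b' s))"

definition prob_density :: "(real \<Rightarrow> real) \<Rightarrow> bool" where
  "prob_density \<rho> \<longleftrightarrow> (\<forall>t\<ge>0. \<rho> t \<ge> 0) \<and> set_integrable lborel {0..} \<rho>
     \<and> (LINT t:{0..}|lborel. \<rho> t) = 1"

definition shift_density :: "(real \<Rightarrow> real) \<Rightarrow> real \<Rightarrow> real \<Rightarrow> real" where
  "shift_density \<rho> T t = \<rho> (t + T) / (LINT s:{T..}|lborel. \<rho> s)"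

definition scale_density :: "(real \<Rightarrow> real) \<Rightarrow> real \<Rightarrow> real \<Rightarrow> real" where
  "scale_density \<rho> l t = l * \<rho> (l * t)"

definition uniform_density :: "real \<Rightarrow> real \<Rightarrow> real" where
  "uniform_density T t = (1 / T) * indicator {0..T} t"

definition exp_density :: "real \<Rightarrow> real \<Rightarrow> real" where
  "exp_density l t = l * exp (- l * t)"

definition power_density :: "(real \<Rightarrow> real) \<Rightarrow> bool" where
  "power_density \<rho> \<longleftrightarrow> prob_density \<rho> \<and>
     (\<exists>\<alpha> \<beta> \<gamma>. \<alpha> > 0 \<and> \<beta> > 0 \<and> \<gamma> > 0 \<and> (\<forall>t\<ge>0. \<rho> t = (\<alpha> + \<beta> * t) powr (- \<gamma>)))"

definition piecewise_cont_pos :: "(real \<Rightarrow> real) \<Rightarrow> bool" where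
  "piecewise_cont_pos \<rho> \<longleftrightarrow> (\<forall>c d. 0 < c \<longrightarrow> finite {t\<in>{c..d}. \<not> isCont \<rho> t})"

definition game_value ::
  "'a::euclidean_space set \<Rightarrow> 'b::euclidean_space set \<Rightarrow> ('x::euclidean_space \<Rightarrow> 'a \<Rightarrow> 'b \<Rightarrow> 'x)
     \<Rightarrow> ('x \<Rightarrow> 'a \<Rightarrow> 'b \<Rightarrow> real) \<Rightarrow> (real \<Rightarrow> real) \<Rightarrow> 'x \<Rightarrow> real" where
  "game_value A B f g \<rho> x0 =
     (INF \<alpha>\<in>{\<alpha>. quasistrategy A B \<alpha>}. SUP b\<in>{b. control B b}.
        LINT t:{0..}|lborel. \<rho> t * g (traj f x0 (\<alpha> b) b t) (\<alpha> b t) (b t))"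

definition unif_conv :: "'x set \<Rightarrow> (real \<Rightarrow> 'x \<Rightarrow> real) \<Rightarrow> ('x \<Rightarrow> real) \<Rightarrow> real filter \<Rightarrow> bool" where
  "unif_conv \<Omega> V U F \<longleftrightarrow> ((\<lambda>s. SUP \<omega>\<in>\<Omega>. \<bar>V s \<omega> - U \<omega>\<bar>) \<longlongrightarrow> 0) F"

end

theory Submission
  imports Defs "HOL-Real_Asymp.Real_Asymp"
begin

text \<open>
  The value \<open>V[\<rho>]\<close> is 1-Lipschitz in the \<open>L\<^sup>1\<close> norm of \<open>\<rho>\<close>, and by the dynamic programming
  principle it is the value of the game with running payoff \<open>\<integral>\<^sub>0\<^sup>\<tau> \<rho> g\<close> and terminal payoff
  \<open>V[\<rho>(\<cdot> + \<tau>)](y(\<tau>))\<close>. Fix \<open>U\<close> and call an integrable \<open>\<psi> \<ge> 0\<close> convergent if the value of its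
  rescalings tends to \<open>(\<integral>\<psi>) U\<close> uniformly on \<open>\<Omega>\<close>. Convergent densities are closed under
  \<open>L\<^sup>1\<close> limits, and if \<open>\<mu>\<close> and its tail \<open>\<mu>(\<cdot> + h)\<close> are convergent, then the tail may be exchanged
  for any convergent density of the same mass.

  The uniform, exponential and power densities are self-similar: their tails are multiples of their
  own rescalings. Hence, if one of them is convergent, then so is everything obtained by gluing
  together rescaled initial pieces of it. Short initial pieces are nearly constant, so these gluings
  are \<open>L\<^sup>1\<close>-dense among all densities, and therefore all densities are convergent. For a power
  density, shifting by \<open>T\<close> is itself a rescaling, by \<open>\<alpha> / (\<alpha> + \<beta> T)\<close>.
\<close>

section \<open>Integrals over the half-line\<close>

text \<open>The value is an inf-sup, hence not additive in the density: limits known for two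
  densities give no direct access to their sum or to a restriction. Exchanging a tail is the
  operation that remains. It is paid for with uniformity, since the position reached at the seam is
  unknown, and it requires tail and replacement to have equal mass. Therefore masses are left
  arbitrary and the limit is the mass times \<open>U\<close>. A target is built from its far end
  towards \<open>0\<close>: a fixed convergent tail is kept and short blocks are prepended one at a
  time. A block prescribes its length and its mass; an initial piece of the self-similar density has
  two free parameters, where it is cut and how it is stretched, and these are fitted to them. The
  cut lies close to \<open>0\<close> only if the block is light compared with what follows, which is
  why a tail of small but positive mass is attached to the target beforehand. The \<open>L1\<close>
  errors are proportional to block lengths, and these add up to a fixed horizon.\<close>

abbreviation hl_integrable :: "(real \<Rightarrow> real) \<Rightarrow> bool" where
  "hl_integrable \<rho> \<equiv> set_integrable lborel {0..} \<rho>"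

abbreviation mass :: "(real \<Rightarrow> real) \<Rightarrow> real" where
  "mass \<rho> \<equiv> (LINT t:{0..}|lborel. \<rho> t)"

text \<open>Changing a Borel function at one point keeps it Borel and alters it only on a null set.
  At every seam the first piece owns the endpoint, so a tail moved back to \<open>0\<close> is known
  only for \<open>t > 0\<close>.\<close>

lemma hl_integrable_cong_pos:
  assumes "hl_integrable \<rho>" "\<And>t. 0 < t \<Longrightarrow> \<rho> t = \<rho>' t"
  shows "hl_integrable \<rho>'"
proof -
  have m: "(\<lambda>x. indicator {0..} x *\<^sub>R \<rho> x) \<in> borel_measurable borel"
    using assms(1) unfolding set_integrable_def by (simp add: borel_measurable_integrable)
  have "(\<lambda>x. indicator {0..} x *\<^sub>R \<rho>' x)
      = (\<lambda>x. if x = 0 then \<rho>' 0 else indicator {0..} x *\<^sub>R \<rho> x)"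
    using assms(2) by (auto simp: indicator_def fun_eq_iff)
  moreover have "(\<lambda>x. if x = 0 then \<rho>' 0 else indicator {0..} x *\<^sub>R \<rho> x) \<in> borel_measurable borel"
    by (intro measurable_If m) auto
  ultimately have m': "(\<lambda>x. indicator {0..} x *\<^sub>R \<rho>' x) \<in> borel_measurable borel"
    by (simp only:)
  have "AE x in lborel. indicator {0..} x *\<^sub>R \<rho> x = indicator {0..} x *\<^sub>R \<rho>' x"
    using AE_lborel_singleton[of 0] by eventually_elim (use assms(2) in \<open>auto simp: indicator_def\<close>)
  then show ?thesis
    using assms(1) m m' unfolding set_integrable_def
    by (subst integrable_cong_AE[symmetric]) auto
qed

lemma mass_cong_pos:
  assumes "\<And>t. 0 < t \<Longrightarrow> \<rho> t = \<rho>' t"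
  shows "mass \<rho> = mass \<rho>'"
proof (cases "hl_integrable \<rho>")
  case True
  then have "hl_integrable \<rho>'"
    by (rule hl_integrable_cong_pos) (rule assms)
  with True have m: "(\<lambda>x. indicator {0..} x *\<^sub>R \<rho> x) \<in> borel_measurable lborel"
      "(\<lambda>x. indicator {0..} x *\<^sub>R \<rho>' x) \<in> borel_measurable lborel"
    unfolding set_integrable_def by (simp_all only: borel_measurable_integrable)
  have "AE x in lborel. indicator {0..} x *\<^sub>R \<rho> x = indicator {0..} x *\<^sub>R \<rho>' x"
    using AE_lborel_singleton[of 0] by eventually_elim (use assms in \<open>auto simp: indicator_def\<close>)
  then show ?thesis
    unfolding set_lebesgue_integral_def by (rule integral_cong_AE[OF m])
next
  case False
  \<comment> \<open>Both integrals then have the default value \<open>0\<close> of a non-integrable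
    function.\<close>
  have "\<not> hl_integrable \<rho>'"
  proof
    assume "hl_integrable \<rho>'"
    then have "hl_integrable \<rho>"
      by (rule hl_integrable_cong_pos) (rule assms[symmetric])
    then show False using False by simp
  qed
  then show ?thesis
    using False by (simp add: set_lebesgue_integral_def set_integrable_def not_integrable_integral_eq)
qed

lemma hl_integrable_scale:
  assumes "hl_integrable \<rho>" "l > 0"
  shows "hl_integrable (scale_density \<rho> l)"
proof -
  have "integrable lborel (\<lambda>x. indicator {0..} (0 + l * x) *\<^sub>R \<rho> (0 + l * x))"
    using assms lborel_integrable_real_affine[of "\<lambda>x. indicator {0..} x *\<^sub>R \<rho> x" l 0]
    by (simp add: set_integrable_def)
  then have "integrable lborel (\<lambda>x. l * (indicator {0..} (0 + l * x) *\<^sub>R \<rho> (0 + l * x)))"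
    by (rule integrable_mult_right)
  moreover have "(\<lambda>x. l * (indicator {0..} (0 + l * x) *\<^sub>R \<rho> (0 + l * x)))
      = (\<lambda>x. indicator {0..} x *\<^sub>R scale_density \<rho> l x)"
    using assms(2) by (auto simp: fun_eq_iff scale_density_def indicator_def zero_le_mult_iff)
  ultimately show ?thesis by (simp only: set_integrable_def)
qed

lemma mass_scale:
  assumes "l > 0"
  shows "mass (scale_density \<rho> l) = mass \<rho>"
proof -
  have "mass \<rho> = l * (LINT x|lborel. indicator {0..} (0 + l * x) *\<^sub>R \<rho> (0 + l * x))"
    using assms lborel_integral_real_affine[of l "\<lambda>x. indicator {0..} x *\<^sub>R \<rho> x" 0]
    by (simp add: set_lebesgue_integral_def)
  also have "\<dots> = (LINT x|lborel. l * (indicator {0..} (0 + l * x) *\<^sub>R \<rho> (0 + l * x)))"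
    by (rule integral_mult_right_zero[symmetric])
  also have "(\<lambda>x. l * (indicator {0..} (0 + l * x) *\<^sub>R \<rho> (0 + l * x)))
      = (\<lambda>x. indicator {0..} x *\<^sub>R scale_density \<rho> l x)"
    using assms by (auto simp: fun_eq_iff scale_density_def indicator_def zero_le_mult_iff)
  finally show ?thesis by (simp add: set_lebesgue_integral_def)
qed

lemma hl_integrable_shift_iff:
  "hl_integrable (\<lambda>t. \<rho> (t + \<tau>)) \<longleftrightarrow> set_integrable lborel {\<tau>..} \<rho>"
proof -
  have "(\<lambda>x. indicator {0..} x *\<^sub>R \<rho> (x + \<tau>)) = (\<lambda>x. indicator {\<tau>..} (\<tau> + 1 * x) *\<^sub>R \<rho> (\<tau> + 1 * x))"
    by (auto simp: fun_eq_iff indicator_def add.commute)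
  then show ?thesis
    using lborel_integrable_real_affine_iff[of 1 "\<lambda>x. indicator {\<tau>..} x *\<^sub>R \<rho> x" \<tau>]
    by (simp add: set_integrable_def)
qed

lemma mass_shift: "mass (\<lambda>t. \<rho> (t + \<tau>)) = (LINT t:{\<tau>..}|lborel. \<rho> t)"
proof -
  have "(\<lambda>x. indicator {0..} x *\<^sub>R \<rho> (x + \<tau>)) = (\<lambda>x. indicator {\<tau>..} (\<tau> + 1 * x) *\<^sub>R \<rho> (\<tau> + 1 * x))"
    by (auto simp: fun_eq_iff indicator_def add.commute)
  then show ?thesis
    using lborel_integral_real_affine[of 1 "\<lambda>x. indicator {\<tau>..} x *\<^sub>R \<rho> x" \<tau>]
    by (simp add: set_lebesgue_integral_def)
qed

lemma hl_integrable_shift: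
  assumes "hl_integrable \<rho>" "\<tau> \<ge> 0"
  shows "hl_integrable (\<lambda>t. \<rho> (t + \<tau>))"
  unfolding hl_integrable_shift_iff
  by (rule set_integrable_subset[OF assms(1)]) (use assms(2) in auto)

lemma set_integral_split_at:
  fixes \<rho> :: "real \<Rightarrow> real"
  assumes "hl_integrable \<rho>" "\<tau> \<ge> 0"
  shows "mass \<rho> = (LINT t:{0..\<tau>}|lborel. \<rho> t) + mass (\<lambda>t. \<rho> (t + \<tau>))"
proof -
  have *: "{0..\<tau>} \<union> {\<tau>..} = {0..}" using assms(2) by auto
  have "(LINT t:{0..\<tau>} \<union> {\<tau>..}|lborel. \<rho> t)
      = (LINT t:{0..\<tau>}|lborel. \<rho> t) + (LINT t:{\<tau>..}|lborel. \<rho> t)"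
  proof (rule set_integral_Un_AE)
    show "AE x in lborel. \<not> (x \<in> {0..\<tau>} \<and> x \<in> {\<tau>..})"
      using AE_lborel_singleton[of \<tau>] by eventually_elim auto
    show "set_integrable lborel {0..\<tau>} \<rho>" "set_integrable lborel {\<tau>..} \<rho>"
      by (rule set_integrable_subset[OF assms(1)]; use assms(2) in auto)+
  qed auto
  then show ?thesis by (simp add: * mass_shift)
qed

lemma hl_integrable_splice:
  assumes "set_integrable lborel {0..h} \<mu>" "hl_integrable \<psi>" "h \<ge> 0"
  shows "hl_integrable (\<lambda>t. if t \<le> h then \<mu> t else \<psi> (t - h))"
proof -
  let ?r = "\<lambda>t. if t \<le> h then \<mu> t else \<psi> (t - h)"
  have 1: "set_integrable lborel {0..h} ?r"
    using assms(1) set_integrable_cong[OF refl refl, of "{0..h}" ?r \<mu> lborel] by simp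
  have "hl_integrable (\<lambda>t. ?r (t + h))"
    by (rule hl_integrable_cong_pos[OF assms(2)]) auto
  then have 2: "set_integrable lborel {h..} ?r"
    using hl_integrable_shift_iff[of ?r h] by (simp only:)
  have "set_integrable lborel ({0..h} \<union> {h..}) ?r"
    by (rule set_integrable_Un[OF 1 2]) auto
  moreover have "{0..h} \<union> {h..} = {0..}" using assms(3) by auto
  ultimately show ?thesis by simp
qed

lemma mass_splice:
  assumes "set_integrable lborel {0..h} \<mu>" "hl_integrable \<psi>" "h \<ge> 0"
  shows "mass (\<lambda>t. if t \<le> h then \<mu> t else \<psi> (t - h)) = (LINT t:{0..h}|lborel. \<mu> t) + mass \<psi>"
proof -
  have "(LINT t:{0..h}|lborel. if t \<le> h then \<mu> t else \<psi> (t - h)) = (LINT t:{0..h}|lborel. \<mu> t)"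
    by (rule set_lebesgue_integral_cong) auto
  moreover have "mass (\<lambda>t. if t + h \<le> h then \<mu> (t + h) else \<psi> (t + h - h)) = mass \<psi>"
    by (rule mass_cong_pos) auto
  ultimately show ?thesis
    using set_integral_split_at[OF hl_integrable_splice[OF assms] assms(3)] by simp
qed

lemma mass_nonneg: "(\<And>t. t \<ge> 0 \<Longrightarrow> \<rho> t \<ge> 0) \<Longrightarrow> 0 \<le> mass \<rho>"
  unfolding set_lebesgue_integral_def by (rule integral_nonneg_AE) (auto simp: indicator_def)

lemma mass_mono:
  assumes "hl_integrable \<rho>" "hl_integrable \<rho>'" "\<And>t. t \<ge> 0 \<Longrightarrow> \<rho> t \<le> \<rho>' t"
  shows "mass \<rho> \<le> mass \<rho>'"
  by (rule set_integral_mono[OF assms(1,2)]) (use assms(3) in auto)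

lemma abs_mass_le:
  "hl_integrable \<rho> \<Longrightarrow> \<bar>mass \<rho>\<bar> \<le> mass (\<lambda>t. \<bar>\<rho> t\<bar>)"
  using set_integral_norm_bound[of lborel "{0..}" \<rho>] by simp

lemma hl_integrable_abs: "hl_integrable \<rho> \<Longrightarrow> hl_integrable (\<lambda>t. \<bar>\<rho> t\<bar>)"
  by (rule set_integrable_abs)

lemma mass_diff: "hl_integrable \<rho> \<Longrightarrow> hl_integrable \<rho>' \<Longrightarrow> mass (\<lambda>t. \<rho> t - \<rho>' t) = mass \<rho> - mass \<rho>'"
  by (rule set_integral_diff)

lemma mass_cmult: "mass (\<lambda>t. c * \<rho> t) = c * mass \<rho>"
  by (rule set_integral_mult_right)

section \<open>Controls\<close>

lemma control_iff:
  "control A a \<longleftrightarrow> (\<lambda>t. indicator {0..} t *\<^sub>R a t) \<in> borel_measurable borel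
     \<and> bounded (a ` {0..}) \<and> a ` {0..} \<subseteq> A \<and> a \<in> extensional {0..}"
  unfolding control_def by (subst borel_measurable_restrict_space_iff) auto

lemma control_in: "control A a \<Longrightarrow> t \<ge> 0 \<Longrightarrow> a t \<in> A"
  unfolding control_def by auto

text \<open>The instant \<open>\<tau>\<close> belongs to the first piece: a quasistrategy is constrained only on intervals
  \<open>[0, t]\<close> with \<open>t > 0\<close>, so its response at time \<open>0\<close> of the second piece may anticipate.\<close>

definition splice :: "real \<Rightarrow> (real \<Rightarrow> 'a) \<Rightarrow> (real \<Rightarrow> 'a) \<Rightarrow> real \<Rightarrow> 'a" where
  "splice \<tau> u v t = (if t \<le> \<tau> then u t else v (t - \<tau>))"

text \<open>\<open>restrict\<close> keeps the result extensional, as \<open>control\<close>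
  demands.\<close>

definition shift_control :: "real \<Rightarrow> (real \<Rightarrow> 'a) \<Rightarrow> real \<Rightarrow> 'a" where
  "shift_control \<tau> u = restrict (\<lambda>t. u (t + \<tau>)) {0..}"

lemma control_splice:
  assumes u: "control A u" and v: "control A v" and "\<tau> > 0"
  shows "control A (splice \<tau> u v)"
proof -
  have "(\<lambda>t. if t \<le> \<tau> then indicator {0..} t *\<^sub>R u t else indicator {0..} (t - \<tau>) *\<^sub>R v (t - \<tau>))
      \<in> borel_measurable borel"
    using u v by (intro measurable_If measurable_compose[of "\<lambda>t. t - \<tau>"
        borel borel "\<lambda>t. indicator {0..} t *\<^sub>R v t"]) (auto simp: control_iff)
  also have "(\<lambda>t. if t \<le> \<tau> then indicator {0..} t *\<^sub>R u t else indicator {0..} (t - \<tau>) *\<^sub>R v (t - \<tau>))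
      = (\<lambda>t. indicator {0..} t *\<^sub>R splice \<tau> u v t)"
    using \<open>\<tau> > 0\<close> by (auto simp: fun_eq_iff indicator_def splice_def)
  finally have m: "(\<lambda>t. indicator {0..} t *\<^sub>R splice \<tau> u v t) \<in> borel_measurable borel" .
  have sub: "splice \<tau> u v ` {0..} \<subseteq> u ` {0..} \<union> v ` {0..}"
    using \<open>\<tau> > 0\<close> by (auto simp: splice_def)
  have "bounded (u ` {0..} \<union> v ` {0..})"
    using u v by (simp add: control_def)
  then have "bounded (splice \<tau> u v ` {0..})"
    using sub bounded_subset by blast
  moreover have "splice \<tau> u v ` {0..} \<subseteq> A"
    using sub u v unfolding control_def by blast
  moreover have "splice \<tau> u v \<in> extensional {0..}"
    using u \<open>\<tau> > 0\<close> by (auto simp: control_def splice_def extensional_def)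
  ultimately show ?thesis using m by (simp add: control_iff)
qed

lemma control_shift:
  assumes u: "control A u" and "\<tau> \<ge> 0"
  shows "control A (shift_control \<tau> u)"
proof -
  have "(\<lambda>t. indicator {0..} (t + \<tau>) *\<^sub>R u (t + \<tau>)) \<in> borel_measurable borel"
    using u by (intro measurable_compose[of "\<lambda>t. t + \<tau>"
        borel borel "\<lambda>t. indicator {0..} t *\<^sub>R u t"]) (auto simp: control_iff)
  then have "(\<lambda>t. indicator {0..} t *\<^sub>R (indicator {0..} (t + \<tau>) *\<^sub>R u (t + \<tau>))) \<in> borel_measurable borel"
    by (rule borel_measurable_scaleR[rotated]) simp
  also have "(\<lambda>t. indicator {0..} t *\<^sub>R (indicator {0..} (t + \<tau>) *\<^sub>R u (t + \<tau>)))
      = (\<lambda>t. indicator {0..} t *\<^sub>R shift_control \<tau> u t)"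
    using \<open>\<tau> \<ge> 0\<close> by (auto simp: fun_eq_iff indicator_def shift_control_def)
  finally have m: "(\<lambda>t. indicator {0..} t *\<^sub>R shift_control \<tau> u t) \<in> borel_measurable borel" .
  have sub: "shift_control \<tau> u ` {0..} \<subseteq> u ` {0..}"
    using \<open>\<tau> \<ge> 0\<close> by (auto simp: shift_control_def)
  then have "bounded (shift_control \<tau> u ` {0..})"
    using u bounded_subset unfolding control_def by blast
  moreover have "shift_control \<tau> u ` {0..} \<subseteq> A"
    using sub u unfolding control_def by blast
  moreover have "shift_control \<tau> u \<in> extensional {0..}"
    by (simp add: shift_control_def)
  ultimately show ?thesis using m by (simp add: control_iff)
qed

lemma control_const: "c \<in> A \<Longrightarrow> control A (restrict (\<lambda>_. c) {0..})"
proof -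
  assume "c \<in> A"
  have "(\<lambda>t::real. indicator {0..} t *\<^sub>R restrict (\<lambda>_. c) {0..} t) = (\<lambda>t. indicator {0..} t *\<^sub>R c)"
    by (auto simp: fun_eq_iff indicator_def)
  then have "(\<lambda>t::real. indicator {0..} t *\<^sub>R restrict (\<lambda>_. c) {0..} t) \<in> borel_measurable borel"
    by simp
  with \<open>c \<in> A\<close> show ?thesis
    by (auto simp: control_iff image_constant_conv)
qed

text \<open>Continuity is available only on \<open>UNIV \<times> A \<times> B\<close>; restricting
  the codomain of the triple of state and controls to that set allows the composition. It serves
  both \<open>f\<close> and \<open>g\<close>.\<close>

lemma measurable_along:
  fixes h :: "'x::euclidean_space \<Rightarrow> 'a::euclidean_space \<Rightarrow> 'b::euclidean_space \<Rightarrow> 'c::euclidean_space"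
  assumes h: "continuous_on (UNIV \<times> A \<times> B) (\<lambda>(x, a, b). h x a b)"
    and y: "continuous_on {0..} y" and a: "control A a" and b: "control B b"
  shows "(\<lambda>t. h (y t) (a t) (b t)) \<in> borel_measurable (restrict_space borel {0..})"
proof -
  have "(\<lambda>t. (y t, a t, b t)) \<in> borel_measurable (restrict_space borel {0..})"
    using borel_measurable_continuous_on_restrict[OF y] a b
    by (intro borel_measurable_Pair) (auto simp: control_def)
  then have "(\<lambda>t. (y t, a t, b t)) \<in> measurable (restrict_space borel {0..}) (restrict_space borel (UNIV \<times> A \<times> B))"
    by (rule measurable_restrict_space2[rotated]) (use a b in \<open>auto simp: control_def\<close>)
  from measurable_compose[OF this borel_measurable_continuous_on_restrict[OF h]]
  show ?thesis by simp
qed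

section \<open>Trajectories\<close>

locale differential_game =
  fixes A :: "'a::euclidean_space set" and B :: "'b::euclidean_space set"
    and f :: "'x::euclidean_space \<Rightarrow> 'a \<Rightarrow> 'b \<Rightarrow> 'x"
    and g :: "'x \<Rightarrow> 'a \<Rightarrow> 'b \<Rightarrow> real"
    and L :: real
  assumes A: "compact A" "A \<noteq> {}"
    and B: "compact B" "B \<noteq> {}"
    and f_cont: "continuous_on (UNIV \<times> A \<times> B) (\<lambda>(x, a, b). f x a b)"
    and g_cont: "continuous_on (UNIV \<times> A \<times> B) (\<lambda>(x, a, b). g x a b)"
    and g_range: "\<And>x a b. a \<in> A \<Longrightarrow> b \<in> B \<Longrightarrow> g x a b \<in> {0..1}"
    and L: "L > 0"
    and Lip: "\<And>x y a b. a \<in> A \<Longrightarrow> b \<in> B \<Longrightarrow>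
               norm (f x a b - f y a b) + \<bar>g x a b - g y a b\<bar> \<le> L * norm (x - y)"
begin

lemma f_Lip: "a \<in> A \<Longrightarrow> b \<in> B \<Longrightarrow> norm (f x a b - f y a b) \<le> L * norm (x - y)"
  using Lip[of a b x y] by linarith

text \<open>Compactness bounds \<open>f\<close> at \<open>x = 0\<close> and the Lipschitz condition
  does the rest. The slope is again \<open>L\<close>, the rate that the weight
  \<open>exp (2 * L * s)\<close> below can absorb.\<close>

lemma f_linear_growth:
  "\<exists>M\<ge>0. \<forall>x. \<forall>a\<in>A. \<forall>b\<in>B. norm (f x a b) \<le> M + L * norm x"
proof -
  have "continuous_on (A \<times> B) ((\<lambda>(x, a, b). f x a b) \<circ> (\<lambda>(a, b). (0, a, b)))"
    by (rule continuous_on_compose)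
       (auto simp: case_prod_unfold intro!: continuous_intros continuous_on_subset[OF f_cont[unfolded case_prod_unfold]])
  then have "compact (((\<lambda>(x, a, b). f x a b) \<circ> (\<lambda>(a, b). (0, a, b))) ` (A \<times> B))"
    using A B by (intro compact_continuous_image compact_Times)
  then obtain M where M: "\<And>a b. a \<in> A \<Longrightarrow> b \<in> B \<Longrightarrow> norm (f 0 a b) \<le> M"
    unfolding compact_eq_bounded_closed bounded_iff by force
  show ?thesis
  proof (intro exI[of _ "\<bar>M\<bar>"] conjI allI ballI)
    fix x a b assume ab: "a \<in> A" "b \<in> B"
    have "norm (f x a b) \<le> norm (f 0 a b) + norm (f x a b - f 0 a b)"
      using norm_triangle_ineq[of "f 0 a b" "f x a b - f 0 a b"] by simp
    then show "norm (f x a b) \<le> \<bar>M\<bar> + L * norm x"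
      using M[OF ab] f_Lip[OF ab, of x 0] by simp
  qed simp
qed

lemma f_along_integrable:
  assumes y: "continuous_on {0..} y" and a: "control A a" and b: "control B b"
  shows "set_integrable lborel {0..t} (\<lambda>s. f (y s) (a s) (b s))"
proof -
  obtain M where M: "norm (f x a b) \<le> M + L * norm x" if "a \<in> A" "b \<in> B" for x a b
    using f_linear_growth by auto
  have "compact (y ` {0..t})"
    by (rule compact_continuous_image[OF continuous_on_subset[OF y]]) auto
  then obtain R where R: "\<And>s. s \<in> {0..t} \<Longrightarrow> norm (y s) \<le> R"
    unfolding compact_eq_bounded_closed bounded_iff by force
  have bd: "norm (f (y s) (a s) (b s)) \<le> M + L * R" if "s \<in> {0..t}" for s
  proof -
    have "norm (f (y s) (a s) (b s)) \<le> M + L * norm (y s)"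
      using that by (intro M control_in[OF a] control_in[OF b]) auto
    also have "\<dots> \<le> M + L * R" using R[OF that] L by simp
    finally show ?thesis .
  qed
  have "(\<lambda>s. indicator {0..} s *\<^sub>R f (y s) (a s) (b s)) \<in> borel_measurable borel"
    using measurable_along[OF f_cont y a b] by (subst (asm) borel_measurable_restrict_space_iff) auto
  then have "(\<lambda>s. indicator {0..t} s *\<^sub>R (indicator {0..} s *\<^sub>R f (y s) (a s) (b s))) \<in> borel_measurable borel"
    by (rule borel_measurable_scaleR[rotated]) simp
  also have "(\<lambda>s. indicator {0..t} s *\<^sub>R (indicator {0..} s *\<^sub>R f (y s) (a s) (b s)))
      = (\<lambda>s. indicator {0..t} s *\<^sub>R f (y s) (a s) (b s))"
    by (auto simp: fun_eq_iff indicator_def)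
  finally have m: "(\<lambda>s. indicator {0..t} s *\<^sub>R f (y s) (a s) (b s)) \<in> borel_measurable lborel" by simp
  show ?thesis
    unfolding set_integrable_def
  proof (rule Bochner_Integration.integrable_bound[OF _ m])
    show "integrable lborel (\<lambda>s. indicator {0..t} s *\<^sub>R (M + L * R))"
      by (intro integrable_scaleR_left) (auto simp: integrable_indicator_iff emeasure_lborel_Icc_eq)
    show "AE s in lborel. norm (indicator {0..t} s *\<^sub>R f (y s) (a s) (b s))
        \<le> norm (indicator {0..t} s *\<^sub>R (M + L * R))"
    proof (rule AE_I2)
      fix s
      show "norm (indicator {0..t} s *\<^sub>R f (y s) (a s) (b s)) \<le> norm (indicator {0..t} s *\<^sub>R (M + L * R))"
        by (cases "s \<in> {0..t}") (use bd[of s] in \<open>simp_all add: abs_le_iff\<close>)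
    qed
  qed
qed

lemma f_along_integrable_on:
  assumes "continuous_on {0..} y" "control A a" "control B b"
  shows "(\<lambda>s. f (y s) (a s) (b s)) integrable_on {0..t}"
  by (rule set_borel_integral_eq_integral(1)[OF f_along_integrable[OF assms]])

text \<open>The weight of Bielecki's norm: integrating \<open>exp (2 * L * s)\<close> against the
  rate \<open>L\<close> gains a factor \<open>1 / 2\<close> on intervals of any length. Uniqueness
  and existence on the whole half-line both rest on this.\<close>

lemma weighted_integral_bound:
  fixes u :: "real \<Rightarrow> 'x"
  assumes u: "u integrable_on {0..t}" "\<And>s. s \<in> {0..t} \<Longrightarrow> norm (u s) \<le> L * exp (2 * L * s) * S"
    and "t \<ge> 0" "S \<ge> 0"
  shows "norm (integral {0..t} u) \<le> S / 2 * exp (2 * L * t)"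
proof -
  have i: "((\<lambda>s. L * exp (2 * L * s) * S) has_integral
      S / 2 * exp (2 * L * t) - S / 2 * exp (2 * L * 0)) {0..t}"
    by (rule fundamental_theorem_of_calculus)
       (use \<open>t \<ge> 0\<close> in \<open>auto intro!: derivative_eq_intros simp flip: has_real_derivative_iff_has_vector_derivative\<close>)
  have "norm (integral {0..t} u) \<le> integral {0..t} (\<lambda>s. L * exp (2 * L * s) * S)"
    by (rule integral_norm_bound_integral[OF u(1) has_integral_integrable[OF i] u(2)])
  also have "\<dots> = S / 2 * exp (2 * L * t) - S / 2 * exp (2 * L * 0)"
    by (rule integral_unique[OF i])
  finally show ?thesis using \<open>S \<ge> 0\<close> by simp
qed

text \<open>At a maximum point of the weighted distance \<open>w\<close>, the weighted bound gives
  \<open>w t0 \<le> w t0 / 2\<close>. The controls are compared only on \<open>{0<..T}\<close>,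
  because a shifted response may differ at time \<open>0\<close>.\<close>

lemma traj_agree:
  assumes y: "continuous_on {0..} y" "\<And>t. t \<in> {0..T} \<Longrightarrow> y t = x0 + integral {0..t} (\<lambda>s. f (y s) (a s) (b s))"
    and y': "continuous_on {0..} y'" "\<And>t. t \<in> {0..T} \<Longrightarrow> y' t = x0 + integral {0..t} (\<lambda>s. f (y' s) (a' s) (b' s))"
    and c: "control A a" "control B b" "control A a'" "control B b'"
    and eq: "\<And>s. s \<in> {0<..T} \<Longrightarrow> a s = a' s" "\<And>s. s \<in> {0<..T} \<Longrightarrow> b s = b' s"
    and t: "t \<in> {0..T}"
  shows "y t = y' t"
proof -
  define w where "w t = exp (- 2 * L * t) * norm (y t - y' t)" for t
  have "continuous_on {0..T} w"
    unfolding w_def using y(1) y'(1)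
    by (intro continuous_intros) (auto elim!: continuous_on_subset)
  then obtain t0 where t0: "t0 \<in> {0..T}" "\<And>s. s \<in> {0..T} \<Longrightarrow> w s \<le> w t0"
    using continuous_attains_sup[of "{0..T}" w] t by auto
  have bd: "norm (y s - y' s) \<le> exp (2 * L * s) * w t0" if "s \<in> {0..T}" for s
    using t0(2)[OF that] by (simp add: w_def exp_minus field_simps)
  let ?u = "\<lambda>s. f (y s) (a s) (b s) - f (y' s) (a s) (b s)"
  have i: "?u integrable_on {0..t0}"
    by (intro integrable_diff f_along_integrable_on y y' c)
  \<comment> \<open>The second pair of controls is traded for the first; a discrepancy at
    \<open>0\<close> is negligible.\<close>
  have "integral {0..t0} (\<lambda>s. f (y' s) (a' s) (b' s)) = integral {0..t0} (\<lambda>s. f (y' s) (a s) (b s))"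
    by (rule integral_spike[of "{0}"]) (use eq t0 in auto)
  then have "y t0 - y' t0 = integral {0..t0} ?u"
    using y(2)[OF t0(1)] y'(2)[OF t0(1)]
    by (subst integral_diff) (auto intro!: f_along_integrable_on y y' c)
  moreover have "norm (integral {0..t0} ?u) \<le> w t0 / 2 * exp (2 * L * t0)"
  proof (rule weighted_integral_bound[OF i])
    fix s assume s: "s \<in> {0..t0}"
    have "norm (?u s) \<le> L * norm (y s - y' s)"
      using s by (intro f_Lip control_in[OF c(1)] control_in[OF c(2)]) auto
    also have "\<dots> \<le> L * (exp (2 * L * s) * w t0)"
      using s t0(1) L by (intro mult_left_mono bd) auto
    finally show "norm (?u s) \<le> L * exp (2 * L * s) * w t0" by simp
  qed (use t0 in \<open>auto simp: w_def\<close>)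
  ultimately have "w t0 \<le> w t0 / 2"
    by (simp add: w_def exp_minus field_simps)
  then have "w t \<le> 0" using t0(2)[OF t] by simp
  then show ?thesis by (simp add: w_def mult_le_0_iff)
qed

text \<open>Picard iteration in the weighted norm: the solution is sought as
  \<open>x0 + exp (2 * L * t) *\<^sub>R z t\<close> with \<open>z\<close> bounded and continuous.
  The integral operator is then a contraction with constant \<open>1 / 2\<close> for all times at
  once, so no continuation from one interval to the next is needed.\<close>

lemma traj_exists:
  assumes a: "control A a" and b: "control B b"
  shows "\<exists>y. is_traj f x0 a b y"
proof -
  obtain M where M: "M \<ge> 0" "\<forall>x. \<forall>a\<in>A. \<forall>b\<in>B. norm (f x a b) \<le> M + L * norm x"
    using f_linear_growth by blast
  define Y where "Y z t = x0 + exp (2 * L * t) *\<^sub>R z t" for z :: "real \<Rightarrow> 'x" and t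
  define I where "I z t = integral {0..t} (\<lambda>s. f (Y z s) (a s) (b s))" for z t
  \<comment> \<open>Bounded continuous functions live on the whole line, so negative times are
    frozen at \<open>0\<close>.\<close>
  define F where "F z t = exp (- 2 * L * max 0 t) *\<^sub>R I z (max 0 t)" for z t
  have Y: "continuous_on {0..} (Y z)" if "continuous_on UNIV z" for z
    unfolding Y_def by (intro continuous_intros continuous_on_subset[OF that]) auto
  have int: "(\<lambda>s. f (Y z s) (a s) (b s)) integrable_on {0..t}" if "continuous_on UNIV z" for z t
    by (rule f_along_integrable_on[OF Y[OF that] a b])
  have I_cont: "continuous_on {0..} (I z)" if "continuous_on UNIV z" for z
    unfolding continuous_on_eq_continuous_within
  proof
    fix t :: real assume t: "t \<in> {0..}"
    have "continuous_on {0..t+1} (I z)"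
      unfolding I_def by (rule indefinite_integral_continuous_1[OF int[OF that]])
    then have "continuous (at t within {0..t+1}) (I z)"
      using t by (auto simp: continuous_on_eq_continuous_within)
    moreover have "at t within {0..t+1} = at t within {0..}"
      by (rule at_within_nhd[of _ "{..<t+1}"]) auto
    ultimately show "continuous (at t within {0..}) (I z)" by (simp add: continuous_within)
  qed
  have F_cont: "continuous_on UNIV (F z)" if "continuous_on UNIV z" for z
    unfolding F_def
    by (intro continuous_intros continuous_on_compose2[OF I_cont[OF that]]) auto
  have F_bound: "norm (F z t) \<le> S / 2"
    if "S \<ge> 0" "norm (I z (max 0 t)) \<le> S / 2 * exp (2 * L * max 0 t)" for z t S
    using that by (simp add: F_def exp_minus field_simps)
  have F_in: "F z \<in> bcontfun" if "z \<in> bcontfun" for z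
  proof -
    from that obtain N where z: "continuous_on UNIV z" and N: "\<And>t. norm (z t) \<le> N"
      unfolding bcontfun_def bounded_iff by auto
    have "N \<ge> 0" using N[of 0] norm_ge_zero order_trans by blast
    \<comment> \<open>Solves \<open>(M + L * norm x0) + L * N = L * S\<close>; since
      \<open>exp (2 * L * s) \<ge> 1\<close>, the constant part may be multiplied by the weight as
      well.\<close>
    define S where "S = (M + L * norm x0 + L * N) / L"
    have S: "S \<ge> 0" using M L \<open>N \<ge> 0\<close> by (simp add: S_def)
    have "norm (F z t) \<le> S / 2" for t
    proof (rule F_bound[OF S])
      show "norm (I z (max 0 t)) \<le> S / 2 * exp (2 * L * max 0 t)"
        unfolding I_def
      proof (rule weighted_integral_bound[OF int[OF z]])
        fix s assume s: "s \<in> {0..max 0 t}"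
        have e: "1 \<le> exp (2 * L * s)" using s L by auto
        have "norm (Y z s) \<le> norm x0 + exp (2 * L * s) * norm (z s)"
          unfolding Y_def by (rule order_trans[OF norm_triangle_ineq]) simp
        also have "\<dots> \<le> norm x0 + exp (2 * L * s) * N" using N by simp
        finally have Ys: "norm (Y z s) \<le> norm x0 + exp (2 * L * s) * N" .
        have "norm (f (Y z s) (a s) (b s)) \<le> M + L * norm (Y z s)"
          using s M(2) control_in[OF a, of s] control_in[OF b, of s] by auto
        also have "\<dots> \<le> M + L * (norm x0 + exp (2 * L * s) * N)"
          using Ys L by simp
        also have "\<dots> = (M + L * norm x0) * 1 + L * exp (2 * L * s) * N" by (simp add: algebra_simps)
        also have "\<dots> \<le> (M + L * norm x0) * exp (2 * L * s) + L * exp (2 * L * s) * N"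
          using e M L by (intro add_right_mono mult_left_mono) auto
        also have "\<dots> = L * exp (2 * L * s) * S"
          using L by (simp add: S_def field_simps)
        finally show "norm (f (Y z s) (a s) (b s)) \<le> L * exp (2 * L * s) * S" .
      qed (use S in auto)
    qed
    then show ?thesis by (rule bcontfun_normI[OF F_cont[OF z]])
  qed
  define \<Phi> where "\<Phi> z = Bcontfun (F (apply_bcontfun z))" for z
  have \<Phi>: "apply_bcontfun (\<Phi> z) = F (apply_bcontfun z)" for z
    unfolding \<Phi>_def by (rule Bcontfun_inverse[OF F_in]) (rule apply_bcontfun)
  have "\<exists>!z. \<Phi> z = z"
  proof (rule banach_fix_type[of "1/2"])
    show "\<forall>z z'. dist (\<Phi> z) (\<Phi> z') \<le> 1 / 2 * dist z z'"
    proof (intro allI dist_bound)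
      fix z z' :: "real \<Rightarrow>\<^sub>C 'x" and t :: real
      let ?D = "dist z z'"
      have zc: "continuous_on UNIV (apply_bcontfun z)" "continuous_on UNIV (apply_bcontfun z')" by auto
      let ?m = "max 0 t"
      have "I z ?m - I z' ?m = integral {0..?m} (\<lambda>s. f (Y z s) (a s) (b s) - f (Y z' s) (a s) (b s))"
        unfolding I_def by (rule integral_diff[symmetric]) (rule int, simp)+
      moreover have "norm \<dots> \<le> ?D / 2 * exp (2 * L * ?m)"
      proof (rule weighted_integral_bound[OF integrable_diff[OF int[OF zc(1)] int[OF zc(2)]]])
        fix s assume s: "s \<in> {0..?m}"
        have "norm (f (Y z s) (a s) (b s) - f (Y z' s) (a s) (b s)) \<le> L * norm (Y z s - Y z' s)"
          using s by (intro f_Lip control_in[OF a] control_in[OF b]) auto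
        also have "norm (Y z s - Y z' s) = exp (2 * L * s) * dist (z s) (z' s)"
          by (simp add: Y_def dist_norm flip: scaleR_diff_right)
        also have "L * \<dots> \<le> L * (exp (2 * L * s) * ?D)"
          using L by (intro mult_left_mono dist_bounded) auto
        finally show "norm (f (Y z s) (a s) (b s) - f (Y z' s) (a s) (b s)) \<le> L * exp (2 * L * s) * ?D"
          by simp
      qed auto
      ultimately have le: "norm (I z ?m - I z' ?m) \<le> ?D / 2 * exp (2 * L * ?m)" by simp
      have "dist (\<Phi> z t) (\<Phi> z' t) = exp (- 2 * L * ?m) * norm (I z ?m - I z' ?m)"
        unfolding \<Phi> F_def dist_norm scaleR_diff_right[symmetric] by simp
      also have "\<dots> \<le> exp (- 2 * L * ?m) * (?D / 2 * exp (2 * L * ?m))"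
        by (rule mult_left_mono[OF le]) simp
      also have "\<dots> = 1 / 2 * ?D"
        by (simp add: exp_minus field_simps)
      finally show "dist (\<Phi> z t) (\<Phi> z' t) \<le> 1 / 2 * ?D" .
    qed
  qed auto
  then obtain z where "\<Phi> z = z" by blast
  then have z: "z t = F z t" for t using \<Phi>[of z] by simp
  have zc: "continuous_on UNIV (apply_bcontfun z)" by auto
  \<comment> \<open>The weight in \<open>Y\<close> cancels the one in \<open>F\<close>, so the fixed
    point solves the integral equation.\<close>
  have Yt: "Y z t = x0 + I z t" if "t \<ge> 0" for t
    unfolding Y_def z[of t] F_def using that by (simp add: exp_minus)
  define y where "y t = (if t < 0 then x0 else Y z t)" for t
  have "is_traj f x0 a b y"
    unfolding is_traj_def
  proof (intro conjI allI impI)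
    show yc: "continuous_on {0..} y"
      by (rule continuous_on_eq[OF Y[OF zc]]) (auto simp: y_def)
    fix t :: real assume "t \<ge> 0"
    show "(\<lambda>s. f (y s) (a s) (b s)) integrable_on {0..t}"
      by (rule f_along_integrable_on[OF yc a b])
    have "integral {0..t} (\<lambda>s. f (y s) (a s) (b s)) = I z t"
      unfolding I_def by (rule integral_cong) (auto simp: y_def)
    then show "y t = x0 + integral {0..t} (\<lambda>s. f (y s) (a s) (b s))"
      using Yt[OF \<open>t \<ge> 0\<close>] \<open>t \<ge> 0\<close> by (simp add: y_def)
  qed (auto simp: y_def)
  then show ?thesis by blast
qed

lemma traj_unique:
  assumes a: "control A a" and b: "control B b"
    and y: "is_traj f x0 a b y" and y': "is_traj f x0 a b y'"
  shows "y = y'"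
proof
  fix t show "y t = y' t"
  proof (cases "t < 0")
    case True then show ?thesis using y y' by (auto simp: is_traj_def)
  next
    case False
    then show ?thesis
      using y y' by (intro traj_agree[of y t x0 a b y' a b t] a b) (auto simp: is_traj_def)
  qed
qed

lemma traj_is_traj:
  assumes "control A a" "control B b"
  shows "is_traj f x0 a b (traj f x0 a b)"
proof -
  have "\<exists>!y. is_traj f x0 a b y"
    using traj_exists[OF assms] traj_unique[OF assms] by blast
  then show ?thesis unfolding traj_def by (rule theI')
qed

lemma traj_continuous: "control A a \<Longrightarrow> control B b \<Longrightarrow> continuous_on {0..} (traj f x0 a b)"
  using traj_is_traj[of a b x0] by (auto simp: is_traj_def)

lemma traj_integral_eq:
  "control A a \<Longrightarrow> control B b \<Longrightarrow> t \<ge> 0 \<Longrightarrow>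
   traj f x0 a b t = x0 + integral {0..t} (\<lambda>s. f (traj f x0 a b s) (a s) (b s))"
  using traj_is_traj[of a b x0] by (auto simp: is_traj_def)

lemma traj_cong:
  assumes "control A a" "control B b" "control A a'" "control B b'"
    and "\<And>s. s \<in> {0<..T} \<Longrightarrow> a s = a' s" "\<And>s. s \<in> {0<..T} \<Longrightarrow> b s = b' s" "t \<in> {0..T}"
  shows "traj f x0 a b t = traj f x0 a' b' t"
  using assms by (intro traj_agree[of "traj f x0 a b" T x0 a b "traj f x0 a' b'" a' b' t])
    (auto intro: traj_continuous traj_integral_eq)

text \<open>After time \<open>\<tau>\<close> the trajectory solves the integral equation started at
  its own position, and uniqueness identifies it.\<close>

lemma traj_shift:
  assumes a: "control A a" and b: "control B b" and "\<tau> \<ge> 0" "t \<ge> 0"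
  shows "traj f x0 a b (t + \<tau>) = traj f (traj f x0 a b \<tau>) (shift_control \<tau> a) (shift_control \<tau> b) t"
proof -
  let ?y = "traj f x0 a b"
  let ?h = "\<lambda>s. f (?y s) (a s) (b s)"
  have c: "continuous_on {0..} (\<lambda>t. ?y (t + \<tau>))"
    by (rule continuous_on_compose2[OF traj_continuous[OF a b]])
       (use \<open>\<tau> \<ge> 0\<close> in \<open>auto intro!: continuous_intros\<close>)
  have "?y (s + \<tau>) = ?y \<tau> + integral {0..s} (\<lambda>r. f (?y (r + \<tau>)) (shift_control \<tau> a r) (shift_control \<tau> b r))"
    if "s \<ge> 0" for s
  proof -
    have i: "?h integrable_on {0..s + \<tau>}"
      by (rule f_along_integrable_on[OF traj_continuous[OF a b] a b])
    have "integral {0..\<tau>} ?h + integral {\<tau>..s+\<tau>} ?h = integral {0..s+\<tau>} ?h"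
      using that \<open>\<tau> \<ge> 0\<close> by (intro Henstock_Kurzweil_Integration.integral_combine i) auto
    moreover have "integral {\<tau>..s+\<tau>} ?h = integral {0..s} (\<lambda>r. ?h (r + \<tau>))"
      using integral_shift_real_ivl[of "\<tau>" "\<tau>" "s + \<tau>" ?h] by simp
    moreover have "integral {0..s} (\<lambda>r. ?h (r + \<tau>))
        = integral {0..s} (\<lambda>r. f (?y (r + \<tau>)) (shift_control \<tau> a r) (shift_control \<tau> b r))"
      by (rule integral_cong) (auto simp: shift_control_def)
    ultimately show ?thesis
      using traj_integral_eq[OF a b, of "s + \<tau>" x0] traj_integral_eq[OF a b, of \<tau> x0] that \<open>\<tau> \<ge> 0\<close>
      by (simp add: add.assoc)
  qed
  with c show ?thesis
    using assms
    by (intro traj_agree[of "\<lambda>t. ?y (t + \<tau>)" t "?y \<tau>" "shift_control \<tau> a" "shift_control \<tau> b"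
          _ "shift_control \<tau> a" "shift_control \<tau> b" t])
       (auto intro!: control_shift traj_continuous traj_integral_eq)
qed

end

section \<open>Upper values and the dynamic programming principle\<close>

context differential_game
begin

text \<open>The payoff is an arbitrary functional of the two controls, because dynamic programming
  equates the values of two different functionals.\<close>

definition upper_value :: "((real \<Rightarrow> 'a) \<Rightarrow> (real \<Rightarrow> 'b) \<Rightarrow> real) \<Rightarrow> real" where
  "upper_value P = (INF \<alpha>\<in>{\<alpha>. quasistrategy A B \<alpha>}. SUP b\<in>{b. control B b}. P (\<alpha> b) b)"

text \<open>Real \<open>INF\<close> and \<open>SUP\<close> are meaningful only under such a
  bound.\<close>

definition bounded_payoff :: "((real \<Rightarrow> 'a) \<Rightarrow> (real \<Rightarrow> 'b) \<Rightarrow> real) \<Rightarrow> bool" where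
  "bounded_payoff P \<longleftrightarrow> (\<exists>M. \<forall>a b. control A a \<longrightarrow> control B b \<longrightarrow> \<bar>P a b\<bar> \<le> M)"

lemma quasistrategy_control: "quasistrategy A B \<alpha> \<Longrightarrow> control B b \<Longrightarrow> control A (\<alpha> b)"
  unfolding quasistrategy_def by blast

lemma quasistrategy_nonanticipative:
  "quasistrategy A B \<alpha> \<Longrightarrow> control B b \<Longrightarrow> control B b' \<Longrightarrow> t > 0 \<Longrightarrow>
   (\<And>s. s \<in> {0..t} \<Longrightarrow> b s = b' s) \<Longrightarrow> s \<in> {0..t} \<Longrightarrow> \<alpha> b s = \<alpha> b' s"
  unfolding quasistrategy_def by blast

lemma ex_control: "\<exists>b. control B b"
  using B(2) control_const by blast

lemma ex_quasistrategy: "\<exists>\<alpha>. quasistrategy A B \<alpha>"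
proof -
  obtain a where "control A a" using A(2) control_const by blast
  then have "quasistrategy A B (\<lambda>_. a)" by (simp add: quasistrategy_def)
  then show ?thesis by (rule exI[of _ "\<lambda>_. a"])
qed

lemma upper_value_upper:
  assumes P: "bounded_payoff P" and \<alpha>: "quasistrategy A B \<alpha>"
    and le: "\<And>b. control B b \<Longrightarrow> P (\<alpha> b) b \<le> c"
  shows "upper_value P \<le> c"
proof -
  obtain M where M: "\<bar>P a b\<bar> \<le> M" if "control A a" "control B b" for a b
    using P unfolding bounded_payoff_def by blast
  obtain b0 where b0: "control B b0" using ex_control by blast
  have "- M \<le> (SUP b\<in>{b. control B b}. P (\<beta> b) b)" if \<beta>: "quasistrategy A B \<beta>" for \<beta>
  proof (rule cSUP_upper2)
    show "bdd_above ((\<lambda>b. P (\<beta> b) b) ` {b. control B b})"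
      using M quasistrategy_control[OF \<beta>] by (intro bdd_aboveI2[of _ _ M]) (auto simp: abs_le_iff)
    show "- M \<le> P (\<beta> b0) b0" using M[OF quasistrategy_control[OF \<beta> b0] b0] by simp
  qed (use b0 in simp)
  then have bb: "bdd_below ((\<lambda>\<alpha>. SUP b\<in>{b. control B b}. P (\<alpha> b) b) ` {\<alpha>. quasistrategy A B \<alpha>})"
    by (intro bdd_belowI2[of _ "- M"]) auto
  have "(SUP b\<in>{b. control B b}. P (\<alpha> b) b) \<le> c"
    by (rule cSUP_least) (use b0 le in auto)
  then show ?thesis
    unfolding upper_value_def using \<alpha> by (intro cINF_lower2[OF bb, of \<alpha>]) auto
qed

lemma upper_value_response:
  assumes P: "bounded_payoff P" and \<alpha>: "quasistrategy A B \<alpha>" and "e > 0"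
  obtains b where "control B b" "upper_value P - e \<le> P (\<alpha> b) b"
proof (rule ccontr)
  assume "\<not> thesis"
  then have "P (\<alpha> b) b \<le> upper_value P - e" if "control B b" for b
    using that \<open>\<And>b. control B b \<Longrightarrow> upper_value P - e \<le> P (\<alpha> b) b \<Longrightarrow> thesis\<close>[of b] by linarith
  from upper_value_upper[OF P \<alpha> this] \<open>e > 0\<close> show False by simp
qed

lemma upper_value_near:
  assumes P: "bounded_payoff P" and "e > 0"
  obtains \<alpha> where "quasistrategy A B \<alpha>" "\<And>b. control B b \<Longrightarrow> P (\<alpha> b) b \<le> upper_value P + e"
proof -
  obtain M where M: "\<bar>P a b\<bar> \<le> M" if "control A a" "control B b" for a b
    using P unfolding bounded_payoff_def by blast
  have "\<exists>\<alpha>. quasistrategy A B \<alpha> \<and> (\<forall>b. control B b \<longrightarrow> P (\<alpha> b) b \<le> upper_value P + e)"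
  proof (rule ccontr)
    assume *: "\<not> ?thesis"
    have "upper_value P + e \<le> upper_value P"
      unfolding upper_value_def[of P]
    proof (rule cINF_greatest)
      fix \<alpha> assume "\<alpha> \<in> {\<alpha>. quasistrategy A B \<alpha>}"
      then have \<alpha>: "quasistrategy A B \<alpha>" by simp
      with * obtain b where b: "control B b" "upper_value P + e < P (\<alpha> b) b" by force
      have "upper_value P + e \<le> (SUP b\<in>{b. control B b}. P (\<alpha> b) b)"
      proof (rule cSUP_upper2)
        show "bdd_above ((\<lambda>b. P (\<alpha> b) b) ` {b. control B b})"
          using M quasistrategy_control[OF \<alpha>] by (intro bdd_aboveI2[of _ _ M]) (auto simp: abs_le_iff)
      qed (use b in auto)
      then show "(INF \<alpha>\<in>{\<alpha>. quasistrategy A B \<alpha>}. SUP b\<in>{b. control B b}. P (\<alpha> b) b) + e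
          \<le> (SUP b\<in>{b. control B b}. P (\<alpha> b) b)"
        unfolding upper_value_def .
    qed (use ex_quasistrategy in auto)
    with \<open>e > 0\<close> show False by simp
  qed
  then show thesis using that by blast
qed

lemma upper_value_lower:
  assumes P: "bounded_payoff P"
    and ge: "\<And>\<alpha> e. quasistrategy A B \<alpha> \<Longrightarrow> e > 0 \<Longrightarrow> \<exists>b. control B b \<and> c - e \<le> P (\<alpha> b) b"
  shows "c \<le> upper_value P"
proof (rule field_le_epsilon)
  fix e :: real assume "e > 0"
  then have "e / 2 > 0" by simp
  from upper_value_near[OF P this] obtain \<alpha> where \<alpha>: "quasistrategy A B \<alpha>"
    "\<And>b. control B b \<Longrightarrow> P (\<alpha> b) b \<le> upper_value P + e / 2" by blast
  obtain b where "control B b" "c - e / 2 \<le> P (\<alpha> b) b"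
    using ge[OF \<alpha>(1) \<open>e / 2 > 0\<close>] by blast
  then show "c \<le> upper_value P + e" using \<alpha>(2)[of b] by linarith
qed

lemma upper_value_le_add:
  assumes "bounded_payoff P" "bounded_payoff Q"
    and le: "\<And>a b. control A a \<Longrightarrow> control B b \<Longrightarrow> P a b \<le> Q a b + d"
  shows "upper_value P \<le> upper_value Q + d"
proof (rule field_le_epsilon)
  fix e :: real assume "e > 0"
  from upper_value_near[OF assms(2) this] obtain \<alpha> where \<alpha>: "quasistrategy A B \<alpha>"
    "\<And>b. control B b \<Longrightarrow> Q (\<alpha> b) b \<le> upper_value Q + e" by blast
  show "upper_value P \<le> upper_value Q + d + e"
  proof (rule upper_value_upper[OF assms(1) \<alpha>(1)])
    fix b assume b: "control B b"
    show "P (\<alpha> b) b \<le> upper_value Q + d + e"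
      using le[OF quasistrategy_control[OF \<alpha>(1) b] b] \<alpha>(2)[OF b] by linarith
  qed
qed

text \<open>A strategy that is nearly optimal for one payoff is tested in the other game; each pair
  of strategy response and control loses at most \<open>d\<close>.\<close>

lemma upper_value_dist:
  assumes P: "bounded_payoff P" and Q: "bounded_payoff Q"
    and d: "\<And>a b. control A a \<Longrightarrow> control B b \<Longrightarrow> \<bar>P a b - Q a b\<bar> \<le> d"
  shows "\<bar>upper_value P - upper_value Q\<bar> \<le> d"
proof -
  have "upper_value P \<le> upper_value Q + d"
  proof (rule upper_value_le_add[OF P Q])
    fix a b assume "control A a" "control B b"
    from d[OF this] show "P a b \<le> Q a b + d" by linarith
  qed
  moreover have "upper_value Q \<le> upper_value P + d"
  proof (rule upper_value_le_add[OF Q P])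
    fix a b assume "control A a" "control B b"
    from d[OF this] show "Q a b \<le> P a b + d" by linarith
  qed
  ultimately show ?thesis by linarith
qed

section \<open>Payoffs of densities: bounds, homogeneity, splitting in time\<close>

definition payoff :: "(real \<Rightarrow> real) \<Rightarrow> 'x \<Rightarrow> (real \<Rightarrow> 'a) \<Rightarrow> (real \<Rightarrow> 'b) \<Rightarrow> real" where
  "payoff \<rho> x a b = mass (\<lambda>t. \<rho> t * g (traj f x a b t) (a t) (b t))"

definition running :: "(real \<Rightarrow> real) \<Rightarrow> real \<Rightarrow> 'x \<Rightarrow> (real \<Rightarrow> 'a) \<Rightarrow> (real \<Rightarrow> 'b) \<Rightarrow> real" where
  "running \<rho> \<tau> x a b = (LINT t:{0..\<tau>}|lborel. \<rho> t * g (traj f x a b t) (a t) (b t))"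

abbreviation V :: "(real \<Rightarrow> real) \<Rightarrow> 'x \<Rightarrow> real" where
  "V \<equiv> game_value A B f g"

lemma V_eq: "V \<rho> x = upper_value (payoff \<rho> x)"
  by (simp add: game_value_def upper_value_def payoff_def)

lemma g_bounds:
  assumes "control A a" "control B b" "t \<ge> 0"
  shows "0 \<le> g x (a t) (b t)" "g x (a t) (b t) \<le> 1"
  using g_range[OF control_in[OF assms(1,3)] control_in[OF assms(2,3)], of x] by auto

lemma payoff_integrable:
  assumes \<rho>: "hl_integrable \<rho>" and a: "control A a" and b: "control B b"
  shows "hl_integrable (\<lambda>t. \<rho> t * g (traj f x a b t) (a t) (b t))"
proof -
  have "(\<lambda>s. indicator {0..} s *\<^sub>R g (traj f x a b s) (a s) (b s)) \<in> borel_measurable borel"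
    using measurable_along[OF g_cont traj_continuous[OF a b] a b]
    by (subst (asm) borel_measurable_restrict_space_iff) auto
  moreover have "(\<lambda>s. indicator {0..} s *\<^sub>R \<rho> s) \<in> borel_measurable borel"
    using \<rho> borel_measurable_integrable unfolding set_integrable_def by fastforce
  ultimately have "(\<lambda>s. (indicator {0..} s *\<^sub>R \<rho> s) * (indicator {0..} s *\<^sub>R g (traj f x a b s) (a s) (b s)))
      \<in> borel_measurable borel"
    by (rule borel_measurable_times[rotated])
  also have "(\<lambda>s. (indicator {0..} s *\<^sub>R \<rho> s) * (indicator {0..} s *\<^sub>R g (traj f x a b s) (a s) (b s)))
      = (\<lambda>s. indicator {0..} s *\<^sub>R (\<rho> s * g (traj f x a b s) (a s) (b s)))"
    by (auto simp: fun_eq_iff indicator_def)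
  finally have m: "(\<lambda>s. indicator {0..} s *\<^sub>R (\<rho> s * g (traj f x a b s) (a s) (b s))) \<in> borel_measurable lborel"
    by simp
  have "AE s in lborel. norm (indicator {0..} s *\<^sub>R (\<rho> s * g (traj f x a b s) (a s) (b s)))
      \<le> norm (indicator {0..} s *\<^sub>R \<rho> s)"
  proof (rule AE_I2)
    fix s
    show "norm (indicator {0..} s *\<^sub>R (\<rho> s * g (traj f x a b s) (a s) (b s)))
      \<le> norm (indicator {0..} s *\<^sub>R \<rho> s)"
      by (cases "s \<ge> 0") (use g_bounds[OF a b, of s] in \<open>auto simp: abs_mult mult_left_le\<close>)
  qed
  from Bochner_Integration.integrable_bound[OF \<rho>[unfolded set_integrable_def] m this]
  show ?thesis by (simp only: set_integrable_def)
qed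

lemma payoff_diff_bound:
  assumes \<rho>: "hl_integrable \<rho>" "hl_integrable \<rho>'" and a: "control A a" and b: "control B b"
  shows "\<bar>payoff \<rho> x a b - payoff \<rho>' x a b\<bar> \<le> mass (\<lambda>t. \<bar>\<rho> t - \<rho>' t\<bar>)"
proof -
  let ?d = "\<lambda>t. \<rho> t - \<rho>' t"
  have d: "hl_integrable ?d" by (rule set_integral_diff(1)[OF \<rho>])
  have i: "hl_integrable (\<lambda>t. ?d t * g (traj f x a b t) (a t) (b t))"
    by (rule payoff_integrable[OF d a b])
  have "payoff \<rho> x a b - payoff \<rho>' x a b = mass (\<lambda>t. ?d t * g (traj f x a b t) (a t) (b t))"
    unfolding payoff_def left_diff_distrib
    by (rule set_integral_diff(2)[symmetric]; rule payoff_integrable[OF _ a b]; fact)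
  also have "\<bar>\<dots>\<bar> \<le> mass (\<lambda>t. \<bar>?d t * g (traj f x a b t) (a t) (b t)\<bar>)"
    by (rule abs_mass_le[OF i])
  also have "\<dots> \<le> mass (\<lambda>t. \<bar>?d t\<bar>)"
  proof (rule mass_mono[OF hl_integrable_abs[OF i] hl_integrable_abs[OF d]])
    fix t :: real assume "t \<ge> 0"
    from g_bounds[OF a b this, of "traj f x a b t"]
    show "\<bar>?d t * g (traj f x a b t) (a t) (b t)\<bar> \<le> \<bar>?d t\<bar>"
      by (simp add: abs_mult mult_left_le)
  qed
  finally show ?thesis .
qed

lemma payoff_bound:
  assumes \<rho>: "hl_integrable \<rho>" and a: "control A a" and b: "control B b"
  shows "\<bar>payoff \<rho> x a b\<bar> \<le> mass (\<lambda>t. \<bar>\<rho> t\<bar>)"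
proof -
  have "hl_integrable (\<lambda>_. 0)" by (simp add: set_integrable_def)
  from payoff_diff_bound[OF \<rho> this a b, of x] show ?thesis
    by (simp add: payoff_def set_lebesgue_integral_def)
qed

lemma bounded_payoff: "hl_integrable \<rho> \<Longrightarrow> bounded_payoff (payoff \<rho> x)"
  unfolding bounded_payoff_def using payoff_bound by blast

lemma V_abs_le:
  assumes \<rho>: "hl_integrable \<rho>"
  shows "\<bar>V \<rho> x\<bar> \<le> mass (\<lambda>t. \<bar>\<rho> t\<bar>)"
proof -
  have 0: "bounded_payoff (\<lambda>_ _. 0)" unfolding bounded_payoff_def by auto
  have "upper_value (\<lambda>_ _. 0) = 0"
    unfolding upper_value_def using ex_control ex_quasistrategy by simp
  with upper_value_dist[OF bounded_payoff[OF \<rho>, of x] 0] payoff_bound[OF \<rho>, of _ _ x]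
  show ?thesis by (simp add: V_eq)
qed

lemma V_nonneg:
  assumes \<rho>: "hl_integrable \<rho>" "\<And>t. t \<ge> 0 \<Longrightarrow> \<rho> t \<ge> 0"
  shows "0 \<le> V \<rho> x"
  unfolding V_eq
proof (rule upper_value_lower[OF bounded_payoff[OF \<rho>(1)]])
  fix \<alpha> and e :: real assume \<alpha>: "quasistrategy A B \<alpha>" and "e > 0"
  obtain b where b: "control B b" using ex_control by blast
  have "0 \<le> payoff \<rho> x (\<alpha> b) b"
    unfolding payoff_def
    using \<rho>(2) g_bounds[OF quasistrategy_control[OF \<alpha> b] b] by (intro mass_nonneg mult_nonneg_nonneg) auto
  with b \<open>e > 0\<close> show "\<exists>b. control B b \<and> 0 - e \<le> payoff \<rho> x (\<alpha> b) b"
    by (intro exI[of _ b]) auto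
qed

lemma V_L1:
  assumes "hl_integrable \<rho>" "hl_integrable \<rho>'"
  shows "\<bar>V \<rho> x - V \<rho>' x\<bar> \<le> mass (\<lambda>t. \<bar>\<rho> t - \<rho>' t\<bar>)"
  unfolding V_eq by (intro upper_value_dist bounded_payoff assms payoff_diff_bound)

lemma V_cong_pos:
  assumes "\<And>t. t > 0 \<Longrightarrow> \<rho> t = \<rho>' t"
  shows "V \<rho> x = V \<rho>' x"
  unfolding V_eq by (rule arg_cong[where f=upper_value]) (auto simp: payoff_def fun_eq_iff assms intro: mass_cong_pos)

lemma V_cmult:
  assumes "hl_integrable \<rho>" "c > 0"
  shows "V (\<lambda>t. c * \<rho> t) x = c * V \<rho> x"
proof -
  have le: "V (\<lambda>t. c * \<rho> t) x \<le> c * V \<rho> x" if i: "hl_integrable \<rho>" and "c > 0" for c \<rho>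
  proof (rule field_le_epsilon)
    fix e :: real assume "e > 0"
    have c\<rho>: "hl_integrable (\<lambda>t. c * \<rho> t)" using i by simp
    obtain \<alpha> where \<alpha>: "quasistrategy A B \<alpha>"
      "\<And>b. control B b \<Longrightarrow> payoff \<rho> x (\<alpha> b) b \<le> V \<rho> x + e / c"
      using upper_value_near[OF bounded_payoff[OF i], of "e / c" x] \<open>e > 0\<close> \<open>c > 0\<close>
      unfolding V_eq by auto
    show "V (\<lambda>t. c * \<rho> t) x \<le> c * V \<rho> x + e"
      unfolding V_eq[of "\<lambda>t. c * \<rho> t"]
    proof (rule upper_value_upper[OF bounded_payoff[OF c\<rho>] \<alpha>(1)])
      fix b assume "control B b"
      from \<alpha>(2)[OF this] have "c * payoff \<rho> x (\<alpha> b) b \<le> c * (V \<rho> x + e / c)"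
        using \<open>c > 0\<close> by simp
      then show "payoff (\<lambda>t. c * \<rho> t) x (\<alpha> b) b \<le> c * V \<rho> x + e"
        using \<open>c > 0\<close> by (simp add: payoff_def mult.assoc distrib_left)
    qed
  qed
  \<comment> \<open>The reverse inequality is the same one, for the density
    \<open>c * \<rho>\<close> and the factor \<open>inverse c\<close>.\<close>
  have "V (\<lambda>t. inverse c * (c * \<rho> t)) x \<le> inverse c * V (\<lambda>t. c * \<rho> t) x"
    using assms by (intro le) auto
  then have "c * V \<rho> x \<le> V (\<lambda>t. c * \<rho> t) x"
    using \<open>c > 0\<close> by (simp add: mult.assoc[symmetric] field_simps)
  with le[OF assms] show ?thesis by simp
qed

lemma payoff_split:
  assumes \<rho>: "hl_integrable \<rho>" and a: "control A a" and b: "control B b" and "\<tau> \<ge> 0"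
  shows "payoff \<rho> x a b = running \<rho> \<tau> x a b
    + payoff (\<lambda>t. \<rho> (t + \<tau>)) (traj f x a b \<tau>) (shift_control \<tau> a) (shift_control \<tau> b)"
proof -
  have "mass (\<lambda>t. \<rho> (t + \<tau>) * g (traj f x a b (t + \<tau>)) (a (t + \<tau>)) (b (t + \<tau>)))
    = payoff (\<lambda>t. \<rho> (t + \<tau>)) (traj f x a b \<tau>) (shift_control \<tau> a) (shift_control \<tau> b)"
    unfolding payoff_def
    by (rule mass_cong_pos) (simp add: traj_shift[OF a b \<open>\<tau> \<ge> 0\<close>] shift_control_def)
  then show ?thesis
    using set_integral_split_at[OF payoff_integrable[OF \<rho> a b] \<open>\<tau> \<ge> 0\<close>, of x]
    by (simp add: payoff_def running_def)
qed

lemma payoff_cong: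
  assumes "control A a" "control B b" "control A a'" "control B b'"
    and eq: "\<And>s. s > 0 \<Longrightarrow> a s = a' s" "\<And>s. s > 0 \<Longrightarrow> b s = b' s"
  shows "payoff \<rho> x a b = payoff \<rho> x a' b'"
  unfolding payoff_def
proof (rule mass_cong_pos)
  fix t :: real assume "t > 0"
  then have "traj f x a b t = traj f x a' b' t"
    using assms by (intro traj_cong[of a b a' b' t]) auto
  then show "\<rho> t * g (traj f x a b t) (a t) (b t) = \<rho> t * g (traj f x a' b' t) (a' t) (b' t)"
    using eq[OF \<open>t > 0\<close>] by simp
qed

text \<open>The densities may differ as well: this is how a density and its splice get the same
  running payoff up to the seam.\<close>

lemma running_cong:
  assumes "control A a" "control B b" "control A a'" "control B b'"
    and eq: "\<And>s. s \<in> {0..\<tau>} \<Longrightarrow> a s = a' s" "\<And>s. s \<in> {0..\<tau>} \<Longrightarrow> b s = b' s"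
    and \<rho>: "\<And>s. s \<in> {0..\<tau>} \<Longrightarrow> \<rho> s = \<rho>' s"
  shows "running \<rho> \<tau> x a b = running \<rho>' \<tau> x a' b'"
  unfolding running_def
proof (rule set_lebesgue_integral_cong)
  have "traj f x a b t = traj f x a' b' t" if "t \<in> {0..\<tau>}" for t
    using assms that by (intro traj_cong[of a b a' b' \<tau>]) auto
  then show "\<forall>t. t \<in> {0..\<tau>} \<longrightarrow>
      \<rho> t * g (traj f x a b t) (a t) (b t) = \<rho>' t * g (traj f x a' b' t) (a' t) (b' t)"
    using eq \<rho> by auto
qed simp

section \<open>Concatenation of strategies and dynamic programming\<close>

definition staged_payoff :: "(real \<Rightarrow> real) \<Rightarrow> real \<Rightarrow> ('x \<Rightarrow> real) \<Rightarrow> 'x \<Rightarrow> (real \<Rightarrow> 'a) \<Rightarrow> (real \<Rightarrow> 'b) \<Rightarrow> real" where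
  "staged_payoff \<rho> \<tau> F x a b = running \<rho> \<tau> x a b + F (traj f x a b \<tau>)"

lemma bounded_staged_payoff:
  assumes \<rho>: "hl_integrable \<rho>" and F: "\<And>x. \<bar>F x\<bar> \<le> M" and "\<tau> \<ge> 0"
  shows "bounded_payoff (staged_payoff \<rho> \<tau> F x)"
  unfolding bounded_payoff_def
proof (intro exI allI impI)
  fix a b assume a: "control A a" and b: "control B b"
  have i: "hl_integrable (\<lambda>t. \<rho> (t + \<tau>))" by (rule hl_integrable_shift[OF \<rho> \<open>\<tau> \<ge> 0\<close>])
  \<comment> \<open>The running payoff is the difference of a full payoff and a shifted one, both
    already bounded.\<close>
  show "\<bar>staged_payoff \<rho> \<tau> F x a b\<bar> \<le> mass (\<lambda>t. \<bar>\<rho> t\<bar>) + mass (\<lambda>t. \<bar>\<rho> (t + \<tau>)\<bar>) + M"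
    using payoff_split[OF \<rho> a b \<open>\<tau> \<ge> 0\<close>, of x] payoff_bound[OF \<rho> a b, of x]
      payoff_bound[OF i control_shift[OF a \<open>\<tau> \<ge> 0\<close>] control_shift[OF b \<open>\<tau> \<ge> 0\<close>], of "traj f x a b \<tau>"]
      F[of "traj f x a b \<tau>"]
    unfolding staged_payoff_def by linarith
qed

text \<open>Upper bound: follow a nearly optimal strategy of the staged game until
  \<open>\<tau>\<close>, then one that is nearly optimal from the position reached. Lower bound:
  after a good control \<open>b1\<close> on \<open>[0, \<tau>]\<close>, the continuation of
  \<open>\<alpha>\<close> is a quasistrategy for the tail and admits a good response
  \<open>b2\<close>.\<close>

theorem dynamic_programming:
  assumes \<rho>: "hl_integrable \<rho>" and \<tau>: "\<tau> > 0"
  shows "V \<rho> x = upper_value (staged_payoff \<rho> \<tau> (V (\<lambda>t. \<rho> (t + \<tau>))) x)"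
proof -
  define \<psi> where "\<psi> = (\<lambda>t. \<rho> (t + \<tau>))"
  have \<psi>: "hl_integrable \<psi>" unfolding \<psi>_def by (rule hl_integrable_shift) (use \<rho> \<tau> in auto)
  have \<tau>0: "\<tau> \<ge> 0" using \<tau> by simp
  let ?W = "upper_value (staged_payoff \<rho> \<tau> (V \<psi>) x)"
  have bW: "bounded_payoff (staged_payoff \<rho> \<tau> (V \<psi>) x)"
    by (rule bounded_staged_payoff[OF \<rho> V_abs_le[OF \<psi>] \<tau>0])
  have "V \<rho> x \<le> ?W"
  proof (rule field_le_epsilon)
    fix e :: real assume "e > 0"
    then have e: "e / 2 > 0" by simp
    obtain \<alpha>1 where \<alpha>1: "quasistrategy A B \<alpha>1"
      and \<alpha>1_le: "\<And>b. control B b \<Longrightarrow> staged_payoff \<rho> \<tau> (V \<psi>) x (\<alpha>1 b) b \<le> ?W + e / 2"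
      using upper_value_near[OF bW e] by blast
    \<comment> \<open>One strategy is chosen for each position \<open>z\<close>, with no regularity
      in \<open>z\<close>: a given \<open>b\<close> meets only the position \<open>Z b\<close>, so
      measurability in \<open>z\<close> is never an issue.\<close>
    have "\<exists>\<alpha>. quasistrategy A B \<alpha> \<and> (\<forall>b. control B b \<longrightarrow> payoff \<psi> z (\<alpha> b) b \<le> V \<psi> z + e / 2)" for z
      using upper_value_near[OF bounded_payoff[OF \<psi>] e, of z] unfolding V_eq by blast
    then obtain \<alpha>2 where \<alpha>2: "quasistrategy A B (\<alpha>2 z)"
      and \<alpha>2_le: "control B b \<Longrightarrow> payoff \<psi> z (\<alpha>2 z b) b \<le> V \<psi> z + e / 2" for z b by metis
    define Z where "Z b = traj f x (\<alpha>1 b) b \<tau>" for b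
    define \<alpha> where "\<alpha> b = splice \<tau> (\<alpha>1 b) (\<alpha>2 (Z b) (shift_control \<tau> b))" for b
    have \<alpha>: "quasistrategy A B \<alpha>"
      unfolding quasistrategy_def
    proof (intro conjI allI impI ballI)
      fix b assume b: "control B b"
      show "control A (\<alpha> b)"
        unfolding \<alpha>_def by (intro control_splice quasistrategy_control[OF \<alpha>1] quasistrategy_control[OF \<alpha>2]
            control_shift b \<tau> \<tau>0)
    next
      fix b b' :: "real \<Rightarrow> 'b" and t s :: real
      assume b: "control B b" and b': "control B b'" and "t > 0"
        and eq: "\<forall>s\<in>{0..t}. b s = b' s" and s: "s \<in> {0..t}"
      show "\<alpha> b s = \<alpha> b' s"
      proof (cases "s \<le> \<tau>")
        case True
        have "\<alpha>1 b s = \<alpha>1 b' s"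
          by (rule quasistrategy_nonanticipative[OF \<alpha>1 b b' \<open>t > 0\<close> _ s]) (use eq in auto)
        with True show ?thesis by (simp add: \<alpha>_def splice_def)
      next
        case False
        \<comment> \<open>Now \<open>b\<close> and \<open>b'\<close> agree on all of
          \<open>[0, \<tau>]\<close>, so the same position is reached and the same second strategy
          is in force.\<close>
        then have t\<tau>: "t - \<tau> > 0" using s by auto
        have "\<alpha>1 b r = \<alpha>1 b' r" if "r \<in> {0<..\<tau>}" for r
          by (rule quasistrategy_nonanticipative[OF \<alpha>1 b b' \<open>t > 0\<close>]) (use eq that t\<tau> in auto)
        then have "Z b = Z b'"
          unfolding Z_def
          by (intro traj_cong[of _ _ _ _ \<tau>] quasistrategy_control[OF \<alpha>1] b b')
             (use eq t\<tau> \<tau> in auto)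
        moreover have "\<alpha>2 (Z b) (shift_control \<tau> b) (s - \<tau>) = \<alpha>2 (Z b) (shift_control \<tau> b') (s - \<tau>)"
          by (rule quasistrategy_nonanticipative[OF \<alpha>2 control_shift[OF b \<tau>0] control_shift[OF b' \<tau>0] t\<tau>])
             (use eq s False \<tau> in \<open>auto simp: shift_control_def\<close>)
        ultimately show ?thesis using False by (simp add: \<alpha>_def splice_def)
      qed
    qed
    show "V \<rho> x \<le> ?W + e"
      unfolding V_eq[of \<rho>]
    proof (rule upper_value_upper[OF bounded_payoff[OF \<rho>] \<alpha>])
      fix b assume b: "control B b"
      have c: "control A (\<alpha> b)" "control A (\<alpha>1 b)" "control B (shift_control \<tau> b)"
        "control A (\<alpha>2 (Z b) (shift_control \<tau> b))"
        by (intro quasistrategy_control[OF \<alpha>] quasistrategy_control[OF \<alpha>1] quasistrategy_control[OF \<alpha>2]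
            control_shift b \<tau>0)+
      have "traj f x (\<alpha> b) b \<tau> = Z b"
        unfolding Z_def by (intro traj_cong[of _ _ _ _ \<tau>] c b) (use \<tau> in \<open>auto simp: \<alpha>_def splice_def\<close>)
      moreover have "running \<rho> \<tau> x (\<alpha> b) b = running \<rho> \<tau> x (\<alpha>1 b) b"
        by (intro running_cong c b) (auto simp: \<alpha>_def splice_def)
      \<comment> \<open>At time \<open>0\<close> the shifted response still comes from
        \<open>\<alpha>1\<close>; \<open>payoff_cong\<close> ignores that instant.\<close>
      moreover have "payoff \<psi> (Z b) (shift_control \<tau> (\<alpha> b)) (shift_control \<tau> b)
          = payoff \<psi> (Z b) (\<alpha>2 (Z b) (shift_control \<tau> b)) (shift_control \<tau> b)"
        using c b \<tau> by (intro payoff_cong control_shift)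
          (auto simp: shift_control_def splice_def \<alpha>_def)
      ultimately have "payoff \<rho> x (\<alpha> b) b
          = running \<rho> \<tau> x (\<alpha>1 b) b + payoff \<psi> (Z b) (\<alpha>2 (Z b) (shift_control \<tau> b)) (shift_control \<tau> b)"
        using payoff_split[OF \<rho> c(1) b \<tau>0, of x] by (simp add: \<psi>_def)
      also have "\<dots> \<le> running \<rho> \<tau> x (\<alpha>1 b) b + (V \<psi> (Z b) + e / 2)"
        using \<alpha>2_le[OF c(3)] by simp
      also have "\<dots> \<le> ?W + e"
        using \<alpha>1_le[OF b] by (simp add: staged_payoff_def Z_def)
      finally show "payoff \<rho> x (\<alpha> b) b \<le> ?W + e" .
    qed
  qed
  moreover have "?W \<le> V \<rho> x"
    unfolding V_eq[of \<rho>]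
  proof (rule upper_value_lower[OF bounded_payoff[OF \<rho>]])
    fix \<alpha> and e :: real assume \<alpha>: "quasistrategy A B \<alpha>" and "e > 0"
    then have e: "e / 2 > 0" by simp
    obtain b1 where b1: "control B b1" "?W - e / 2 \<le> staged_payoff \<rho> \<tau> (V \<psi>) x (\<alpha> b1) b1"
      using upper_value_response[OF bW \<alpha> e] by blast
    define z where "z = traj f x (\<alpha> b1) b1 \<tau>"
    \<comment> \<open>The reaction of \<open>\<alpha>\<close> after \<open>\<tau>\<close> when
      \<open>b1\<close> has been played until then.\<close>
    define \<beta> where "\<beta> b = shift_control \<tau> (\<alpha> (splice \<tau> b1 b))" for b
    have \<beta>: "quasistrategy A B \<beta>"
      unfolding quasistrategy_def
    proof (intro conjI allI impI ballI)
      fix b assume b: "control B b"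
      show "control A (\<beta> b)"
        unfolding \<beta>_def by (intro control_shift quasistrategy_control[OF \<alpha>] control_splice b b1 \<tau> \<tau>0)
    next
      fix b b' :: "real \<Rightarrow> 'b" and t s :: real
      assume b: "control B b" and b': "control B b'" and "t > 0"
        and eq: "\<forall>s\<in>{0..t}. b s = b' s" and s: "s \<in> {0..t}"
      have "\<alpha> (splice \<tau> b1 b) (s + \<tau>) = \<alpha> (splice \<tau> b1 b') (s + \<tau>)"
        by (rule quasistrategy_nonanticipative[OF \<alpha>, where t = "t + \<tau>"])
           (use b b' b1 \<tau> \<open>t > 0\<close> eq s in \<open>auto intro!: control_splice simp: splice_def\<close>)
      then show "\<beta> b s = \<beta> b' s" by (simp add: \<beta>_def shift_control_def)
    qed
    obtain b2 where b2: "control B b2" "V \<psi> z - e / 2 \<le> payoff \<psi> z (\<beta> b2) b2"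
      using upper_value_response[OF bounded_payoff[OF \<psi>] \<beta> e, of z] unfolding V_eq by blast
    define b where "b = splice \<tau> b1 b2"
    have b: "control B b" unfolding b_def by (intro control_splice b1 b2 \<tau>)
    have c: "control A (\<alpha> b)" "control A (\<alpha> b1)" by (intro quasistrategy_control[OF \<alpha>] b b1)+
    have b_eq: "b s = b1 s" if "s \<in> {0..\<tau>}" for s using that by (simp add: b_def splice_def)
    have \<alpha>_eq: "\<alpha> b s = \<alpha> b1 s" if "s \<in> {0..\<tau>}" for s
      by (rule quasistrategy_nonanticipative[OF \<alpha> b b1(1) \<tau> b_eq that])
    have "traj f x (\<alpha> b) b \<tau> = z"
      unfolding z_def by (rule traj_cong[OF c(1) b c(2) b1(1), of \<tau>]) (use \<tau> b_eq \<alpha>_eq in auto)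
    moreover have "running \<rho> \<tau> x (\<alpha> b) b = running \<rho> \<tau> x (\<alpha> b1) b1"
      by (rule running_cong[OF c(1) b c(2) b1(1)]) (use \<tau> b_eq \<alpha>_eq in auto)
    moreover have "payoff \<psi> z (shift_control \<tau> (\<alpha> b)) (shift_control \<tau> b) = payoff \<psi> z (\<beta> b2) b2"
      by (intro payoff_cong control_shift c b b2 \<tau>0 quasistrategy_control[OF \<beta>])
         (auto simp: \<beta>_def b_def shift_control_def splice_def)
    ultimately have "payoff \<rho> x (\<alpha> b) b = running \<rho> \<tau> x (\<alpha> b1) b1 + payoff \<psi> z (\<beta> b2) b2"
      using payoff_split[OF \<rho> c(1) b \<tau>0, of x] by (simp add: \<psi>_def)
    then have "?W - e \<le> payoff \<rho> x (\<alpha> b) b"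
      using b1(2) b2(2) by (simp add: staged_payoff_def z_def)
    with b show "\<exists>b. control B b \<and> ?W - e \<le> payoff \<rho> x (\<alpha> b) b" by blast
  qed
  ultimately show ?thesis by (simp add: \<psi>_def)
qed

end

section \<open>Densities whose rescaled values converge\<close>

locale invariant_game = differential_game A B f g L
  for A :: "'a::euclidean_space set" and B :: "'b::euclidean_space set"
    and f :: "'x::euclidean_space \<Rightarrow> 'a \<Rightarrow> 'b \<Rightarrow> 'x" and g L +
  fixes \<Omega> :: "'x set" and U :: "'x \<Rightarrow> real"
  assumes \<Omega>_inv: "\<And>x0 a b t. x0 \<in> \<Omega> \<Longrightarrow> control A a \<Longrightarrow> control B b \<Longrightarrow> t \<ge> 0 \<Longrightarrow>
               traj f x0 a b t \<in> \<Omega>"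
    and U_range: "\<And>\<omega>. \<omega> \<in> \<Omega> \<Longrightarrow> U \<omega> \<in> {0..1}"
begin

text \<open>The mass is not normalised, because tails of probability densities must qualify too. The
  epsilon form replaces the supremum in \<open>unif_conv\<close>, whose value is meaningless on
  unbounded sets.\<close>

definition convergent_density :: "(real \<Rightarrow> real) \<Rightarrow> bool" where
  "convergent_density \<psi> \<longleftrightarrow> hl_integrable \<psi> \<and> (\<forall>t\<ge>0. 0 \<le> \<psi> t) \<and>
     (\<forall>e>0. \<exists>d>0. \<forall>l. 0 < l \<longrightarrow> l < d \<longrightarrow>
        (\<forall>\<omega>\<in>\<Omega>. \<bar>V (scale_density \<psi> l) \<omega> - mass \<psi> * U \<omega>\<bar> \<le> e))"

lemma convergent_integrable: "convergent_density \<psi> \<Longrightarrow> hl_integrable \<psi>"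
  and convergent_nonneg: "convergent_density \<psi> \<Longrightarrow> t \<ge> 0 \<Longrightarrow> 0 \<le> \<psi> t"
  by (auto simp: convergent_density_def)

lemma convergent_limit:
  assumes "convergent_density \<psi>" "e > 0"
  obtains d where "d > 0" "\<And>l \<omega>. 0 < l \<Longrightarrow> l < d \<Longrightarrow> \<omega> \<in> \<Omega> \<Longrightarrow>
    \<bar>V (scale_density \<psi> l) \<omega> - mass \<psi> * U \<omega>\<bar> \<le> e"
  using assms unfolding convergent_density_def by metis

lemma convergent_cong_pos:
  assumes "convergent_density \<psi>" "\<And>t. t > 0 \<Longrightarrow> \<psi> t = \<psi>' t" "\<psi>' 0 \<ge> 0"
  shows "convergent_density \<psi>'"
proof -
  have "mass \<psi> = mass \<psi>'" by (rule mass_cong_pos) (rule assms(2))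
  moreover have "V (scale_density \<psi> l) \<omega> = V (scale_density \<psi>' l) \<omega>" if "l > 0" for l \<omega>
    using that assms(2) by (intro V_cong_pos) (simp add: scale_density_def)
  moreover have "hl_integrable \<psi>'"
    by (rule hl_integrable_cong_pos[OF convergent_integrable[OF assms(1)]]) (rule assms(2))
  moreover have "\<psi>' t \<ge> 0" if "t \<ge> 0" for t
    using that assms(2)[of t] convergent_nonneg[OF assms(1), of t] assms(3) by (cases "t = 0") auto
  ultimately show ?thesis
    using assms(1) unfolding convergent_density_def by simp
qed

lemma convergent_scale:
  assumes "convergent_density \<psi>" "k > 0"
  shows "convergent_density (scale_density \<psi> k)"
  unfolding convergent_density_def
proof (intro conjI allI impI)
  show "hl_integrable (scale_density \<psi> k)"
    by (rule hl_integrable_scale[OF convergent_integrable[OF assms(1)] assms(2)])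
  show "0 \<le> scale_density \<psi> k t" if "t \<ge> 0" for t
    using that assms convergent_nonneg[OF assms(1), of "k * t"] by (simp add: scale_density_def)
  fix e :: real assume "e > 0"
  from convergent_limit[OF assms(1) this] obtain d where d: "d > 0"
    "\<And>l \<omega>. 0 < l \<Longrightarrow> l < d \<Longrightarrow> \<omega> \<in> \<Omega> \<Longrightarrow> \<bar>V (scale_density \<psi> l) \<omega> - mass \<psi> * U \<omega>\<bar> \<le> e" by blast
  have sc: "scale_density (scale_density \<psi> k) l = scale_density \<psi> (k * l)" for l
    by (auto simp: scale_density_def fun_eq_iff mult_ac)
  show "\<exists>d>0. \<forall>l. 0 < l \<longrightarrow> l < d \<longrightarrow> (\<forall>\<omega>\<in>\<Omega>.
      \<bar>V (scale_density (scale_density \<psi> k) l) \<omega> - mass (scale_density \<psi> k) * U \<omega>\<bar> \<le> e)"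
    using d \<open>k > 0\<close> unfolding sc mass_scale[OF \<open>k > 0\<close>]
    by (intro exI[of _ "d / k"]) (auto simp: field_simps)
qed

lemma convergent_cmult:
  assumes "convergent_density \<psi>" "c > 0"
  shows "convergent_density (\<lambda>t. c * \<psi> t)"
  unfolding convergent_density_def
proof (intro conjI allI impI)
  show "hl_integrable (\<lambda>t. c * \<psi> t)"
    using convergent_integrable[OF assms(1)] by simp
  show "0 \<le> c * \<psi> t" if "t \<ge> 0" for t
    using that assms convergent_nonneg[OF assms(1), of t] by simp
  fix e :: real assume "e > 0"
  then have "e / c > 0" using \<open>c > 0\<close> by simp
  from convergent_limit[OF assms(1) this] obtain d where d: "d > 0"
    "\<And>l \<omega>. 0 < l \<Longrightarrow> l < d \<Longrightarrow> \<omega> \<in> \<Omega> \<Longrightarrow> \<bar>V (scale_density \<psi> l) \<omega> - mass \<psi> * U \<omega>\<bar> \<le> e / c" by blast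
  have "\<bar>V (scale_density (\<lambda>t. c * \<psi> t) l) \<omega> - mass (\<lambda>t. c * \<psi> t) * U \<omega>\<bar> \<le> e"
    if "0 < l" "l < d" "\<omega> \<in> \<Omega>" for l \<omega>
  proof -
    have "scale_density (\<lambda>t. c * \<psi> t) l = (\<lambda>t. c * scale_density \<psi> l t)"
      by (auto simp: scale_density_def fun_eq_iff)
    then have "V (scale_density (\<lambda>t. c * \<psi> t) l) \<omega> = c * V (scale_density \<psi> l) \<omega>"
      using V_cmult[OF hl_integrable_scale[OF convergent_integrable[OF assms(1)] \<open>l > 0\<close>] \<open>c > 0\<close>] by simp
    then have "\<bar>V (scale_density (\<lambda>t. c * \<psi> t) l) \<omega> - mass (\<lambda>t. c * \<psi> t) * U \<omega>\<bar>
        = c * \<bar>V (scale_density \<psi> l) \<omega> - mass \<psi> * U \<omega>\<bar>"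
      using \<open>c > 0\<close> by (simp add: mass_cmult abs_mult mult.assoc flip: right_diff_distrib)
    also have "\<dots> \<le> c * (e / c)"
      using d(2)[OF that] \<open>c > 0\<close> by (intro mult_left_mono) auto
    finally show ?thesis using \<open>c > 0\<close> by simp
  qed
  with d(1) show "\<exists>d>0. \<forall>l. 0 < l \<longrightarrow> l < d \<longrightarrow> (\<forall>\<omega>\<in>\<Omega>.
      \<bar>V (scale_density (\<lambda>t. c * \<psi> t) l) \<omega> - mass (\<lambda>t. c * \<psi> t) * U \<omega>\<bar> \<le> e)" by blast
qed

text \<open>Rescaling preserves \<open>L1\<close> distances, so the bound does not depend on
  \<open>l\<close>; this is what lets approximation commute with the limit in
  \<open>l\<close>.\<close>

lemma V_scale_L1:
  assumes "hl_integrable \<mu>" "hl_integrable \<phi>" "l > 0"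
  shows "\<bar>V (scale_density \<mu> l) x - V (scale_density \<phi> l) x\<bar> \<le> mass (\<lambda>t. \<bar>\<mu> t - \<phi> t\<bar>)"
proof -
  have "(\<lambda>t. \<bar>scale_density \<mu> l t - scale_density \<phi> l t\<bar>) = scale_density (\<lambda>t. \<bar>\<mu> t - \<phi> t\<bar>) l"
    using \<open>l > 0\<close> by (auto simp: scale_density_def fun_eq_iff abs_mult simp flip: right_diff_distrib)
  with V_L1[OF hl_integrable_scale[OF assms(1,3)] hl_integrable_scale[OF assms(2,3)], of x]
  show ?thesis using mass_scale[OF \<open>l > 0\<close>] by simp
qed

text \<open>The values differ by at most the \<open>L1\<close> distance for every \<open>l\<close>,
  and \<open>U\<close> lies in \<open>[0, 1]\<close>, so the limit \<open>mass \<mu> * U\<close>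
  moves by no more than the mass does.\<close>

lemma convergent_L1_closed:
  assumes \<mu>: "hl_integrable \<mu>" "\<And>t. t \<ge> 0 \<Longrightarrow> 0 \<le> \<mu> t"
    and approx: "\<And>e. e > 0 \<Longrightarrow> \<exists>\<phi>. convergent_density \<phi> \<and> mass (\<lambda>t. \<bar>\<mu> t - \<phi> t\<bar>) \<le> e"
  shows "convergent_density \<mu>"
  unfolding convergent_density_def
proof (intro conjI allI impI \<mu>)
  fix e :: real assume "e > 0"
  then have e3: "e / 3 > 0" by simp
  from approx[OF this] obtain \<phi> where \<phi>: "convergent_density \<phi>" and near: "mass (\<lambda>t. \<bar>\<mu> t - \<phi> t\<bar>) \<le> e / 3" by blast
  note \<phi>i = convergent_integrable[OF \<phi>]
  from convergent_limit[OF \<phi> e3] obtain d where d: "d > 0"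
    "\<And>l \<omega>. 0 < l \<Longrightarrow> l < d \<Longrightarrow> \<omega> \<in> \<Omega> \<Longrightarrow> \<bar>V (scale_density \<phi> l) \<omega> - mass \<phi> * U \<omega>\<bar> \<le> e / 3" by blast
  have "\<bar>mass \<mu> - mass \<phi>\<bar> \<le> mass (\<lambda>t. \<bar>\<mu> t - \<phi> t\<bar>)"
    using abs_mass_le[OF set_integral_diff(1)[OF \<mu>(1) \<phi>i]] mass_diff[OF \<mu>(1) \<phi>i] by simp
  with near have m: "\<bar>mass \<mu> - mass \<phi>\<bar> \<le> e / 3" by simp
  have "\<bar>V (scale_density \<mu> l) \<omega> - mass \<mu> * U \<omega>\<bar> \<le> e" if l: "0 < l" "l < d" "\<omega> \<in> \<Omega>" for l \<omega>
  proof -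
    have "\<bar>mass \<phi> * U \<omega> - mass \<mu> * U \<omega>\<bar> = \<bar>mass \<mu> - mass \<phi>\<bar> * \<bar>U \<omega>\<bar>"
      by (subst abs_minus_commute) (simp add: abs_mult left_diff_distrib[symmetric])
    also have "\<dots> \<le> (e / 3) * 1"
      using U_range[OF l(3)] m e3 by (intro mult_mono) auto
    finally show ?thesis
      using d(2)[OF l] V_scale_L1[OF \<mu>(1) \<phi>i l(1), of \<omega>] near by linarith
  qed
  with d(1) show "\<exists>d>0. \<forall>l. 0 < l \<longrightarrow> l < d \<longrightarrow> (\<forall>\<omega>\<in>\<Omega>.
      \<bar>V (scale_density \<mu> l) \<omega> - mass \<mu> * U \<omega>\<bar> \<le> e)" by blast
qed

text \<open>By dynamic programming, the values of \<open>\<mu>\<close> and of the spliced density are upper values with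
  the same running payoff, and their continuation values have the same limit.\<close>

lemma convergent_splice:
  assumes \<mu>: "convergent_density \<mu>" and tail: "convergent_density (\<lambda>t. \<mu> (t + h))" and \<psi>: "convergent_density \<psi>"
    and m: "mass \<psi> = mass (\<lambda>t. \<mu> (t + h))" and h: "h > 0"
  shows "convergent_density (\<lambda>t. if t \<le> h then \<mu> t else \<psi> (t - h))"
proof -
  define \<xi> where "\<xi> t = (if t \<le> h then \<mu> t else \<psi> (t - h))" for t
  have h0: "h \<ge> 0" using h by simp
  note \<mu>i = convergent_integrable[OF \<mu>] and \<psi>i = convergent_integrable[OF \<psi>] and ti = convergent_integrable[OF tail]
  have \<mu>h: "set_integrable lborel {0..h} \<mu>" by (rule set_integrable_subset[OF \<mu>i]) auto
  have \<xi>i: "hl_integrable \<xi>" unfolding \<xi>_def by (rule hl_integrable_splice[OF \<mu>h \<psi>i h0])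
  have \<xi>m: "mass \<xi> = mass \<mu>"
    unfolding \<xi>_def mass_splice[OF \<mu>h \<psi>i h0] set_integral_split_at[OF \<mu>i h0] m ..
  have "convergent_density \<xi>"
    unfolding convergent_density_def
  proof (intro conjI allI impI \<xi>i)
    show "0 \<le> \<xi> t" if "t \<ge> 0" for t
      using that convergent_nonneg[OF \<mu>] convergent_nonneg[OF \<psi>] by (simp add: \<xi>_def)
    fix e :: real assume "e > 0"
    then have e3: "e / 3 > 0" by simp
    from convergent_limit[OF \<mu> e3] obtain d1 where d1: "d1 > 0"
      "\<And>l \<omega>. 0 < l \<Longrightarrow> l < d1 \<Longrightarrow> \<omega> \<in> \<Omega> \<Longrightarrow> \<bar>V (scale_density \<mu> l) \<omega> - mass \<mu> * U \<omega>\<bar> \<le> e / 3" by blast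
    from convergent_limit[OF tail e3] obtain d2 where d2: "d2 > 0"
      "\<And>l \<omega>. 0 < l \<Longrightarrow> l < d2 \<Longrightarrow> \<omega> \<in> \<Omega> \<Longrightarrow>
        \<bar>V (scale_density (\<lambda>t. \<mu> (t + h)) l) \<omega> - mass (\<lambda>t. \<mu> (t + h)) * U \<omega>\<bar> \<le> e / 3" by blast
    from convergent_limit[OF \<psi> e3] obtain d3 where d3: "d3 > 0"
      "\<And>l \<omega>. 0 < l \<Longrightarrow> l < d3 \<Longrightarrow> \<omega> \<in> \<Omega> \<Longrightarrow> \<bar>V (scale_density \<psi> l) \<omega> - mass \<psi> * U \<omega>\<bar> \<le> e / 3" by blast
    have "\<bar>V (scale_density \<xi> l) \<omega> - mass \<xi> * U \<omega>\<bar> \<le> e"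
      if l: "0 < l" "l < min d1 (min d2 d3)" and \<omega>: "\<omega> \<in> \<Omega>" for l \<omega>
    proof -
      \<comment> \<open>Rescaling by \<open>l\<close> moves the seam from \<open>h\<close> to
        \<open>h / l\<close>.\<close>
      define \<tau> where "\<tau> = h / l"
      have \<tau>: "\<tau> > 0" "\<tau> \<ge> 0" "l * \<tau> = h" using h l by (auto simp: \<tau>_def)
      have i: "hl_integrable (scale_density \<xi> l)" "hl_integrable (scale_density \<mu> l)"
        "hl_integrable (scale_density \<psi> l)" "hl_integrable (scale_density (\<lambda>t. \<mu> (t + h)) l)"
        by (intro hl_integrable_scale \<xi>i \<mu>i \<psi>i ti l)+
      let ?F = "V (scale_density \<psi> l)" and ?G = "V (scale_density (\<lambda>t. \<mu> (t + h)) l)"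
      have "V (\<lambda>t. scale_density \<xi> l (t + \<tau>)) = ?F"
        using l \<tau> by (intro ext V_cong_pos) (auto simp: scale_density_def \<xi>_def distrib_left mult_le_0_iff)
      then have 1: "V (scale_density \<xi> l) \<omega> = upper_value (staged_payoff (scale_density \<xi> l) \<tau> ?F \<omega>)"
        using dynamic_programming[OF i(1) \<tau>(1), of \<omega>] by simp
      have "V (\<lambda>t. scale_density \<mu> l (t + \<tau>)) = ?G"
        using \<tau> by (intro ext V_cong_pos) (auto simp: scale_density_def distrib_left)
      then have 2: "V (scale_density \<mu> l) \<omega> = upper_value (staged_payoff (scale_density \<mu> l) \<tau> ?G \<omega>)"
        using dynamic_programming[OF i(2) \<tau>(1), of \<omega>] by simp
      have "\<bar>V (scale_density \<xi> l) \<omega> - V (scale_density \<mu> l) \<omega>\<bar> \<le> 2 * (e / 3)"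
        unfolding 1 2
      proof (rule upper_value_dist)
        show "bounded_payoff (staged_payoff (scale_density \<xi> l) \<tau> ?F \<omega>)"
          "bounded_payoff (staged_payoff (scale_density \<mu> l) \<tau> ?G \<omega>)"
          by (rule bounded_staged_payoff, rule i, rule V_abs_le, rule i, rule \<tau>)+
        fix a b assume ab: "control A a" "control B b"
        let ?z = "traj f \<omega> a b \<tau>"
        \<comment> \<open>The position at the seam depends on the controls and on \<open>l\<close>;
          only invariance together with limits uniform on \<open>\<Omega>\<close> makes the
          estimates usable there.\<close>
        have z: "?z \<in> \<Omega>" by (rule \<Omega>_inv[OF \<omega> ab \<tau>(2)])
        have "l * s \<le> h" if "s \<in> {0..\<tau>}" for s
          using that l \<tau>(3) mult_left_mono[of s \<tau> l] by simp
        then have "running (scale_density \<xi> l) \<tau> \<omega> a b = running (scale_density \<mu> l) \<tau> \<omega> a b"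
          by (intro running_cong ab) (auto simp: scale_density_def \<xi>_def)
        moreover have "\<bar>?F ?z - ?G ?z\<bar> \<le> 2 * (e / 3)"
        proof -
          have "\<bar>?F ?z - mass \<psi> * U ?z\<bar> \<le> e / 3"
            by (rule d3(2)[OF l(1) _ z]) (use l in simp)
          moreover have "\<bar>?G ?z - mass \<psi> * U ?z\<bar> \<le> e / 3"
            unfolding m by (rule d2(2)[OF l(1) _ z]) (use l in simp)
          ultimately show ?thesis by linarith
        qed
        ultimately show "\<bar>staged_payoff (scale_density \<xi> l) \<tau> ?F \<omega> a b
            - staged_payoff (scale_density \<mu> l) \<tau> ?G \<omega> a b\<bar> \<le> 2 * (e / 3)"
          by (simp add: staged_payoff_def)
      qed
      moreover have "\<bar>V (scale_density \<mu> l) \<omega> - mass \<xi> * U \<omega>\<bar> \<le> e / 3"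
        unfolding \<xi>m by (rule d1(2)[OF l(1) _ \<omega>]) (use l in simp)
      ultimately show ?thesis by linarith
    qed
    then show "\<exists>d>0. \<forall>l. 0 < l \<longrightarrow> l < d \<longrightarrow> (\<forall>\<omega>\<in>\<Omega>.
        \<bar>V (scale_density \<xi> l) \<omega> - mass \<xi> * U \<omega>\<bar> \<le> e)"
      using d1(1) d2(1) d3(1) by (intro exI[of _ "min d1 (min d2 d3)"]) auto
  qed
  then show ?thesis by (simp add: \<xi>_def[abs_def])
qed

end

section \<open>Self-similar densities generate all densities\<close>

lemma set_integral_const_Icc:
  fixes c :: real assumes "h \<ge> 0"
  shows "set_integrable lborel {0..h} (\<lambda>_. c)" "(LINT t:{0..h}|lborel. c) = c * h"
  using assms
  by (simp_all add: set_integrable_def set_lebesgue_integral_def emeasure_lborel_Icc_eq measure_def)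

text \<open>Feeds the intermediate value theorem that finds a cutting point with a prescribed tail
  mass.\<close>

lemma continuous_on_mass_tail:
  assumes \<mu>: "hl_integrable \<mu>"
  shows "continuous_on {0..c} (\<lambda>s. mass (\<lambda>t. \<mu> (t + s)))"
proof -
  have i: "set_integrable lborel {0..s} \<mu>" for s
    by (rule set_integrable_subset[OF \<mu>]) auto
  have "continuous_on {0..c} (\<lambda>s. mass \<mu> - integral {0..s} \<mu>)"
    by (intro continuous_intros indefinite_integral_continuous_1 set_borel_integral_eq_integral(1)[OF i])
  moreover have "mass \<mu> - integral {0..s} \<mu> = mass (\<lambda>t. \<mu> (t + s))" if "s \<in> {0..c}" for s
    using set_integral_split_at[OF \<mu>, of s] set_borel_integral_eq_integral(2)[OF i, of s] that by simp
  ultimately show ?thesis by (rule continuous_on_eq)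
qed

lemma set_integral_average_dist:
  fixes \<gamma> :: "real \<Rightarrow> real"
  assumes \<gamma>: "set_integrable lborel {0..h} \<gamma>" and h: "h > 0"
    and avg: "(LINT t:{0..h}|lborel. \<gamma> t) = c * h"
    and le: "\<And>t. t \<in> {0..h} \<Longrightarrow> \<bar>\<gamma> t - X\<bar> \<le> d"
  shows "\<bar>c - X\<bar> \<le> d"
proof -
  have h0: "h \<ge> 0" using h by simp
  have "(LINT t:{0..h}|lborel. \<gamma> t) \<le> (LINT t:{0..h}|lborel. X + d)"
  proof (rule set_integral_mono[OF \<gamma> set_integral_const_Icc(1)[OF h0]])
    fix t assume "t \<in> {0..h}" from le[OF this] show "\<gamma> t \<le> X + d" by linarith
  qed
  moreover have "(LINT t:{0..h}|lborel. X - d) \<le> (LINT t:{0..h}|lborel. \<gamma> t)"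
  proof (rule set_integral_mono[OF set_integral_const_Icc(1)[OF h0] \<gamma>])
    fix t assume "t \<in> {0..h}" from le[OF this] show "X - d \<le> \<gamma> t" by linarith
  qed
  ultimately have "c * h \<le> (X + d) * h" "(X - d) * h \<le> c * h"
    by (simp_all only: avg set_integral_const_Icc(2)[OF h0])
  then show ?thesis using h by (auto simp: abs_le_iff)
qed

text \<open>Self-similarity is asked only for small \<open>s\<close>, since the uniform density has
  it only inside its support. \<open>q\<close> is the height at \<open>0\<close>; measuring the
  deviation relative to \<open>q\<close> makes it insensitive to rescaling and to constant
  factors.\<close>

locale self_similar_game = invariant_game A B f g L \<Omega> U
  for A :: "'a::euclidean_space set" and B :: "'b::euclidean_space set"
    and f :: "'x::euclidean_space \<Rightarrow> 'a \<Rightarrow> 'b \<Rightarrow> 'x" and g L \<Omega> U +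
  fixes \<mu>\<^sub>0 :: "real \<Rightarrow> real" and s\<^sub>1 q :: real
  assumes \<mu>0_convergent: "convergent_density \<mu>\<^sub>0" and \<mu>0_mass: "mass \<mu>\<^sub>0 = 1"
    and s1_pos: "s\<^sub>1 > 0"
    and self_similar: "\<And>s. s \<in> {0..s\<^sub>1} \<Longrightarrow> \<exists>c>0. \<exists>\<kappa>>0. \<forall>t\<ge>0. \<mu>\<^sub>0 (t + s) = c * \<mu>\<^sub>0 (\<kappa> * t)"
    and q_pos: "q > 0"
    and at_0: "\<And>e. e > 0 \<Longrightarrow> \<exists>\<delta>>0. \<forall>u\<in>{0..\<delta>}. \<bar>\<mu>\<^sub>0 u - q\<bar> \<le> e * q"
begin

lemma tail_convergent:
  assumes "s \<in> {0..s\<^sub>1}"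
  shows "convergent_density (\<lambda>t. \<mu>\<^sub>0 (t + s))" "mass (\<lambda>t. \<mu>\<^sub>0 (t + s)) > 0"
proof -
  from self_similar[OF assms] obtain c \<kappa> where c: "c > 0" "\<kappa> > 0"
    and eq: "\<And>t. t \<ge> 0 \<Longrightarrow> \<mu>\<^sub>0 (t + s) = c * \<mu>\<^sub>0 (\<kappa> * t)" by blast
  \<comment> \<open>\<open>scale_density\<close> brings its own factor \<open>\<kappa>\<close>,
    hence the quotient \<open>c / \<kappa>\<close>, which is also the mass of the tail.\<close>
  have eq': "c / \<kappa> * scale_density \<mu>\<^sub>0 \<kappa> t = \<mu>\<^sub>0 (t + s)" if "t > 0" for t
    using that c eq[of t] by (simp add: scale_density_def)
  have "0 \<le> \<mu>\<^sub>0 (0 + s)"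
    by (rule convergent_nonneg[OF \<mu>0_convergent]) (use assms in auto)
  then show "convergent_density (\<lambda>t. \<mu>\<^sub>0 (t + s))"
    using c by (intro convergent_cong_pos[OF convergent_cmult[OF convergent_scale[OF \<mu>0_convergent \<open>\<kappa> > 0\<close>], of "c / \<kappa>"] eq']) auto
  have "mass (\<lambda>t. \<mu>\<^sub>0 (t + s)) = mass (\<lambda>t. c / \<kappa> * scale_density \<mu>\<^sub>0 \<kappa> t)"
    by (rule mass_cong_pos) (rule eq'[symmetric])
  also have "\<dots> = c / \<kappa>"
    unfolding mass_cmult mass_scale[OF \<open>\<kappa> > 0\<close>] \<mu>0_mass by simp
  finally show "mass (\<lambda>t. \<mu>\<^sub>0 (t + s)) > 0" using c by simp
qed

text \<open>A short block \<open>\<gamma>\<close> of nearly constant height \<open>c\<close>, followed by \<open>\<psi>\<close>, is replaced by a rescaled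
  initial piece of \<open>\<mu>\<^sub>0\<close> of the same mass, followed by a convergent \<open>\<phi>\<close>. Since the block carries only a
  small fraction \<open>p\<close> of the remaining mass, that piece stays near \<open>0\<close>, where \<open>\<mu>\<^sub>0\<close> is nearly
  constant.\<close>

lemma block_approx:
  assumes "e > 0"
  shows "\<exists>p>0. \<forall>h \<gamma> \<psi> \<phi> c d. h > 0 \<longrightarrow> c > 0 \<longrightarrow> set_integrable lborel {0..h} \<gamma> \<longrightarrow>
    (LINT t:{0..h}|lborel. \<gamma> t) = c * h \<longrightarrow> (\<forall>t\<in>{0..h}. \<bar>\<gamma> t - c\<bar> \<le> d) \<longrightarrow>
    hl_integrable \<psi> \<longrightarrow> convergent_density \<phi> \<longrightarrow> mass \<phi> > 0 \<longrightarrow> c * h \<le> p * mass \<phi> \<longrightarrow>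
    (\<exists>\<phi>'. convergent_density \<phi>' \<and> mass \<phi>' = mass \<phi> + c * h \<and>
       mass (\<lambda>t. \<bar>(if t \<le> h then \<gamma> t else \<psi> (t - h)) - \<phi>' t\<bar>) \<le> mass (\<lambda>t. \<bar>\<psi> t - \<phi> t\<bar>) + (d + e * c) * h)"
proof -
  \<comment> \<open>The bound \<open>1 / 2\<close> keeps the heights \<open>X\<close> and
    \<open>c\<close> below comparable, with \<open>X \<le> 2 * c\<close>; the bound
    \<open>e / 4\<close> pays for two errors \<open>e1 * X\<close>, each then at most
    \<open>2 * e1 * c\<close>.\<close>
  define e1 where "e1 = min (e / 4) (1 / 2)"
  have e1: "e1 > 0" "e1 \<le> 1 / 2" "4 * e1 \<le> e" using assms by (auto simp: e1_def)
  from at_0[OF e1(1)] obtain \<delta>0 where \<delta>0: "\<delta>0 > 0" "\<And>u. u \<in> {0..\<delta>0} \<Longrightarrow> \<bar>\<mu>\<^sub>0 u - q\<bar> \<le> e1 * q" by blast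
  define \<delta> where "\<delta> = min \<delta>0 s\<^sub>1"
  have \<delta>: "\<delta> > 0" "\<delta> \<le> s\<^sub>1" "\<And>u. u \<in> {0..\<delta>} \<Longrightarrow> \<bar>\<mu>\<^sub>0 u - q\<bar> \<le> e1 * q"
    using \<delta>0 s1_pos by (auto simp: \<delta>_def)
  note \<mu>0i = convergent_integrable[OF \<mu>0_convergent]
  define m where "m s = mass (\<lambda>t. \<mu>\<^sub>0 (t + s))" for s
  have m0: "m 0 = 1" using \<mu>0_mass by (simp add: m_def)
  have mpos: "m \<delta> > 0" unfolding m_def by (rule tail_convergent) (use \<delta> in auto)
  have \<mu>0_Icc: "set_integrable lborel {0..s} \<mu>\<^sub>0" for s by (rule set_integrable_subset[OF \<mu>0i]) auto
  \<comment> \<open>\<open>\<mu>\<^sub>0\<close> stays close to \<open>q > 0\<close> on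
    \<open>[0, \<delta>]\<close>, so some mass lies there; this makes \<open>p\<close>
    positive.\<close>
  have "m \<delta> < 1"
  proof -
    define c where "c = (LINT t:{0..\<delta>}|lborel. \<mu>\<^sub>0 t) / \<delta>"
    have c\<delta>: "(LINT t:{0..\<delta>}|lborel. \<mu>\<^sub>0 t) = c * \<delta>" using \<delta>(1) by (simp add: c_def)
    have "\<bar>c - q\<bar> \<le> e1 * q"
      by (rule set_integral_average_dist[OF \<mu>0_Icc \<delta>(1) c\<delta> \<delta>(3)])
    moreover have "e1 * q \<le> 1 / 2 * q" using e1 q_pos by (intro mult_right_mono) auto
    ultimately have "c > 0" using q_pos by linarith
    then have "c * \<delta> > 0" using \<delta>(1) by simp
    then show ?thesis
      using set_integral_split_at[OF \<mu>0i, of \<delta>] \<delta>(1) c\<delta> \<mu>0_mass by (simp add: m_def)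
  qed
  \<comment> \<open>Equivalently \<open>m \<delta> = 1 / (1 + p)\<close>: a block of mass at most
    \<open>p * mass \<phi>\<close> leaves at least this fraction to \<open>\<phi>\<close>, which
    forces the cut \<open>s\<close> below into \<open>[0, \<delta>]\<close>.\<close>
  define p where "p = 1 / m \<delta> - 1"
  have p: "p > 0" "m \<delta> * (1 + p) = 1" using mpos \<open>m \<delta> < 1\<close> by (simp_all add: p_def field_simps)
  show ?thesis
  proof (intro exI[of _ p] conjI allI impI p)
    fix h \<gamma> \<psi> \<phi> and c d :: real
    assume h: "h > 0" and c: "c > 0" and \<gamma>: "set_integrable lborel {0..h} \<gamma>"
      and avg: "(LINT t:{0..h}|lborel. \<gamma> t) = c * h" and dev: "\<forall>t\<in>{0..h}. \<bar>\<gamma> t - c\<bar> \<le> d"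
      and \<psi>: "hl_integrable \<psi>" and \<phi>: "convergent_density \<phi>" and r: "mass \<phi> > 0" and small: "c * h \<le> p * mass \<phi>"
    have h0: "h \<ge> 0" using h by simp
    define r' where "r' = mass \<phi> + c * h"
    have r': "r' > 0" using r c h by (simp add: r'_def add_pos_pos)
    have "m \<delta> \<le> mass \<phi> / r'"
    proof -
      have "m \<delta> * r' \<le> m \<delta> * (mass \<phi> + p * mass \<phi>)"
        using small mpos by (intro mult_left_mono) (auto simp: r'_def)
      also have "\<dots> = (m \<delta> * (1 + p)) * mass \<phi>" by (simp add: algebra_simps)
      finally show ?thesis using p r' by (simp add: field_simps)
    qed
    moreover have "mass \<phi> / r' \<le> m 0" using r r' c h by (simp add: m0 r'_def)
    moreover have "continuous_on {0..\<delta>} m"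
      unfolding m_def by (rule continuous_on_mass_tail[OF \<mu>0i])
    \<comment> \<open>Beyond \<open>s\<close>, \<open>\<mu>\<^sub>0\<close> carries the same
      fraction of its mass as \<open>\<phi>\<close> has in the total \<open>r'\<close>. Multiplied
      by \<open>r'\<close>, its tail can thus be exchanged for \<open>\<phi>\<close>.\<close>
    ultimately obtain s where s: "0 \<le> s" "s \<le> \<delta>" "m s = mass \<phi> / r'"
      using IVT2'[of m \<delta> "mass \<phi> / r'" 0] \<delta>(1) by auto
    have "s \<noteq> 0"
      using s(3) m0 r' c h by (auto simp: r'_def field_simps)
    with s have s_pos: "s > 0" by simp
    \<comment> \<open>Rescaling by \<open>k\<close> moves the cut from \<open>s\<close> to
      \<open>h\<close>.\<close>
    define k where "k = s / h"
    have k: "k > 0" "k * h = s" using s_pos h by (auto simp: k_def)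
    define \<xi> where "\<xi> t = r' * scale_density \<mu>\<^sub>0 k t" for t
    have \<xi>: "convergent_density \<xi>" unfolding \<xi>_def by (intro convergent_cmult convergent_scale \<mu>0_convergent k r')
    have \<xi>_shift: "\<xi> (t + h) = r' * scale_density (\<lambda>t. \<mu>\<^sub>0 (t + s)) k t" for t
      using k by (simp add: \<xi>_def scale_density_def distrib_left)
    have \<xi>_tail: "convergent_density (\<lambda>t. \<xi> (t + h))"
      unfolding \<xi>_shift by (intro convergent_cmult convergent_scale tail_convergent k r') (use s \<delta> in auto)
    have \<xi>_tail_mass: "mass (\<lambda>t. \<xi> (t + h)) = mass \<phi>"
      unfolding \<xi>_shift mass_cmult mass_scale[OF k(1)] using s(3) r' by (simp add: m_def)
    define \<phi>' where "\<phi>' t = (if t \<le> h then \<xi> t else \<phi> (t - h))" for t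
    have \<phi>': "convergent_density \<phi>'"
      unfolding \<phi>'_def by (rule convergent_splice[OF \<xi> \<xi>_tail \<phi> \<xi>_tail_mass[symmetric] h])
    have \<xi>_Icc: "set_integrable lborel {0..h} \<xi>"
      by (rule set_integrable_subset[OF convergent_integrable[OF \<xi>]]) auto
    have "mass \<xi> = r'" unfolding \<xi>_def mass_cmult mass_scale[OF k(1)] \<mu>0_mass by simp
    then have \<xi>_avg: "(LINT t:{0..h}|lborel. \<xi> t) = c * h"
      using set_integral_split_at[OF convergent_integrable[OF \<xi>] h0] \<xi>_tail_mass by (simp add: r'_def)
    \<comment> \<open>The height of the rescaled piece if \<open>\<mu>\<^sub>0\<close> were exactly
      \<open>q\<close> near \<open>0\<close>.\<close>
    define X where "X = r' * k * q"
    have X: "X > 0" using r' k q_pos by (simp add: X_def)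
    have \<xi>X: "\<bar>\<xi> t - X\<bar> \<le> e1 * X" if "t \<in> {0..h}" for t
    proof -
      have "k * t \<le> k * h" using that k by (intro mult_left_mono) auto
      then have "k * t \<in> {0..\<delta>}" using that k s by auto
      then have "\<bar>\<mu>\<^sub>0 (k * t) - q\<bar> \<le> e1 * q" by (rule \<delta>(3))
      then have "r' * k * \<bar>\<mu>\<^sub>0 (k * t) - q\<bar> \<le> r' * k * (e1 * q)"
        using r' k by (intro mult_left_mono) auto
      moreover have "r' * k * \<bar>\<mu>\<^sub>0 (k * t) - q\<bar> = \<bar>\<xi> t - X\<bar>"
      proof -
        have "\<xi> t - X = r' * k * (\<mu>\<^sub>0 (k * t) - q)"
          by (simp add: \<xi>_def X_def scale_density_def algebra_simps)
        then show ?thesis using r' k by (simp add: abs_mult)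
      qed
      ultimately show ?thesis by (simp add: X_def algebra_simps)
    qed
    have cX: "\<bar>c - X\<bar> \<le> e1 * X"
      by (rule set_integral_average_dist[OF \<xi>_Icc h \<xi>_avg \<xi>X])
    \<comment> \<open>Turns errors relative to the height \<open>X\<close> into errors relative to
      the given height \<open>c\<close>.\<close>
    have "e1 * X \<le> 1 / 2 * X" using e1 X by (intro mult_right_mono) auto
    then have "X \<le> 2 * c" using cX by linarith
    then have "2 * e1 * X \<le> 2 * e1 * (2 * c)" using e1 by (intro mult_left_mono) auto
    also have "\<dots> = 4 * e1 * c" by simp
    also have "\<dots> \<le> e * c" using e1 c by (intro mult_right_mono) auto
    finally have ec: "2 * e1 * X \<le> e * c" .
    have diff: "(\<lambda>t. \<bar>(if t \<le> h then \<gamma> t else \<psi> (t - h)) - \<phi>' t\<bar>)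
        = (\<lambda>t. if t \<le> h then \<bar>\<gamma> t - \<xi> t\<bar> else \<bar>\<psi> (t - h) - \<phi> (t - h)\<bar>)"
      by (auto simp: \<phi>'_def fun_eq_iff)
    have i1: "set_integrable lborel {0..h} (\<lambda>t. \<bar>\<gamma> t - \<xi> t\<bar>)"
      by (intro set_integrable_abs set_integral_diff \<gamma> \<xi>_Icc)
    have i2: "hl_integrable (\<lambda>t. \<bar>\<psi> t - \<phi> t\<bar>)"
      by (intro set_integrable_abs set_integral_diff \<psi> convergent_integrable[OF \<phi>])
    have "(LINT t:{0..h}|lborel. \<bar>\<gamma> t - \<xi> t\<bar>) \<le> (LINT t:{0..h}|lborel. d + e * c)"
    proof (rule set_integral_mono[OF i1 set_integral_const_Icc(1)[OF h0]])
      fix t assume t: "t \<in> {0..h}"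
      \<comment> \<open>Triangle inequality through \<open>c\<close> and \<open>X\<close>: first
        \<open>d\<close>, then \<open>e1 * X\<close> twice.\<close>
      show "\<bar>\<gamma> t - \<xi> t\<bar> \<le> d + e * c"
        using bspec[OF dev t] \<xi>X[OF t] cX ec by linarith
    qed
    then have "mass (\<lambda>t. \<bar>(if t \<le> h then \<gamma> t else \<psi> (t - h)) - \<phi>' t\<bar>)
        \<le> mass (\<lambda>t. \<bar>\<psi> t - \<phi> t\<bar>) + (d + e * c) * h"
      unfolding diff mass_splice[OF i1 i2 h0] set_integral_const_Icc(2)[OF h0] by simp
    moreover have "mass \<phi>' = mass \<phi> + c * h"
      unfolding \<phi>'_def mass_splice[OF \<xi>_Icc convergent_integrable[OF \<phi>] h0] \<xi>_avg by simp
    ultimately show "\<exists>\<phi>'. convergent_density \<phi>' \<and> mass \<phi>' = mass \<phi> + c * h \<and>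
       mass (\<lambda>t. \<bar>(if t \<le> h then \<gamma> t else \<psi> (t - h)) - \<phi>' t\<bar>) \<le> mass (\<lambda>t. \<bar>\<psi> t - \<phi> t\<bar>) + (d + e * c) * h"
      using \<phi>' by blast
  qed
qed

text \<open>Cut \<open>[0, K]\<close> into \<open>n\<close> equal blocks, on which uniform
  continuity makes \<open>\<gamma>\<close> nearly constant, and prepend their approximations to
  \<open>\<phi>\<^sub>0\<close> from right to left. Positivity of \<open>\<gamma>\<close> gives
  every block a positive mean height.\<close>

lemma convergent_continuous_splice:
  assumes \<gamma>: "continuous_on {0..K} \<gamma>" "\<And>t. t \<in> {0..K} \<Longrightarrow> \<gamma> t > 0" and K: "K > 0"
    and tail: "convergent_density \<phi>\<^sub>0" "mass \<phi>\<^sub>0 > 0"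
  shows "convergent_density (\<lambda>t. if t \<le> K then \<gamma> t else \<phi>\<^sub>0 (t - K))"
proof (rule convergent_L1_closed)
  have K0: "K \<ge> 0" using K by simp
  note tail_i = convergent_integrable[OF tail(1)]
  have \<gamma>i: "set_integrable lborel {0..K} \<gamma>" by (rule borel_integrable_atLeastAtMost'[OF \<gamma>(1)])
  show "hl_integrable (\<lambda>t. if t \<le> K then \<gamma> t else \<phi>\<^sub>0 (t - K))"
    by (rule hl_integrable_splice[OF \<gamma>i tail_i K0])
  show "0 \<le> (if t \<le> K then \<gamma> t else \<phi>\<^sub>0 (t - K))" if "t \<ge> 0" for t
    using that \<gamma>(2)[of t] convergent_nonneg[OF tail(1), of "t - K"] by auto
  fix e :: real assume e: "e > 0"
  obtain tM where tM: "tM \<in> {0..K}" "\<And>t. t \<in> {0..K} \<Longrightarrow> \<gamma> t \<le> \<gamma> tM"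
    using continuous_attains_sup[OF _ _ \<gamma>(1)] K by auto
  obtain tm where tm: "tm \<in> {0..K}" "\<And>t. t \<in> {0..K} \<Longrightarrow> \<gamma> tm \<le> \<gamma> t"
    using continuous_attains_inf[OF _ _ \<gamma>(1)] K by auto
  define M where "M = \<gamma> tM"
  have M: "M > 0" "\<And>t. t \<in> {0..K} \<Longrightarrow> \<gamma> t \<le> M" using tM \<gamma>(2) by (auto simp: M_def)
  \<comment> \<open>\<open>d\<close> and \<open>e1 * M\<close> both equal
    \<open>e / (2 * K)\<close>, so errors of \<open>(d + e1 * M) * h\<close> per block add up to
    \<open>e\<close>.\<close>
  define e1 where "e1 = e / (2 * K * M)"
  define d where "d = e / (2 * K)"
  have e1: "e1 > 0" and d: "d > 0" using e K M by (auto simp: e1_def d_def)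
  have total: "K * (d + e1 * M) = e" using K M by (simp add: e1_def d_def field_simps)
  let ?concl = "\<lambda>h \<gamma> \<psi> \<phi> c d. \<exists>\<phi>'. convergent_density \<phi>' \<and> mass \<phi>' = mass \<phi> + c * h \<and>
       mass (\<lambda>t. \<bar>(if t \<le> h then \<gamma> t else \<psi> (t - h)) - \<phi>' t\<bar>) \<le> mass (\<lambda>t. \<bar>\<psi> t - \<phi> t\<bar>) + (d + e1 * c) * h"
  obtain p where p: "p > 0"
    and block: "\<forall>h \<gamma> \<psi> \<phi> c d. h > 0 \<longrightarrow> c > 0 \<longrightarrow> set_integrable lborel {0..h} \<gamma> \<longrightarrow>
    (LINT t:{0..h}|lborel. \<gamma> t) = c * h \<longrightarrow> (\<forall>t\<in>{0..h}. \<bar>\<gamma> t - c\<bar> \<le> d) \<longrightarrow>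
    hl_integrable \<psi> \<longrightarrow> convergent_density \<phi> \<longrightarrow> mass \<phi> > 0 \<longrightarrow> c * h \<le> p * mass \<phi> \<longrightarrow> ?concl h \<gamma> \<psi> \<phi> c d"
    using block_approx[OF e1] by (elim exE conjE) (rule that)
  have "uniformly_continuous_on {0..K} \<gamma>"
    by (rule compact_uniformly_continuous[OF \<gamma>(1)]) simp
  then obtain \<delta> where \<delta>: "\<delta> > 0"
    "\<And>s t. s \<in> {0..K} \<Longrightarrow> t \<in> {0..K} \<Longrightarrow> \<bar>s - t\<bar> < \<delta> \<Longrightarrow> \<bar>\<gamma> s - \<gamma> t\<bar> < d"
    using d unfolding uniformly_continuous_on_def dist_real_def by (metis abs_minus_commute)
  \<comment> \<open>The first bound gives \<open>h < \<delta>\<close>, so \<open>\<gamma>\<close>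
    varies by less than \<open>d\<close> on a block. The second makes even a block of height
    \<open>M\<close> light enough against \<open>\<phi>\<^sub>0\<close> alone.\<close>
  obtain n :: nat where n: "real n > max (K / \<delta>) (M * K / (p * mass \<phi>\<^sub>0))" "n > 0"
  proof -
    obtain n :: nat where "real n > max 0 (max (K / \<delta>) (M * K / (p * mass \<phi>\<^sub>0)))"
      using reals_Archimedean2 by blast
    then show thesis using that[of n] by auto
  qed
  define h where "h = K / n"
  have h: "h > 0" "n * h = K" using K n by (auto simp: h_def)
  have h0: "h \<ge> 0" using h by simp
  have h\<delta>: "h < \<delta>" using n \<delta>(1) by (simp add: h_def field_simps)
  have "p * mass \<phi>\<^sub>0 > 0" using p tail by simp
  then have hp: "M * h \<le> p * mass \<phi>\<^sub>0" using n by (simp add: h_def field_simps)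
  \<comment> \<open>The target seen from the start of its last \<open>j\<close> blocks:
    \<open>\<phi>\<^sub>0\<close> for \<open>j = 0\<close>, up to the value at \<open>0\<close>, and
    the whole function for \<open>j = n\<close>.\<close>
  define F where "F j t = (if t \<le> real j * h then \<gamma> (t + real (n - j) * h) else \<phi>\<^sub>0 (t - real j * h))" for j t
  have "hl_integrable (F j) \<and> (\<exists>\<phi>. convergent_density \<phi> \<and> mass \<phi>\<^sub>0 \<le> mass \<phi> \<and>
      mass (\<lambda>t. \<bar>F j t - \<phi> t\<bar>) \<le> real j * h * (d + e1 * M))" if "j \<le> n" for j
    using that
  proof (induction j)
    case 0
    have "hl_integrable (F 0)"
      by (rule hl_integrable_cong_pos[OF tail_i]) (auto simp: F_def)
    moreover have "mass (\<lambda>t. \<bar>F 0 t - \<phi>\<^sub>0 t\<bar>) = mass (\<lambda>t. 0)"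
      by (rule mass_cong_pos) (auto simp: F_def)
    then have "mass (\<lambda>t. \<bar>F 0 t - \<phi>\<^sub>0 t\<bar>) = 0" by (simp add: set_lebesgue_integral_def)
    ultimately show ?case using tail(1) by (intro conjI exI[of _ \<phi>\<^sub>0]) auto
  next
    case (Suc j)
    then obtain \<phi> where Fi: "hl_integrable (F j)" and \<phi>: "convergent_density \<phi>" "mass \<phi>\<^sub>0 \<le> mass \<phi>"
      and le: "mass (\<lambda>t. \<bar>F j t - \<phi> t\<bar>) \<le> real j * h * (d + e1 * M)" by auto
    define i where "i = real (n - Suc j) * h"
    have ih: "real (n - j) * h = i + h"
      using Suc.prems by (simp add: i_def of_nat_diff algebra_simps)
    have i: "i \<ge> 0" using h by (simp add: i_def)
    have iKh: "i + h \<le> K"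
      unfolding ih[symmetric] h(2)[symmetric] using h0 by (intro mult_right_mono) auto
    then have iK: "t + i \<in> {0..K}" if "t \<in> {0..h}" for t using that i by auto
    let ?\<gamma> = "\<lambda>t. \<gamma> (t + i)"
    \<comment> \<open>The shape that \<open>block\<close> expects: one block in front of the
      previous stage.\<close>
    have F_Suc: "F (Suc j) t = (if t \<le> h then ?\<gamma> t else F j (t - h))" for t
    proof -
      have "t \<le> h \<Longrightarrow> t \<le> h + real j * h" using h0 by (simp add: add_increasing2)
      then show ?thesis
        unfolding F_def ih i_def[symmetric] by (auto simp: algebra_simps)
    qed
    have \<gamma>c: "continuous_on {0..h} ?\<gamma>"
      by (rule continuous_on_compose2[OF \<gamma>(1)]) (use i iKh in \<open>auto intro!: continuous_intros\<close>)
    have \<gamma>i: "set_integrable lborel {0..h} ?\<gamma>" by (rule borel_integrable_atLeastAtMost'[OF \<gamma>c])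
    define c where "c = (LINT t:{0..h}|lborel. ?\<gamma> t) / h"
    have c: "(LINT t:{0..h}|lborel. ?\<gamma> t) = c * h" using h by (simp add: c_def)
    have "(LINT t:{0..h}|lborel. ?\<gamma> t) \<le> (LINT t:{0..h}|lborel. M)"
      by (rule set_integral_mono[OF \<gamma>i set_integral_const_Icc(1)[OF h0] M(2)]) (rule iK)
    then have cM: "c \<le> M" using h by (simp add: c set_integral_const_Icc(2)[OF h0])
    have "(LINT t:{0..h}|lborel. \<gamma> tm) \<le> (LINT t:{0..h}|lborel. ?\<gamma> t)"
      by (rule set_integral_mono[OF set_integral_const_Icc(1)[OF h0] \<gamma>i tm(2)]) (rule iK)
    then have "\<gamma> tm \<le> c" using h by (simp add: c set_integral_const_Icc(2)[OF h0])
    then have cpos: "c > 0" using \<gamma>(2)[OF tm(1)] by simp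
    have dev: "\<forall>t\<in>{0..h}. \<bar>?\<gamma> t - c\<bar> \<le> d"
    proof
      fix t assume t: "t \<in> {0..h}"
      have "\<bar>c - ?\<gamma> t\<bar> \<le> d"
      proof (rule set_integral_average_dist[OF \<gamma>i h(1) c])
        fix s assume s: "s \<in> {0..h}"
        have "\<bar>\<gamma> (s + i) - \<gamma> (t + i)\<bar> < d"
          by (rule \<delta>(2)[OF iK[OF s] iK[OF t]]) (use s t h\<delta> in auto)
        then show "\<bar>?\<gamma> s - ?\<gamma> t\<bar> \<le> d" by simp
      qed
      then show "\<bar>?\<gamma> t - c\<bar> \<le> d" by (simp add: abs_minus_commute)
    qed
    \<comment> \<open>Prepending only adds mass, so the threshold that \<open>n\<close> meets for
      \<open>mass \<phi>\<^sub>0\<close> suffices at every stage.\<close>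
    have "c * h \<le> M * h" using cM h0 by (rule mult_right_mono)
    also note hp
    also have "p * mass \<phi>\<^sub>0 \<le> p * mass \<phi>" using \<phi>(2) p by simp
    finally have small: "c * h \<le> p * mass \<phi>" .
    have "mass \<phi> > 0" using \<phi>(2) tail(2) by simp
    from block[rule_format, OF h(1) cpos \<gamma>i c bspec[OF dev] Fi \<phi>(1) this small]
    obtain \<phi>' where \<phi>': "convergent_density \<phi>'" "mass \<phi>' = mass \<phi> + c * h"
      "mass (\<lambda>t. \<bar>F (Suc j) t - \<phi>' t\<bar>) \<le> mass (\<lambda>t. \<bar>F j t - \<phi> t\<bar>) + (d + e1 * c) * h"
      unfolding F_Suc by blast
    have "(d + e1 * c) * h \<le> (d + e1 * M) * h"
      using cM e1 h0 by (intro mult_right_mono add_left_mono mult_left_mono) auto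
    with \<phi>'(3) le have "mass (\<lambda>t. \<bar>F (Suc j) t - \<phi>' t\<bar>) \<le> real (Suc j) * h * (d + e1 * M)"
      by (simp add: algebra_simps)
    moreover have "0 \<le> c * h" using cpos h0 by simp
    then have "mass \<phi>\<^sub>0 \<le> mass \<phi>'" using \<phi>' \<phi>(2) by linarith
    moreover have "hl_integrable (F (Suc j))"
      unfolding F_Suc by (rule hl_integrable_splice[OF \<gamma>i Fi h0])
    ultimately show ?case using \<phi>'(1) by blast
  qed
  from this[of n] obtain \<phi> where "convergent_density \<phi>" "mass (\<lambda>t. \<bar>F n t - \<phi> t\<bar>) \<le> e"
    using total h by auto
  moreover have "F n = (\<lambda>t. if t \<le> K then \<gamma> t else \<phi>\<^sub>0 (t - K))"
    using h by (simp add: F_def fun_eq_iff)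
  ultimately show "\<exists>\<phi>. convergent_density \<phi> \<and> mass (\<lambda>t. \<bar>(if t \<le> K then \<gamma> t else \<phi>\<^sub>0 (t - K)) - \<phi> t\<bar>) \<le> e"
    by auto
qed

end

section \<open>\<open>L1\<close> approximation by positive continuous functions on a bounded
  interval\<close>

lemma hl_truncation_approx:
  assumes \<mu>: "hl_integrable \<mu>" "\<And>t. t \<ge> 0 \<Longrightarrow> 0 \<le> \<mu> t" and "e > 0"
  obtains K :: nat where "K > 0" "mass (\<lambda>t. \<bar>\<mu> t - (if t \<le> K then min (\<mu> t) K else 0)\<bar>) \<le> e"
    "hl_integrable (\<lambda>t. \<bar>\<mu> t - (if t \<le> K then min (\<mu> t) K else 0)\<bar>)"
proof -
  define \<nu> where "\<nu> t = indicator {0..} t *\<^sub>R \<mu> t" for t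
  have \<nu>: "integrable lborel \<nu>" using \<mu>(1) by (simp add: set_integrable_def \<nu>_def[abs_def])
  then have [measurable]: "\<nu> \<in> borel_measurable borel" using borel_measurable_integrable by force
  have \<nu>0: "0 \<le> \<nu> t" for t using \<mu>(2) by (simp add: \<nu>_def indicator_def)
  define s where "s n t = \<bar>\<nu> t - (if t \<le> real n then min (\<nu> t) (real n) else 0)\<bar>" for n t
  have s_eq: "s n t = indicator {0..} t *\<^sub>R \<bar>\<mu> t - (if t \<le> real n then min (\<mu> t) (real n) else 0)\<bar>" for n t
    by (auto simp: s_def \<nu>_def indicator_def)
  have meas: "s n \<in> borel_measurable lborel" for n
    unfolding s_def by measurable
  have dom: "norm (s n t) \<le> \<nu> t" for n t using \<nu>0[of t] by (auto simp: s_def)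
  have lim: "(\<lambda>n. s n t) \<longlonglongrightarrow> 0" for t
  proof (rule tendsto_eventually)
    obtain N :: nat where "max t (\<nu> t) \<le> real N" using real_arch_simple by blast
    then show "\<forall>\<^sub>F n in sequentially. s n t = 0"
      unfolding eventually_sequentially by (intro exI[of _ N]) (auto simp: s_def)
  qed
  \<comment> \<open>\<open>\<nu>\<close> itself dominates the truncation errors, and each vanishes
    once \<open>n\<close> is at least \<open>t\<close> and \<open>\<nu> t\<close>.\<close>
  have "(\<lambda>n. integral\<^sup>L lborel (s n)) \<longlonglongrightarrow> integral\<^sup>L lborel (\<lambda>_::real. 0::real)"
    by (intro integral_dominated_convergence[where w = \<nu>] meas \<nu> AE_I2 dom lim) simp
  then have "(\<lambda>n. integral\<^sup>L lborel (s n)) \<longlonglongrightarrow> 0" by simp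
  then have "\<forall>\<^sub>F n in sequentially. integral\<^sup>L lborel (s n) < e"
    using \<open>e > 0\<close> by (rule order_tendstoD(2))
  then have "\<forall>\<^sub>F n in sequentially. integral\<^sup>L lborel (s n) < e \<and> n > 0"
    using eventually_gt_at_top[of 0] by (rule eventually_conj)
  then obtain K where K: "integral\<^sup>L lborel (s K) < e" "K > 0"
    using eventually_happens[of _ sequentially] by auto
  have "integrable lborel (s K)"
    by (rule Bochner_Integration.integrable_bound[OF \<nu> meas])
       (intro AE_I2 order_trans[OF dom], simp)
  with K that[of K] show thesis
    by (simp add: set_lebesgue_integral_def set_integrable_def s_eq[abs_def])
qed

text \<open>A measurable function is an almost everywhere limit of continuous ones; after clamping,
  dominated convergence upgrades this to \<open>L1\<close> on \<open>[0, K]\<close>.\<close>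

lemma bounded_continuous_approx:
  fixes \<nu> :: "real \<Rightarrow> real"
  assumes \<nu>: "\<nu> \<in> borel_measurable borel" "\<And>t. 0 \<le> \<nu> t" "\<And>t. \<nu> t \<le> C" and "e > 0"
  obtains \<gamma> where "continuous_on UNIV \<gamma>" "\<forall>t. 0 \<le> \<gamma> t" "(LINT t:{0..K}|lborel. \<bar>\<nu> t - \<gamma> t\<bar>) \<le> e"
proof -
  note [measurable] = \<nu>(1)
  have "\<nu> \<in> borel_measurable lebesgue" by (simp add: measurable_completion)
  then have "\<nu> measurable_on UNIV" by (rule lebesgue_measurable_imp_measurable_on) simp
  then obtain N G where N: "negligible N" and G: "\<And>n. continuous_on UNIV (G n)"
    and lim: "\<And>x. x \<notin> N \<Longrightarrow> (\<lambda>n. G n x) \<longlonglongrightarrow> \<nu> x"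
    unfolding measurable_on_def by auto
  \<comment> \<open>The exceptional set is Lebesgue negligible; \<open>AE\<close> with respect to
    \<open>lborel\<close> needs a Borel null set around it.\<close>
  obtain N' where N': "N' \<in> null_sets lborel" "N \<subseteq> N'"
    using N unfolding negligible_iff_null_sets null_sets_completion_iff2 by blast
  \<comment> \<open>Clamping to \<open>[0, C]\<close> supplies nonnegativity and a dominating
    constant, and it leaves the limit \<open>\<nu>\<close> alone.\<close>
  define H where "H n x = max 0 (min C (G n x))" for n x
  have Hc: "continuous_on UNIV (H n)" for n
    unfolding H_def by (intro continuous_intros G)
  have Hm[measurable]: "H n \<in> borel_measurable borel" for n
    by (rule borel_measurable_continuous_onI[OF Hc])
  have C: "C \<ge> 0" using \<nu>(2,3)[of 0] by linarith
  define s where "s n x = indicator {0..K} x *\<^sub>R \<bar>\<nu> x - H n x\<bar>" for n x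
  have "(\<lambda>n. integral\<^sup>L lborel (s n)) \<longlonglongrightarrow> integral\<^sup>L lborel (\<lambda>_::real. 0::real)"
  proof (rule integral_dominated_convergence[where w = "\<lambda>x. indicator {0..K} x *\<^sub>R C"])
    show "integrable lborel (\<lambda>x. indicator {0..K} x *\<^sub>R C)"
      by (intro integrable_scaleR_left) (auto simp: integrable_indicator_iff emeasure_lborel_Icc_eq)
    show "s n \<in> borel_measurable lborel" for n unfolding s_def by measurable
    show "AE x in lborel. norm (s n x) \<le> indicator {0..K} x *\<^sub>R C" for n
    proof (rule AE_I2)
      fix x
      have "\<bar>\<nu> x - H n x\<bar> \<le> C" using \<nu>(2,3)[of x] C by (auto simp: H_def)
      then show "norm (s n x) \<le> indicator {0..K} x *\<^sub>R C" by (simp add: s_def indicator_def)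
    qed
    show "AE x in lborel. (\<lambda>n. s n x) \<longlonglongrightarrow> 0"
      using AE_not_in[OF N'(1)]
    proof eventually_elim
      case (elim x)
      then have "(\<lambda>n. G n x) \<longlonglongrightarrow> \<nu> x" using N'(2) by (intro lim) auto
      then have "(\<lambda>n. s n x) \<longlonglongrightarrow> indicator {0..K} x *\<^sub>R \<bar>\<nu> x - max 0 (min C (\<nu> x))\<bar>"
        unfolding s_def H_def by (intro tendsto_intros)
      then show ?case using \<nu>(2,3)[of x] by (simp add: min_absorb2 max_absorb2)
    qed
  qed simp
  then have "(\<lambda>n. integral\<^sup>L lborel (s n)) \<longlonglongrightarrow> 0" by simp
  then have "\<forall>\<^sub>F n in sequentially. integral\<^sup>L lborel (s n) < e"
    using \<open>e > 0\<close> by (rule order_tendstoD(2))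
  then obtain n where "integral\<^sup>L lborel (s n) < e"
    using eventually_happens[of _ sequentially] by auto
  then have "(LINT t:{0..K}|lborel. \<bar>\<nu> t - H n t\<bar>) \<le> e"
    by (simp add: set_lebesgue_integral_def s_def[abs_def])
  moreover have "\<forall>t. 0 \<le> H n t" by (simp add: H_def)
  ultimately show thesis using that Hc by blast
qed

lemma hl_positive_continuous_approx:
  assumes \<mu>: "hl_integrable \<mu>" "\<And>t. t \<ge> 0 \<Longrightarrow> 0 \<le> \<mu> t" and "e > 0"
  obtains K :: real and \<gamma> where "K > 0" "continuous_on UNIV \<gamma>" "\<forall>t. 0 < \<gamma> t"
    "mass (\<lambda>t. \<bar>\<mu> t - (if t \<le> K then \<gamma> t else 0)\<bar>) \<le> e"
proof -
  have e3: "e / 3 > 0" using \<open>e > 0\<close> by simp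
  obtain K :: nat where K: "K > 0"
    and trunc: "mass (\<lambda>t. \<bar>\<mu> t - (if t \<le> K then min (\<mu> t) K else 0)\<bar>) \<le> e / 3"
    and trunc_i: "hl_integrable (\<lambda>t. \<bar>\<mu> t - (if t \<le> K then min (\<mu> t) K else 0)\<bar>)"
    by (rule hl_truncation_approx[OF \<mu> e3])
  define \<nu> where "\<nu> t = min (indicator {0..} t *\<^sub>R \<mu> t) (real K)" for t
  have "(\<lambda>t. indicator {0..} t *\<^sub>R \<mu> t) \<in> borel_measurable borel"
    using \<mu>(1) borel_measurable_integrable unfolding set_integrable_def by force
  then have \<nu>: "\<nu> \<in> borel_measurable borel" "\<And>t. 0 \<le> \<nu> t" "\<And>t. \<nu> t \<le> real K"
    unfolding \<nu>_def using \<mu>(2) by (auto simp: indicator_def)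
  obtain \<gamma>0 where \<gamma>0: "continuous_on UNIV \<gamma>0" "\<forall>t. 0 \<le> \<gamma>0 t"
    "(LINT t:{0..real K}|lborel. \<bar>\<nu> t - \<gamma>0 t\<bar>) \<le> e / 3"
    by (rule bounded_continuous_approx[OF \<nu> e3])
  \<comment> \<open>The added constant makes the approximation strictly positive and costs
    \<open>K * (e / (3 * K)) = e / 3\<close>.\<close>
  define \<gamma> where "\<gamma> t = \<gamma>0 t + e / (3 * K)" for t
  have \<gamma>: "continuous_on UNIV \<gamma>" "\<forall>t. 0 < \<gamma> t"
    unfolding \<gamma>_def using \<gamma>0 K \<open>e > 0\<close> by (auto intro!: continuous_intros add_nonneg_pos)
  have K0: "real K \<ge> 0" by simp
  have \<nu>i: "set_integrable lborel {0..real K} \<nu>"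
    unfolding set_integrable_def
  proof (rule Bochner_Integration.integrable_bound)
    show "integrable lborel (\<lambda>x. indicator {0..real K} x *\<^sub>R real K)"
      using set_integral_const_Icc(1)[OF K0, of "real K"] by (simp add: set_integrable_def)
    show "(\<lambda>x. indicator {0..real K} x *\<^sub>R \<nu> x) \<in> borel_measurable lborel"
      using \<nu>(1) by simp
    show "AE x in lborel. norm (indicator {0..real K} x *\<^sub>R \<nu> x) \<le> norm (indicator {0..real K} x *\<^sub>R real K)"
      using \<nu>(2,3) by (auto simp: indicator_def)
  qed
  have \<gamma>0i: "set_integrable lborel {0..real K} \<gamma>0"
    by (rule borel_integrable_atLeastAtMost'[OF continuous_on_subset[OF \<gamma>0(1)]]) auto
  have \<gamma>i: "set_integrable lborel {0..real K} \<gamma>"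
    by (rule borel_integrable_atLeastAtMost'[OF continuous_on_subset[OF \<gamma>(1)]]) auto
  have i0: "set_integrable lborel {0..real K} (\<lambda>t. \<bar>\<nu> t - \<gamma>0 t\<bar>)"
    by (intro set_integrable_abs set_integral_diff \<nu>i \<gamma>0i)
  have i: "set_integrable lborel {0..real K} (\<lambda>t. \<bar>\<nu> t - \<gamma> t\<bar>)"
    by (intro set_integrable_abs set_integral_diff \<nu>i \<gamma>i)
  note ic = set_integral_const_Icc[OF K0, of "e / (3 * K)"]
  have "(LINT t:{0..real K}|lborel. \<bar>\<nu> t - \<gamma> t\<bar>)
      \<le> (LINT t:{0..real K}|lborel. \<bar>\<nu> t - \<gamma>0 t\<bar> + e / (3 * K))"
  proof (rule set_integral_mono[OF i set_integral_add(1)[OF i0 ic(1)]])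
    fix t
    have "0 \<le> e / (3 * K)" using \<open>e > 0\<close> by simp
    then show "\<bar>\<nu> t - \<gamma> t\<bar> \<le> \<bar>\<nu> t - \<gamma>0 t\<bar> + e / (3 * K)" unfolding \<gamma>_def by linarith
  qed
  also have "\<dots> = (LINT t:{0..real K}|lborel. \<bar>\<nu> t - \<gamma>0 t\<bar>) + e / (3 * K) * K"
    unfolding set_integral_add(2)[OF i0 ic(1)] ic(2) ..
  also have "\<dots> \<le> e / 3 + e / 3" using \<gamma>0(3) K by simp
  finally have \<nu>\<gamma>: "(LINT t:{0..real K}|lborel. \<bar>\<nu> t - \<gamma> t\<bar>) \<le> e / 3 + e / 3" .
  have z: "hl_integrable (\<lambda>_. 0)" by (simp add: set_integrable_def)
  let ?r = "\<lambda>t. if t \<le> real K then \<bar>\<nu> t - \<gamma> t\<bar> else 0"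
  have ri: "hl_integrable ?r" using hl_integrable_splice[OF i z K0] .
  have rm: "mass ?r \<le> e / 3 + e / 3"
    using mass_splice[OF i z K0] \<nu>\<gamma> by (simp add: set_lebesgue_integral_def)
  have "hl_integrable (\<lambda>t. \<bar>\<mu> t - (if t \<le> K then \<gamma> t else 0)\<bar>)"
    using hl_integrable_splice[OF \<gamma>i z K0] \<mu>(1) by (intro set_integrable_abs set_integral_diff)
  then have "mass (\<lambda>t. \<bar>\<mu> t - (if t \<le> K then \<gamma> t else 0)\<bar>)
      \<le> mass (\<lambda>t. \<bar>\<mu> t - (if t \<le> K then min (\<mu> t) K else 0)\<bar> + ?r t)"
    by (rule mass_mono[OF _ set_integral_add(1)[OF trunc_i ri]]) (auto simp: \<nu>_def)
  also have "\<dots> \<le> e"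
    unfolding set_integral_add(2)[OF trunc_i ri] using trunc rm by linarith
  finally show thesis using that[of "real K" \<gamma>] K \<gamma> by simp
qed

context self_similar_game
begin

theorem all_convergent:
  assumes \<mu>: "hl_integrable \<mu>" "\<And>t. t \<ge> 0 \<Longrightarrow> 0 \<le> \<mu> t"
  shows "convergent_density \<mu>"
proof (rule convergent_L1_closed[OF \<mu>])
  fix e :: real assume "e > 0"
  then have e2: "e / 2 > 0" by simp
  obtain K \<gamma> where K: "K > 0"
    and \<gamma>: "continuous_on UNIV \<gamma>" "\<forall>t. 0 < \<gamma> t"
    and near: "mass (\<lambda>t. \<bar>\<mu> t - (if t \<le> K then \<gamma> t else 0)\<bar>) \<le> e / 2"
    by (rule hl_positive_continuous_approx[OF \<mu> e2])
  have K0: "K \<ge> 0" using K by simp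
  \<comment> \<open>Blocks must be light relative to the mass behind them, so the zero continuation
    past \<open>K\<close> is replaced by a tail of mass \<open>e / 2\<close>; the other half of
    \<open>e\<close> pays for \<open>\<gamma>\<close>.\<close>
  let ?\<phi> = "\<lambda>t. e / 2 * \<mu>\<^sub>0 t"
  have \<phi>: "convergent_density ?\<phi>" by (rule convergent_cmult[OF \<mu>0_convergent e2])
  have \<phi>m: "mass ?\<phi> = e / 2" unfolding mass_cmult \<mu>0_mass by simp
  have "convergent_density (\<lambda>t. if t \<le> K then \<gamma> t else ?\<phi> (t - K))"
    using \<phi>m e2 \<gamma>(2) by (intro convergent_continuous_splice[OF continuous_on_subset[OF \<gamma>(1)] _ K \<phi>]) auto
  moreover have "mass (\<lambda>t. \<bar>\<mu> t - (if t \<le> K then \<gamma> t else ?\<phi> (t - K))\<bar>) \<le> e"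
  proof -
    have z: "set_integrable lborel {0..K} (\<lambda>_. 0)" "hl_integrable (\<lambda>_. 0)" by (simp_all add: set_integrable_def)
    have \<gamma>i: "set_integrable lborel {0..K} \<gamma>"
      by (rule borel_integrable_atLeastAtMost'[OF continuous_on_subset[OF \<gamma>(1)]]) auto
    let ?r = "\<lambda>t. if t \<le> K then 0 else ?\<phi> (t - K)"
    have ri: "hl_integrable ?r" by (rule hl_integrable_splice[OF z(1) convergent_integrable[OF \<phi>] K0])
    have rm: "mass ?r = e / 2"
      unfolding mass_splice[OF z(1) convergent_integrable[OF \<phi>] K0] \<phi>m by (simp add: set_lebesgue_integral_def)
    have i: "hl_integrable (\<lambda>t. \<bar>\<mu> t - (if t \<le> K then \<gamma> t else 0)\<bar>)"
      using hl_integrable_splice[OF \<gamma>i z(2) K0] \<mu>(1) by (intro set_integrable_abs set_integral_diff)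
    have "hl_integrable (\<lambda>t. \<bar>\<mu> t - (if t \<le> K then \<gamma> t else ?\<phi> (t - K))\<bar>)"
      using hl_integrable_splice[OF \<gamma>i convergent_integrable[OF \<phi>] K0] \<mu>(1) by (intro set_integrable_abs set_integral_diff)
    then have "mass (\<lambda>t. \<bar>\<mu> t - (if t \<le> K then \<gamma> t else ?\<phi> (t - K))\<bar>)
        \<le> mass (\<lambda>t. \<bar>\<mu> t - (if t \<le> K then \<gamma> t else 0)\<bar> + ?r t)"
    proof (rule mass_mono[OF _ set_integral_add(1)[OF i ri]])
      fix t :: real assume "t \<ge> 0"
      have "t > K \<Longrightarrow> 0 \<le> ?\<phi> (t - K)" by (rule convergent_nonneg[OF \<phi>]) simp
      then show "\<bar>\<mu> t - (if t \<le> K then \<gamma> t else ?\<phi> (t - K))\<bar>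
          \<le> \<bar>\<mu> t - (if t \<le> K then \<gamma> t else 0)\<bar> + ?r t" by (cases "t \<le> K") auto
    qed
    also have "\<dots> \<le> e"
      unfolding set_integral_add(2)[OF i ri] using near rm by linarith
    finally show ?thesis .
  qed
  ultimately show "\<exists>\<phi>. convergent_density \<phi> \<and> mass (\<lambda>t. \<bar>\<mu> t - \<phi> t\<bar>) \<le> e" by blast
qed

end

section \<open>The uniform, exponential and power densities\<close>

text \<open>Improper integrals come as Henstock-Kurzweil integrals. Nonnegativity makes them
  absolute, and continuity gives the Borel measurability that \<open>lborel\<close>
  requires.\<close>

lemma set_integrable_has_integral:
  fixes \<rho> :: "real \<Rightarrow> real"
  assumes "(\<rho> has_integral I) {c..}" "\<And>t. t \<ge> c \<Longrightarrow> 0 \<le> \<rho> t" "continuous_on {c..} \<rho>"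
  shows "set_integrable lborel {c..} \<rho>" "(LINT t:{c..}|lborel. \<rho> t) = I"
proof -
  have "\<rho> absolutely_integrable_on {c..}"
    using assms by (intro nonnegative_absolutely_integrable_1) auto
  moreover have "(\<lambda>t. indicator {c..} t *\<^sub>R \<rho> t) \<in> borel_measurable lborel"
    using borel_measurable_continuous_on_restrict[OF assms(3)]
    by (subst (asm) borel_measurable_restrict_space_iff) auto
  ultimately show i: "set_integrable lborel {c..} \<rho>"
    unfolding set_integrable_def by (simp add: integrable_completion)
  show "(LINT t:{c..}|lborel. \<rho> t) = I"
    using set_borel_integral_eq_integral(2)[OF i] assms(1) by (simp add: integral_unique)
qed

lemma prob_density_uniform: "prob_density (uniform_density 1)"
proof -
  have "(\<lambda>t::real. indicator {0..} t *\<^sub>R uniform_density 1 t) = (\<lambda>t. indicator {0..1} t *\<^sub>R 1)"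
    by (auto simp: uniform_density_def fun_eq_iff indicator_def)
  then have "hl_integrable (uniform_density 1)" "mass (uniform_density 1) = (LINT t:{0..1::real}|lborel. 1)"
    using set_integral_const_Icc(1)[of 1 1] by (simp_all add: set_integrable_def set_lebesgue_integral_def)
  then show ?thesis
    using set_integral_const_Icc(2)[of 1 1] by (simp add: prob_density_def uniform_density_def)
qed

lemma prob_density_exp: "prob_density (exp_density 1)"
proof -
  have eq: "exp_density 1 = (\<lambda>t. exp (- 1 * t))" by (simp add: exp_density_def fun_eq_iff)
  have "(exp_density 1 has_integral exp (- 1 * 0) / 1) {0..}"
    unfolding eq by (rule has_integral_exp_minus_to_infinity) simp
  moreover have "continuous_on {0..} (exp_density 1)"
    unfolding eq by (intro continuous_intros)
  moreover have "0 \<le> exp_density 1 t" for t by (simp add: eq)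
  ultimately show ?thesis
    using set_integrable_has_integral[of "exp_density 1" 1 0] by (simp add: prob_density_def)
qed

text \<open>Keeps a statement about every power density from being vacuous, so that (q) implies
  (p).\<close>

lemma ex_power_density: "\<exists>\<rho>. power_density \<rho>"
proof -
  let ?\<rho> = "\<lambda>t::real. (1 + 1 * t) powr (- 2)"
  have "((\<lambda>x. x powr (- 2)) has_integral - (1 powr (- 2 + 1)) / (- 2 + 1)) {1::real..}"
    by (rule has_integral_powr_to_inf) auto
  then have 1: "((\<lambda>x::real. x powr (- 2)) has_integral 1) {1..}" by simp
  have c: "continuous_on {1..} (\<lambda>x::real. x powr (- 2))"
    by (intro continuous_intros) auto
  note i = set_integrable_has_integral[OF 1 powr_ge_zero c]
  have eq: "?\<rho> = (\<lambda>t. (t + 1) powr (- 2))" by (simp add: fun_eq_iff add.commute)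
  have "hl_integrable ?\<rho>" unfolding eq hl_integrable_shift_iff[of "\<lambda>x. x powr (- 2)" 1] by (rule i)
  moreover have "mass ?\<rho> = 1" unfolding eq mass_shift[of "\<lambda>x. x powr (- 2)" 1] by (rule i)
  ultimately have "prob_density ?\<rho>" by (simp add: prob_density_def)
  then have "power_density ?\<rho>"
    unfolding power_density_def by (intro conjI exI[of _ 1] exI[of _ 2]) auto
  then show ?thesis by blast
qed

text \<open>With \<open>\<kappa> = \<alpha> / (\<alpha> + \<beta> * s)\<close> one has
  \<open>\<alpha> + \<beta> * (t + s) = inverse \<kappa> * (\<alpha> + \<beta> * (\<kappa> *
  t))\<close>, and powers are multiplicative.\<close>

lemma power_shift_eq:
  fixes \<alpha> \<beta> \<gamma> s t :: real
  assumes "\<alpha> > 0" "\<beta> > 0" "s \<ge> 0" "t \<ge> 0"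
    and \<rho>: "\<And>t. t \<ge> 0 \<Longrightarrow> \<rho> t = (\<alpha> + \<beta> * t) powr (- \<gamma>)"
  shows "\<rho> (t + s) = (inverse (\<alpha> / (\<alpha> + \<beta> * s))) powr (- \<gamma>) * \<rho> (\<alpha> / (\<alpha> + \<beta> * s) * t)"
proof -
  define \<kappa> where "\<kappa> = \<alpha> / (\<alpha> + \<beta> * s)"
  have p: "\<alpha> + \<beta> * s > 0" using assms by (intro add_pos_nonneg) auto
  then have \<kappa>: "\<kappa> > 0" using \<open>\<alpha> > 0\<close> by (simp add: \<kappa>_def)
  have "inverse (\<alpha> / D) * (\<alpha> + \<beta> * (\<alpha> / D * t)) = D + \<beta> * t" if "D > 0" for D
    using \<open>\<alpha> > 0\<close> that by (simp add: field_simps)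
  from this[OF p] have "\<alpha> + \<beta> * (t + s) = inverse \<kappa> * (\<alpha> + \<beta> * (\<kappa> * t))"
    by (simp add: distrib_left \<kappa>_def)
  then have "(\<alpha> + \<beta> * (t + s)) powr (- \<gamma>) = inverse \<kappa> powr (- \<gamma>) * (\<alpha> + \<beta> * (\<kappa> * t)) powr (- \<gamma>)"
    using assms \<kappa> by (simp only: powr_mult)
  then show ?thesis
    using assms \<kappa> by (simp add: \<rho> \<kappa>_def[symmetric])
qed

text \<open>The tail is \<open>c / \<kappa>\<close> times a rescaling, and its mass is the same
  \<open>c / \<kappa>\<close>, so normalising removes the factor.\<close>

lemma shift_density_power:
  assumes "\<alpha> > 0" "\<beta> > 0" "T \<ge> 0" "t \<ge> 0" "prob_density \<rho>"
    and \<rho>: "\<And>t. t \<ge> 0 \<Longrightarrow> \<rho> t = (\<alpha> + \<beta> * t) powr (- \<gamma>)"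
  shows "shift_density \<rho> T t = scale_density \<rho> (\<alpha> / (\<alpha> + \<beta> * T)) t"
proof -
  define \<kappa> where "\<kappa> = \<alpha> / (\<alpha> + \<beta> * T)"
  have p: "\<alpha> + \<beta> * T > 0" using assms by (intro add_pos_nonneg) auto
  have \<kappa>: "\<kappa> > 0" using assms p by (simp add: \<kappa>_def)
  define c where "c = inverse \<kappa> powr (- \<gamma>)"
  have c: "c > 0" using \<kappa> by (simp add: c_def)
  have eq: "\<rho> (t + T) = c / \<kappa> * scale_density \<rho> \<kappa> t" if "t \<ge> 0" for t
    using power_shift_eq[OF assms(1-3) that \<rho>] \<kappa> by (simp add: c_def \<kappa>_def scale_density_def)
  have "(LINT s:{T..}|lborel. \<rho> s) = mass (\<lambda>t. \<rho> (t + T))" by (simp add: mass_shift)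
  also have "\<dots> = mass (\<lambda>t. c / \<kappa> * scale_density \<rho> \<kappa> t)"
    by (rule mass_cong_pos) (simp add: eq)
  also have "\<dots> = c / \<kappa>"
    unfolding mass_cmult mass_scale[OF \<kappa>] using assms(5) by (simp add: prob_density_def)
  finally show ?thesis
    using eq[OF \<open>t \<ge> 0\<close>] c \<kappa> by (simp add: shift_density_def \<kappa>_def[symmetric])
qed

lemma continuous_near_0:
  fixes \<rho> :: "real \<Rightarrow> real"
  assumes c: "continuous_on {0..} \<rho>" and "\<rho> 0 > 0" "e > 0"
  shows "\<exists>\<delta>>0. \<forall>u\<in>{0..\<delta>}. \<bar>\<rho> u - \<rho> 0\<bar> \<le> e * \<rho> 0"
proof -
  have "e * \<rho> 0 > 0" using assms by simp
  with c obtain d where d: "d > 0" "\<And>u. u \<ge> 0 \<Longrightarrow> \<bar>u - 0\<bar> < d \<Longrightarrow> \<bar>\<rho> u - \<rho> 0\<bar> < e * \<rho> 0"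
    unfolding continuous_on_iff dist_real_def by (metis atLeast_iff order_refl)
  show ?thesis
  proof (intro exI[of _ "d / 2"] conjI ballI)
    fix u assume "u \<in> {0..d / 2}"
    then show "\<bar>\<rho> u - \<rho> 0\<bar> \<le> e * \<rho> 0" using d(1) d(2)[of u] by auto
  qed (use d in simp)
qed

section \<open>Uniform convergence\<close>

text \<open>A real \<open>SUP\<close> over an unbounded set is a default value that says nothing
  about the members; boundedness lets a small supremum control each of them.\<close>

lemma unif_conv_iff:
  assumes "\<Omega> \<noteq> {}" and bdd: "\<forall>\<^sub>F s in F. bdd_above ((\<lambda>\<omega>. \<bar>V s \<omega> - U \<omega>\<bar>) ` \<Omega>)"
  shows "unif_conv \<Omega> V U F \<longleftrightarrow> (\<forall>e>0. \<forall>\<^sub>F s in F. \<forall>\<omega>\<in>\<Omega>. \<bar>V s \<omega> - U \<omega>\<bar> \<le> e)"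
proof
  assume conv: "unif_conv \<Omega> V U F"
  show "\<forall>e>0. \<forall>\<^sub>F s in F. \<forall>\<omega>\<in>\<Omega>. \<bar>V s \<omega> - U \<omega>\<bar> \<le> e"
  proof (intro allI impI)
    fix e :: real assume "e > 0"
    with conv have "\<forall>\<^sub>F s in F. (SUP \<omega>\<in>\<Omega>. \<bar>V s \<omega> - U \<omega>\<bar>) < e"
      unfolding unif_conv_def by (rule order_tendstoD(2))
    with bdd show "\<forall>\<^sub>F s in F. \<forall>\<omega>\<in>\<Omega>. \<bar>V s \<omega> - U \<omega>\<bar> \<le> e"
    proof eventually_elim
      case (elim s)
      then show ?case using cSUP_upper[OF _ elim(1)] by force
    qed
  qed
next
  assume *: "\<forall>e>0. \<forall>\<^sub>F s in F. \<forall>\<omega>\<in>\<Omega>. \<bar>V s \<omega> - U \<omega>\<bar> \<le> e"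
  obtain \<omega>0 where \<omega>0: "\<omega>0 \<in> \<Omega>" using assms(1) by blast
  show "unif_conv \<Omega> V U F"
    unfolding unif_conv_def
  proof (rule tendstoI)
    fix e :: real assume "e > 0"
    then have "\<forall>\<^sub>F s in F. \<forall>\<omega>\<in>\<Omega>. \<bar>V s \<omega> - U \<omega>\<bar> \<le> e / 2" using *[rule_format, of "e / 2"] by simp
    with bdd show "\<forall>\<^sub>F s in F. dist (SUP \<omega>\<in>\<Omega>. \<bar>V s \<omega> - U \<omega>\<bar>) 0 < e"
    proof eventually_elim
      case (elim s)
      have "(SUP \<omega>\<in>\<Omega>. \<bar>V s \<omega> - U \<omega>\<bar>) \<le> e / 2"
        by (rule cSUP_least) (use elim \<omega>0 in auto)
      moreover have "0 \<le> (SUP \<omega>\<in>\<Omega>. \<bar>V s \<omega> - U \<omega>\<bar>)"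
        by (rule cSUP_upper2[OF elim(1) \<omega>0]) simp
      ultimately show ?case using \<open>e > 0\<close> by simp
    qed
  qed
qed

text \<open>\<open>Sup\<close> on the reals is the \<open>LEAST\<close> upper bound; without upper
  bounds the predicate under \<open>LEAST\<close> is constantly false, whatever \<open>S\<close>
  is.\<close>

lemma Sup_real_unbounded: "\<not> bdd_above S \<Longrightarrow> Sup S = (LEAST z::real. False)"
  unfolding Sup_real_def bdd_above_def by (rule arg_cong[where f = Least]) (auto simp: fun_eq_iff)

lemma unif_conv_cong:
  assumes "\<forall>\<^sub>F s in F. \<forall>\<omega>. V s \<omega> = V' s \<omega>"
  shows "unif_conv \<Omega> V U F \<longleftrightarrow> unif_conv \<Omega> V' U F"
  unfolding unif_conv_def
  by (rule tendsto_cong) (use assms in \<open>auto elim!: eventually_mono\<close>)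

section \<open>The limits of the theorem as limits of rescalings\<close>

context differential_game
begin

lemma uniform_conv_iff:
  "unif_conv \<Omega> (\<lambda>T. V (uniform_density T)) U at_top
   \<longleftrightarrow> unif_conv \<Omega> (\<lambda>l. V (scale_density (uniform_density 1) l)) U (at_right 0)"
proof -
  have eq: "uniform_density T = scale_density (uniform_density 1) (inverse T)" if "T > 0" for T
    using that by (auto simp: uniform_density_def scale_density_def fun_eq_iff indicator_def field_simps)
  have "unif_conv \<Omega> (\<lambda>T. V (uniform_density T)) U at_top
      \<longleftrightarrow> unif_conv \<Omega> (\<lambda>T. V (scale_density (uniform_density 1) (inverse T))) U at_top"
  proof (rule unif_conv_cong)
    show "\<forall>\<^sub>F T in at_top. \<forall>\<omega>. V (uniform_density T) \<omega> = V (scale_density (uniform_density 1) (inverse T)) \<omega>"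
      using eventually_gt_at_top[of 0] by eventually_elim (simp only: eq[symmetric] simp_thms)
  qed
  \<comment> \<open>Substituting \<open>l = inverse T\<close> turns the limit at infinity into one
    at \<open>0\<close> from the right.\<close>
  then show ?thesis
    unfolding unif_conv_def filterlim_at_right_to_top .
qed

lemma exp_conv_iff:
  "unif_conv \<Omega> (\<lambda>l. V (exp_density l)) U (at_right 0)
   \<longleftrightarrow> unif_conv \<Omega> (\<lambda>l. V (scale_density (exp_density 1) l)) U (at_right 0)"
proof -
  have eq: "exp_density l = scale_density (exp_density 1) l" for l
    by (auto simp: exp_density_def scale_density_def fun_eq_iff)
  have "(\<lambda>l. V (exp_density l)) = (\<lambda>l. V (scale_density (exp_density 1) l))"
    by (rule ext, rule arg_cong[where f = V], rule eq)
  then show ?thesis by (rule arg_cong)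
qed

lemma shift_conv_iff:
  assumes "power_density \<rho>"
  shows "unif_conv \<Omega> (\<lambda>T. V (shift_density \<rho> T)) U at_top
   \<longleftrightarrow> unif_conv \<Omega> (\<lambda>l. V (scale_density \<rho> l)) U (at_right 0)"
proof -
  from assms obtain \<alpha> \<beta> \<gamma> where \<alpha>: "\<alpha> > 0" and \<beta>: "\<beta> > 0" and pd: "prob_density \<rho>"
    and \<rho>: "\<And>t. t \<ge> 0 \<Longrightarrow> \<rho> t = (\<alpha> + \<beta> * t) powr (- \<gamma>)"
    unfolding power_density_def by blast
  have eq: "V (shift_density \<rho> T) \<omega> = V (scale_density \<rho> (\<alpha> / (\<alpha> + \<beta> * T))) \<omega>" if "T \<ge> 0" for T \<omega>
    by (rule V_cong_pos) (rule shift_density_power[OF \<alpha> \<beta> that _ pd \<rho>], auto)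
  have 1: "unif_conv \<Omega> (\<lambda>T. V (shift_density \<rho> T)) U at_top
      \<longleftrightarrow> unif_conv \<Omega> (\<lambda>T. V (scale_density \<rho> (\<alpha> / (\<alpha> + \<beta> * T)))) U at_top"
  proof (rule unif_conv_cong)
    show "\<forall>\<^sub>F T in at_top. \<forall>\<omega>. V (shift_density \<rho> T) \<omega> = V (scale_density \<rho> (\<alpha> / (\<alpha> + \<beta> * T))) \<omega>"
      using eventually_ge_at_top[of 0] by eventually_elim (simp add: eq)
  qed
  define G where "G l = (SUP \<omega>\<in>\<Omega>. \<bar>V (scale_density \<rho> l) \<omega> - U \<omega>\<bar>)" for l
  have "((\<lambda>T. G (\<alpha> / (\<alpha> + \<beta> * T))) \<longlongrightarrow> 0) at_top \<longleftrightarrow> (G \<longlongrightarrow> 0) (at_right 0)"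
  proof
    assume "(G \<longlongrightarrow> 0) (at_right 0)"
    moreover have "filterlim (\<lambda>T. \<alpha> / (\<alpha> + \<beta> * T)) (at_right 0) at_top"
      using \<alpha> \<beta> by real_asymp
    ultimately show "((\<lambda>T. G (\<alpha> / (\<alpha> + \<beta> * T))) \<longlongrightarrow> 0) at_top"
      by (rule filterlim_compose)
  next
    assume lim: "((\<lambda>T. G (\<alpha> / (\<alpha> + \<beta> * T))) \<longlongrightarrow> 0) at_top"
    \<comment> \<open>The inverse of the change of variable
      \<open>l = \<alpha> / (\<alpha> + \<beta> * T)\<close>.\<close>
    have "filterlim (\<lambda>l. (\<alpha> / l - \<alpha>) / \<beta>) at_top (at_right 0)"
      using \<alpha> \<beta> by real_asymp
    from filterlim_compose[OF lim this]
    have "((\<lambda>l. G (\<alpha> / (\<alpha> + \<beta> * ((\<alpha> / l - \<alpha>) / \<beta>)))) \<longlongrightarrow> 0) (at_right 0)" .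
    \<comment> \<open>True even at \<open>l = 0\<close>, where both divisions by zero give
      \<open>0\<close>.\<close>
    moreover have "\<alpha> / (\<alpha> + \<beta> * ((\<alpha> / l - \<alpha>) / \<beta>)) = l" for l
    proof -
      have "\<alpha> + \<beta> * ((\<alpha> / l - \<alpha>) / \<beta>) = \<alpha> / l" using \<beta> by simp
      then show ?thesis using \<alpha> by simp
    qed
    ultimately show "(G \<longlongrightarrow> 0) (at_right 0)" by simp
  qed
  then show ?thesis unfolding 1 by (simp add: unif_conv_def G_def[abs_def])
qed

lemma V_prob_density:
  assumes "prob_density \<mu>" "l > 0"
  shows "V (scale_density \<mu> l) x \<in> {0..1}"
proof -
  have \<mu>: "hl_integrable \<mu>" "\<And>t. t \<ge> 0 \<Longrightarrow> \<mu> t \<ge> 0" "mass \<mu> = 1"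
    using assms(1) by (auto simp: prob_density_def)
  note i = hl_integrable_scale[OF \<mu>(1) \<open>l > 0\<close>]
  have nn: "scale_density \<mu> l t \<ge> 0" if "t \<ge> 0" for t
    using that \<mu>(2)[of "l * t"] \<open>l > 0\<close> by (simp add: scale_density_def)
  have "mass (\<lambda>t. \<bar>scale_density \<mu> l t\<bar>) = mass (scale_density \<mu> l)"
    by (rule mass_cong_pos) (simp add: nn)
  then show ?thesis
    using V_abs_le[OF i, of x] V_nonneg[OF i nn, of x] mass_scale[OF \<open>l > 0\<close>, of \<mu>] \<mu>(3) by auto
qed

text \<open>The supremum of an unbounded set of reals is a junk value that does not depend on the set. So
  if \<open>W\<close> is unbounded on \<open>\<Omega>\<close>, then \<open>unif_conv\<close> to \<open>W\<close> holds for every density as soon as it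
  holds for one.\<close>

lemma unif_conv_degenerate_limit:
  assumes \<Omega>: "\<Omega> \<noteq> {}" and pd: "prob_density \<mu>" and pd': "prob_density \<mu>'"
    and conv: "unif_conv \<Omega> (\<lambda>l. V (scale_density \<mu> l)) W (at_right 0)"
    and W: "\<not> (\<forall>\<omega>\<in>\<Omega>. W \<omega> \<in> {0..1})"
  shows "unif_conv \<Omega> (\<lambda>l. V (scale_density \<mu>' l)) W (at_right 0)"
proof -
  have pos: "\<forall>\<^sub>F l in at_right (0::real). l > 0" by (simp add: eventually_at_right_less)
  \<comment> \<open>For bounded \<open>W\<close> the suprema are genuine, so \<open>W\<close> would
    be a uniform limit of functions with values in \<open>[0, 1]\<close>, against the assumption on
    \<open>W\<close>.\<close>
  have nbdd: "\<not> bdd_above ((\<lambda>\<omega>. \<bar>W \<omega>\<bar>) ` \<Omega>)"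
  proof
    assume "bdd_above ((\<lambda>\<omega>. \<bar>W \<omega>\<bar>) ` \<Omega>)"
    then obtain M where M: "\<And>\<omega>. \<omega> \<in> \<Omega> \<Longrightarrow> \<bar>W \<omega>\<bar> \<le> M" by (auto simp: bdd_above_def)
    have "\<forall>\<^sub>F l in at_right 0. bdd_above ((\<lambda>\<omega>. \<bar>V (scale_density \<mu> l) \<omega> - W \<omega>\<bar>) ` \<Omega>)"
      using pos
    proof eventually_elim
      case (elim l)
      show ?case
      proof (rule bdd_aboveI2[of _ _ "1 + M"])
        fix \<omega> assume "\<omega> \<in> \<Omega>"
        from M[OF this] V_prob_density[OF pd elim, of \<omega>]
        show "\<bar>V (scale_density \<mu> l) \<omega> - W \<omega>\<bar> \<le> 1 + M" by auto
      qed
    qed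
    from unif_conv_iff[OF \<Omega> this] conv
    have near: "\<forall>\<^sub>F l in at_right 0. \<forall>\<omega>\<in>\<Omega>. \<bar>V (scale_density \<mu> l) \<omega> - W \<omega>\<bar> \<le> e" if "e > 0" for e
      using that by simp
    have "W \<omega> \<le> 1 + e \<and> 0 \<le> W \<omega> + e" if "\<omega> \<in> \<Omega>" "e > 0" for \<omega> e
    proof -
      from eventually_conj[OF near[OF \<open>e > 0\<close>] pos]
      obtain l where l: "l > 0" "\<forall>\<omega>\<in>\<Omega>. \<bar>V (scale_density \<mu> l) \<omega> - W \<omega>\<bar> \<le> e"
        using eventually_happens'[OF trivial_limit_at_right_real] by blast
      from bspec[OF l(2) \<open>\<omega> \<in> \<Omega>\<close>] V_prob_density[OF pd l(1), of \<omega>] show ?thesis by auto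
    qed
    then have "W \<omega> \<le> 1" "0 \<le> W \<omega>" if "\<omega> \<in> \<Omega>" for \<omega>
      using that by (auto intro: field_le_epsilon)
    with W show False by auto
  qed
  \<comment> \<open>Values of the game stay in \<open>[0, 1]\<close>, so they cannot compensate the
    unbounded \<open>W\<close>: the same default supremum occurs for every density.\<close>
  have sup: "(SUP \<omega>\<in>\<Omega>. \<bar>V (scale_density \<nu> l) \<omega> - W \<omega>\<bar>) = (LEAST z. False)"
    if "prob_density \<nu>" "l > 0" for \<nu> l
  proof (rule Sup_real_unbounded, rule notI)
    assume "bdd_above ((\<lambda>\<omega>. \<bar>V (scale_density \<nu> l) \<omega> - W \<omega>\<bar>) ` \<Omega>)"
    then obtain M where M: "\<And>\<omega>. \<omega> \<in> \<Omega> \<Longrightarrow> \<bar>V (scale_density \<nu> l) \<omega> - W \<omega>\<bar> \<le> M"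
      by (auto simp: bdd_above_def)
    have "bdd_above ((\<lambda>\<omega>. \<bar>W \<omega>\<bar>) ` \<Omega>)"
    proof (rule bdd_aboveI2[of _ _ "1 + M"])
      fix \<omega> assume "\<omega> \<in> \<Omega>"
      from M[OF this] V_prob_density[OF that, of \<omega>] show "\<bar>W \<omega>\<bar> \<le> 1 + M" by auto
    qed
    with nbdd show False ..
  qed
  have "\<forall>\<^sub>F l in at_right 0. (SUP \<omega>\<in>\<Omega>. \<bar>V (scale_density \<mu> l) \<omega> - W \<omega>\<bar>)
      = (SUP \<omega>\<in>\<Omega>. \<bar>V (scale_density \<mu>' l) \<omega> - W \<omega>\<bar>)"
    using pos by eventually_elim (simp add: sup pd pd')
  from tendsto_cong[OF this] conv show ?thesis by (simp add: unif_conv_def)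
qed

end

context invariant_game
begin

text \<open>\<open>V\<close> and \<open>U\<close> take values in \<open>[0, 1]\<close>, so the
  supremum is genuine; mass \<open>1\<close> turns \<open>mass \<mu> * U\<close> into
  \<open>U\<close>.\<close>

lemma convergent_iff_unif_conv:
  assumes \<Omega>: "\<Omega> \<noteq> {}" and pd: "prob_density \<mu>"
  shows "convergent_density \<mu> \<longleftrightarrow> unif_conv \<Omega> (\<lambda>l. V (scale_density \<mu> l)) U (at_right 0)"
proof -
  have pos: "\<forall>\<^sub>F l in at_right (0::real). l > 0" by (simp add: eventually_at_right_less)
  then have bdd: "\<forall>\<^sub>F l in at_right 0. bdd_above ((\<lambda>\<omega>. \<bar>V (scale_density \<mu> l) \<omega> - U \<omega>\<bar>) ` \<Omega>)"
  proof eventually_elim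
    case (elim l)
    show ?case
    proof (rule bdd_aboveI2[of _ _ 1])
      fix \<omega> assume "\<omega> \<in> \<Omega>"
      from U_range[OF this] V_prob_density[OF pd elim, of \<omega>]
      show "\<bar>V (scale_density \<mu> l) \<omega> - U \<omega>\<bar> \<le> 1" by auto
    qed
  qed
  show ?thesis
    using pd unfolding unif_conv_iff[OF \<Omega> bdd] convergent_density_def prob_density_def eventually_at_right_field
    by auto
qed

lemma unif_conv_all_densities:
  assumes \<Omega>: "\<Omega> \<noteq> {}" and pd0: "prob_density \<mu>\<^sub>0"
    and conv: "unif_conv \<Omega> (\<lambda>l. V (scale_density \<mu>\<^sub>0 l)) U (at_right 0)"
    and ss: "s\<^sub>1 > 0" "\<And>s. s \<in> {0..s\<^sub>1} \<Longrightarrow> \<exists>c>0. \<exists>\<kappa>>0. \<forall>t\<ge>0. \<mu>\<^sub>0 (t + s) = c * \<mu>\<^sub>0 (\<kappa> * t)"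
    and at_0: "\<mu>\<^sub>0 0 > 0" "\<And>e. e > 0 \<Longrightarrow> \<exists>\<delta>>0. \<forall>u\<in>{0..\<delta>}. \<bar>\<mu>\<^sub>0 u - \<mu>\<^sub>0 0\<bar> \<le> e * \<mu>\<^sub>0 0"
    and pd: "prob_density \<mu>"
  shows "unif_conv \<Omega> (\<lambda>l. V (scale_density \<mu> l)) U (at_right 0)"
proof -
  interpret self_similar_game A B f g L \<Omega> U \<mu>\<^sub>0 s\<^sub>1 "\<mu>\<^sub>0 0"
  proof
    show "convergent_density \<mu>\<^sub>0" using convergent_iff_unif_conv[OF \<Omega> pd0] conv by simp
    show "mass \<mu>\<^sub>0 = 1" using pd0 by (simp add: prob_density_def)
  qed (fact ss at_0)+
  have "convergent_density \<mu>" by (rule all_convergent) (use pd in \<open>auto simp: prob_density_def\<close>)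
  then show ?thesis using convergent_iff_unif_conv[OF \<Omega> pd] by simp
qed

lemma uniform_conv_imp_all:
  assumes \<Omega>: "\<Omega> \<noteq> {}" and conv: "unif_conv \<Omega> (\<lambda>T. V (uniform_density T)) U at_top"
    and "prob_density \<mu>"
  shows "unif_conv \<Omega> (\<lambda>l. V (scale_density \<mu> l)) U (at_right 0)"
proof (rule unif_conv_all_densities[OF \<Omega> prob_density_uniform conv[unfolded uniform_conv_iff]])
  show "(1 / 2 :: real) > 0" by simp
  fix s :: real assume s: "s \<in> {0..1 / 2}"
  \<comment> \<open>The tail of the indicator of \<open>[0, 1]\<close> is that of
    \<open>[0, 1 - s]\<close>, a compression by \<open>1 - s\<close>; the range
    \<open>s \<le> 1 / 2\<close> keeps this away from \<open>0\<close>.\<close>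
  have "uniform_density 1 (t + s) = 1 * uniform_density 1 (1 / (1 - s) * t)" if "t \<ge> 0" for t
    using that s by (auto simp: uniform_density_def indicator_def field_simps)
  moreover have "1 / (1 - s) > 0" using s by simp
  ultimately show "\<exists>c>0. \<exists>\<kappa>>0. \<forall>t\<ge>0. uniform_density 1 (t + s) = c * uniform_density 1 (\<kappa> * t)"
    using zero_less_one by blast
next
  show "uniform_density 1 0 > 0" by (simp add: uniform_density_def)
  fix e :: real assume "e > 0"
  then show "\<exists>\<delta>>0. \<forall>u\<in>{0..\<delta>}. \<bar>uniform_density 1 u - uniform_density 1 0\<bar> \<le> e * uniform_density 1 0"
    by (intro exI[of _ 1]) (auto simp: uniform_density_def)
qed fact

lemma exp_conv_imp_all:
  assumes \<Omega>: "\<Omega> \<noteq> {}" and conv: "unif_conv \<Omega> (\<lambda>l. V (exp_density l)) U (at_right 0)"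
    and "prob_density \<mu>"
  shows "unif_conv \<Omega> (\<lambda>l. V (scale_density \<mu> l)) U (at_right 0)"
proof (rule unif_conv_all_densities[OF \<Omega> prob_density_exp conv[unfolded exp_conv_iff]])
  show "(1 :: real) > 0" by simp
  fix s :: real assume s: "s \<in> {0..1}"
  \<comment> \<open>Memorylessness: the tail is a multiple without any rescaling.\<close>
  have "exp_density 1 (t + s) = exp (- s) * exp_density 1 (1 * t)" for t
    by (simp add: exp_density_def flip: exp_add)
  then show "\<exists>c>0. \<exists>\<kappa>>0. \<forall>t\<ge>0. exp_density 1 (t + s) = c * exp_density 1 (\<kappa> * t)"
    using zero_less_one exp_gt_zero by blast
next
  show p: "exp_density 1 0 > 0" by (simp add: exp_density_def)
  fix e :: real assume "e > 0"
  then show "\<exists>\<delta>>0. \<forall>u\<in>{0..\<delta>}. \<bar>exp_density 1 u - exp_density 1 0\<bar> \<le> e * exp_density 1 0"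
    using p by (intro continuous_near_0) (auto simp: exp_density_def intro!: continuous_intros)
qed fact

lemma shift_conv_imp_all:
  assumes \<Omega>: "\<Omega> \<noteq> {}" and pow: "power_density \<rho>"
    and conv: "unif_conv \<Omega> (\<lambda>T. V (shift_density \<rho> T)) U at_top"
    and "prob_density \<mu>"
  shows "unif_conv \<Omega> (\<lambda>l. V (scale_density \<mu> l)) U (at_right 0)"
proof -
  from pow obtain \<alpha> \<beta> \<gamma> where \<alpha>: "\<alpha> > 0" and \<beta>: "\<beta> > 0" and pd: "prob_density \<rho>"
    and \<rho>: "\<And>t. t \<ge> 0 \<Longrightarrow> \<rho> t = (\<alpha> + \<beta> * t) powr (- \<gamma>)"
    unfolding power_density_def by blast
  show ?thesis
  proof (rule unif_conv_all_densities[OF \<Omega> pd conv[unfolded shift_conv_iff[OF pow]]])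
    show "(1 :: real) > 0" by simp
    fix s :: real assume "s \<in> {0..1}"
    then have s: "s \<ge> 0" by simp
    have pos: "\<alpha> + \<beta> * s > 0" using \<alpha> \<beta> s by (simp add: add_pos_nonneg)
    then have "\<alpha> / (\<alpha> + \<beta> * s) > 0" "inverse (\<alpha> / (\<alpha> + \<beta> * s)) powr (- \<gamma>) > 0"
      using \<alpha> by auto
    with power_shift_eq[OF \<alpha> \<beta> s _ \<rho>]
    show "\<exists>c>0. \<exists>\<kappa>>0. \<forall>t\<ge>0. \<rho> (t + s) = c * \<rho> (\<kappa> * t)" by blast
  next
    show p: "\<rho> 0 > 0" using \<alpha> by (simp add: \<rho>)
    have "continuous_on {0..} (\<lambda>t. (\<alpha> + \<beta> * t) powr (- \<gamma>))"
    proof (intro continuous_intros ballI)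
      fix t :: real assume "t \<in> {0..}"
      then have "\<alpha> + \<beta> * t > 0" using \<alpha> \<beta> by (intro add_pos_nonneg) auto
      then show "\<alpha> + \<beta> * t \<noteq> 0" by simp
    qed
    then have "continuous_on {0..} \<rho>" by (rule continuous_on_eq) (simp add: \<rho>)
    then show "\<exists>\<delta>>0. \<forall>u\<in>{0..\<delta>}. \<bar>\<rho> u - \<rho> 0\<bar> \<le> e * \<rho> 0" if "e > 0" for e
      using p that by (rule continuous_near_0)
  qed fact
qed

end

text \<open>Allows condition (c) to be applied to the uniform density itself.\<close>

lemma piecewise_cont_uniform: "piecewise_cont_pos (uniform_density 1)"
  unfolding piecewise_cont_pos_def
proof (intro allI impI)
  fix c d :: real assume "0 < c"
  have cont: "isCont (uniform_density 1) t" if "0 < t" "t \<noteq> 1" for t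
  proof (cases "t < 1")
    case True
    have "\<forall>\<^sub>F u in nhds t. uniform_density 1 u = 1"
      using eventually_nhds_in_open[of "{0<..<1}" t] True that
      by (auto elim!: eventually_mono simp: uniform_density_def)
    then show ?thesis by (subst isCont_cong) auto
  next
    case False
    have "\<forall>\<^sub>F u in nhds t. uniform_density 1 u = 0"
      using eventually_nhds_in_open[of "{1<..}" t] False that
      by (auto elim!: eventually_mono simp: uniform_density_def)
    then show ?thesis by (subst isCont_cong) auto
  qed
  have "t = 1" if "t \<in> {c..d}" "\<not> isCont (uniform_density 1) t" for t
  proof (rule ccontr)
    assume "t \<noteq> 1"
    moreover have "0 < t" using that(1) \<open>0 < c\<close> by simp
    ultimately show False using cont that(2) by blast
  qed
  then have "{t \<in> {c..d}. \<not> isCont (uniform_density 1) t} \<subseteq> {1}" by blast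
  then show "finite {t \<in> {c..d}. \<not> isCont (uniform_density 1) t}" by (rule finite_subset) simp
qed

theorem theorem4:
  fixes A :: "'a::euclidean_space set" and B :: "'b::euclidean_space set"
    and f :: "'x::euclidean_space \<Rightarrow> 'a \<Rightarrow> 'b \<Rightarrow> 'x"
    and g :: "'x \<Rightarrow> 'a \<Rightarrow> 'b \<Rightarrow> real"
    and L :: real and \<Omega> :: "'x set"
  assumes A: "compact A" "A \<noteq> {}"
    and B: "compact B" "B \<noteq> {}"
    and f_cont: "continuous_on (UNIV \<times> A \<times> B) (\<lambda>(x, a, b). f x a b)"
    and g_cont: "continuous_on (UNIV \<times> A \<times> B) (\<lambda>(x, a, b). g x a b)"
    and g_range: "\<And>x a b. a \<in> A \<Longrightarrow> b \<in> B \<Longrightarrow> g x a b \<in> {0..1}"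
    and L: "L > 0"
    and Lip: "\<And>x y a b. a \<in> A \<Longrightarrow> b \<in> B \<Longrightarrow>
               norm (f x a b - f y a b) + \<bar>g x a b - g y a b\<bar> \<le> L * norm (x - y)"
    and \<Omega>_ne: "\<Omega> \<noteq> {}"
    and \<Omega>_inv: "\<And>x0 a b t. x0 \<in> \<Omega> \<Longrightarrow> control A a \<Longrightarrow> control B b \<Longrightarrow> t \<ge> 0 \<Longrightarrow>
               traj f x0 a b t \<in> \<Omega>"
  shows
    "(\<forall>U. (\<forall>\<omega>\<in>\<Omega>. U \<omega> \<in> {0..1}) \<longrightarrow>
       (let V = game_value A B f g;
            C = (\<forall>\<mu>. prob_density \<mu> \<and> piecewise_cont_pos \<mu> \<longrightarrow>
                   unif_conv \<Omega> (\<lambda>l. V (scale_density \<mu> l)) U (at_right 0));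
            Uu = unif_conv \<Omega> (\<lambda>T. V (uniform_density T)) U at_top;
            E = unif_conv \<Omega> (\<lambda>l. V (exp_density l)) U (at_right 0);
            P = (\<exists>\<rho>. power_density \<rho> \<and> unif_conv \<Omega> (\<lambda>T. V (shift_density \<rho> T)) U at_top);
            Q = (\<forall>\<rho>. power_density \<rho> \<longrightarrow> unif_conv \<Omega> (\<lambda>T. V (shift_density \<rho> T)) U at_top)
        in (C \<longleftrightarrow> Uu) \<and> (Uu \<longleftrightarrow> E) \<and> (E \<longleftrightarrow> P) \<and> (P \<longleftrightarrow> Q)))
   \<and>
    (\<forall>\<mu> \<rho>. prob_density \<mu> \<longrightarrow> piecewise_cont_pos \<mu> \<longrightarrow> power_density \<rho> \<longrightarrow>
       (\<exists>W. unif_conv \<Omega> (\<lambda>T. game_value A B f g (uniform_density T)) W at_top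
          \<or> unif_conv \<Omega> (\<lambda>l. game_value A B f g (exp_density l)) W (at_right 0)
          \<or> unif_conv \<Omega> (\<lambda>T. game_value A B f g (shift_density \<rho> T)) W at_top) \<longrightarrow>
       (\<exists>U. unif_conv \<Omega> (\<lambda>T. game_value A B f g (uniform_density T)) U at_top
          \<and> unif_conv \<Omega> (\<lambda>l. game_value A B f g (exp_density l)) U (at_right 0)
          \<and> (\<forall>\<rho>'. power_density \<rho>' \<longrightarrow>
               unif_conv \<Omega> (\<lambda>T. game_value A B f g (shift_density \<rho>' T)) U at_top)
          \<and> (\<forall>\<mu>'. prob_density \<mu>' \<and> piecewise_cont_pos \<mu>' \<longrightarrow>
               unif_conv \<Omega> (\<lambda>l. game_value A B f g (scale_density \<mu>' l)) U (at_right 0))))"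
proof -
  interpret differential_game A B f g L
    by unfold_locales (fact A B f_cont g_cont g_range L Lip)+
  define conv where "conv U \<mu> \<longleftrightarrow> unif_conv \<Omega> (\<lambda>l. V (scale_density \<mu> l)) U (at_right 0)" for U \<mu>
  let ?u = "\<lambda>U. unif_conv \<Omega> (\<lambda>T. V (uniform_density T)) U at_top"
  let ?e = "\<lambda>U. unif_conv \<Omega> (\<lambda>l. V (exp_density l)) U (at_right 0)"
  let ?s = "\<lambda>U \<rho>. unif_conv \<Omega> (\<lambda>T. V (shift_density \<rho> T)) U at_top"
  have u: "?u U \<longleftrightarrow> conv U (uniform_density 1)" for U
    unfolding conv_def by (rule uniform_conv_iff)
  have e: "?e U \<longleftrightarrow> conv U (exp_density 1)" for U
    unfolding conv_def by (rule exp_conv_iff)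
  have s: "?s U \<rho> \<longleftrightarrow> conv U \<rho>" if "power_density \<rho>" for U \<rho>
    unfolding conv_def by (rule shift_conv_iff[OF that])
  have pow: "prob_density \<rho>" if "power_density \<rho>" for \<rho> using that by (simp add: power_density_def)
  \<comment> \<open>One convergent family yields every density. The locale is interpreted inside
    because \<open>U\<close> varies.\<close>
  have all: "conv U \<mu>"
    if U: "\<forall>\<omega>\<in>\<Omega>. U \<omega> \<in> {0..1}" and lim: "?u U \<or> ?e U \<or> (\<exists>\<rho>. power_density \<rho> \<and> ?s U \<rho>)"
      and \<mu>: "prob_density \<mu>" for U \<mu>
  proof -
    interpret invariant_game A B f g L \<Omega> U
    proof
      show "traj f x0 a b t \<in> \<Omega>" if "x0 \<in> \<Omega>" "control A a" "control B b" "t \<ge> 0" for x0 a b t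
        using that by (rule \<Omega>_inv)
      show "U \<omega> \<in> {0..1}" if "\<omega> \<in> \<Omega>" for \<omega> using U that by blast
    qed
    show ?thesis
      using lim uniform_conv_imp_all[OF \<Omega>_ne _ \<mu>] exp_conv_imp_all[OF \<Omega>_ne _ \<mu>]
        shift_conv_imp_all[OF \<Omega>_ne _ _ \<mu>] unfolding conv_def by blast
  qed
  show ?thesis
  proof (intro conjI allI impI, goal_cases)
    case (1 U)
    then have U: "\<forall>\<omega>\<in>\<Omega>. U \<omega> \<in> {0..1}" .
    \<comment> \<open>Each of the five conditions is shown equivalent to \<open>D\<close>.\<close>
    define D where "D \<longleftrightarrow> (\<forall>\<mu>. prob_density \<mu> \<longrightarrow> conv U \<mu>)"
    have C: "(\<forall>\<mu>. prob_density \<mu> \<and> piecewise_cont_pos \<mu> \<longrightarrow> conv U \<mu>) \<longleftrightarrow> D"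
      using all[OF U] u prob_density_uniform piecewise_cont_uniform unfolding D_def by blast
    have Uu: "?u U \<longleftrightarrow> D"
      using all[OF U] u prob_density_uniform unfolding D_def by blast
    have E: "?e U \<longleftrightarrow> D"
      using all[OF U] e prob_density_exp unfolding D_def by blast
    have P: "(\<exists>\<rho>. power_density \<rho> \<and> ?s U \<rho>) \<longleftrightarrow> D"
      using all[OF U] s pow ex_power_density unfolding D_def by blast
    have Q: "(\<forall>\<rho>. power_density \<rho> \<longrightarrow> ?s U \<rho>) \<longleftrightarrow> D"
      using P s pow ex_power_density unfolding D_def by blast
    show ?case
      unfolding Let_def conv_def[symmetric] C Uu E P Q by simp
  next
    case (2 \<mu> \<rho>)
    then obtain W where W: "?u W \<or> ?e W \<or> ?s W \<rho>" by blast
    \<comment> \<open>\<open>W\<close> is only known to satisfy \<open>unif_conv\<close>. If it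
      leaves \<open>[0, 1]\<close> somewhere, the hypothesis holds merely through the default
      supremum, and it then holds for all densities alike.\<close>
    have "conv W \<mu>'" if \<mu>': "prob_density \<mu>'" for \<mu>'
    proof (cases "\<forall>\<omega>\<in>\<Omega>. W \<omega> \<in> {0..1}")
      case True
      then show ?thesis using all[OF True _ \<mu>'] W 2(3) by blast
    next
      case False
      obtain \<mu>0 where "prob_density \<mu>0" "conv W \<mu>0"
        using W u e s[OF 2(3)] prob_density_uniform prob_density_exp pow[OF 2(3)] by blast
      then show ?thesis
        unfolding conv_def using unif_conv_degenerate_limit[OF \<Omega>_ne _ \<mu>' _ False] by blast
    qed
    then have "?u W \<and> ?e W \<and> (\<forall>\<rho>'. power_density \<rho>' \<longrightarrow> ?s W \<rho>')
        \<and> (\<forall>\<mu>'. prob_density \<mu>' \<and> piecewise_cont_pos \<mu>' \<longrightarrow> conv W \<mu>')"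
      using u e s pow prob_density_uniform prob_density_exp by blast
    then show ?case unfolding conv_def by blast
  qed
qed

end
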